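(* Let $n\ge2$, let $I_{\mathrm A}\subset S$ be the Plücker ideal of the partial flag variety $F_{\mathrm A}\subset\mathbb{P}_{\mathrm A}$, let $\pi:S\to\mathbb{C}[\Theta]$ be the projection, let $\widetilde I=\pi(I_{\mathrm A})$, and let $\widetilde F$ be the variety cut out by $\widetilde I$. Then $\widetilde F$ is a type A Schubert variety in $F_{\mathrm A}$: the ideal $\pi^{-1}(\widetilde I)\subset S$, which cuts out $\widetilde F$ in $\mathbb{P}_{\mathrm A}$, is the defining ideal of the Schubert variety in $F_{\mathrm A}$ corresponding to the Borel subgroup of $SL(\mathbb{C}^N)$ given by the ordering $\lessdot'$ of $N$ and the torus-fixed point $y\in F_{\mathrm A}$ all of whose multihomogeneous coordinates are zero except for $y_{-1,\dots,-k}$ with $k\in[1,n]$.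
   Context: **Index set.** $(N,\lessdot)$ is the totally ordered set $\{1\lessdot\dots\lessdot n\lessdot -n\lessdot\dots\lessdot -1\}$. A second total order on $N$ is $-1\lessdot'1\lessdot'-2\lessdot'2\lessdot'\dots\lessdot'-n\lessdot' n$. A tuple $(i_1,\dots,i_k)$ of elements of $N$ is *admissible* if for every $l\in[1,n]$ the number of its elements with $|i_j|\le l$ does not exceed $l$. $\Theta$ is the set of admissible tuples with $i_1\lessdot\dots\lessdot i_k$ ($k\in[1,n]$), $\Theta_k\subset\Theta$ the subset of $k$-tuples, and $\mathbb{C}[\Theta]=\mathbb{C}[X_{i_1,\dots,i_k}]_{(i_1,\dots,i_k)\in\Theta}$. **Flag variety.** $\mathbb{C}^N\simeq\mathbb{C}^{2n}$ has basis $\{e_i\}_{i\in N}$. $F_{\mathrm A}$ is the variety of partial flags in $\mathbb{C}^N$ of signature $(1,\dots,n)$ (subspaces of dimensions $1,\dots,n$), Plücker-embedded in $\mathbb{P}_{\mathrm A}=\mathbb{P}(\wedge^1\mathbb{C}^N)\times\dots\times\mathbb{P}(\wedge^n\mathbb{C}^N)$, whose multihomogeneous coordinate ring is $S=\mathbb{C}[X_{i_1,\dots,i_k}]_{k\in[1,n],\{i_1\lessdot\dots\lessdot i_k\}\subset N}$ (with $X_{i_1,\dots,i_k}$ the coordinate dual to $e_{i_1}\wedge\dots\wedge e_{i_k}$); $I_{\mathrm A}\subset S$ is its Plücker (vanishing) ideal. $\pi:S\to\mathbb{C}[\Theta]$ is the surjection mapping all $X_{i_1,\dots,i_k}\notin\mathbb{C}[\Theta]$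 to $0$ and fixing $\mathbb{C}[\Theta]$. $\widetilde F$ is the zero set of $\widetilde I$ in the multiprojective space $\prod_{k=1}^n\mathbb{P}(\mathbb{C}^{\Theta_k})$ with coordinate ring $\mathbb{C}[\Theta]$, which is regarded via $\pi$ as the coordinate subspace of $\mathbb{P}_{\mathrm A}$ where all $X_{i_1,\dots,i_k}\notin\mathbb{C}[\Theta]$ vanish. **Schubert variety.** The torus is the group of diagonal matrices in the basis $\{e_i\}$; $y$ is the flag with $k$-dimensional subspace $\mathrm{span}(e_{-1},\dots,e_{-k})$. The Borel subgroup is the one stabilizing all subspaces $\mathrm{span}\{e_j: j=i\text{ or }i\lessdot' j\}$, $i\in N$, and the Schubert variety is the closure in $F_{\mathrm A}$ of the orbit of $y$ under this Borel subgroup. *)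

theory Defs
  imports
    Complex_Main
    "HOL-Library.FuncSet"
    "HOL-Library.Function_Algebras"
    "HOL-Library.Poly_Mapping"
    "Jordan_Normal_Form.Determinant"
begin

section \<open>The index set and admissible tuples\<close>

definition N :: "nat \<Rightarrow> int set" where
  "N n = {1..int n} \<union> {- int n..-1}"

text \<open>\<open>1 < \<dots> < n < -n < \<dots> < -1\<close>\<close>

definition ord_lt :: "int \<Rightarrow> int \<Rightarrow> bool" where
  "ord_lt i j \<longleftrightarrow> (0 < i \<and> j < 0) \<or> ((0 < i \<longleftrightarrow> 0 < j) \<and> i < j)"

text \<open>\<open>-1 < 1 < -2 < 2 < \<dots> < -n < n\<close>\<close>

definition ord_lt' :: "int \<Rightarrow> int \<Rightarrow> bool" where
  "ord_lt' i j \<longleftrightarrow> \<bar>i\<bar> < \<bar>j\<bar> \<or> (\<bar>i\<bar> = \<bar>j\<bar> \<and> i < j)"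

definition tuples :: "nat \<Rightarrow> int list set" where
  "tuples n = {t. set t \<subseteq> N n \<and> length t \<in> {1..n} \<and> sorted_wrt ord_lt t}"

definition admissible :: "nat \<Rightarrow> int list \<Rightarrow> bool" where
  "admissible n t \<longleftrightarrow> (\<forall>l\<in>{1..n}. length (filter (\<lambda>i. \<bar>i\<bar> \<le> int l) t) \<le> l)"

definition Theta :: "nat \<Rightarrow> int list set" where
  "Theta n = {t \<in> tuples n. admissible n t}"

section \<open>Polynomials in variables indexed by tuples\<close>

text \<open>A monomial maps each variable to its exponent; a polynomial maps each monomial to its
  coefficient.  Multiplication on \<open>mpoly\<close> is the convolution product of \<open>Poly_Mapping\<close>.\<close>

type_synonym mpoly = "(int list \<Rightarrow>\<^sub>0 nat) \<Rightarrow>\<^sub>0 complex"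

definition Const :: "complex \<Rightarrow> mpoly" where
  "Const c = Poly_Mapping.single 0 c"

definition Var :: "int list \<Rightarrow> mpoly" where
  "Var t = Poly_Mapping.single (Poly_Mapping.single t 1) 1"

definition poly_ring :: "int list set \<Rightarrow> mpoly set" where
  "poly_ring D = {f. \<forall>m\<in>Poly_Mapping.keys f. Poly_Mapping.keys m \<subseteq> D}"

text \<open>The ring homomorphism extending \<open>h\<close> on coefficients and sending the variable \<open>t\<close>
  to \<open>a t\<close>.\<close>

definition poly_hom :: "(complex \<Rightarrow> 'a) \<Rightarrow> (int list \<Rightarrow> 'a) \<Rightarrow> mpoly \<Rightarrow> 'a::comm_ring_1" where
  "poly_hom h a f =
    (\<Sum>m\<in>Poly_Mapping.keys f. h (Poly_Mapping.lookup f m) *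
       (\<Prod>t\<in>Poly_Mapping.keys m. a t ^ Poly_Mapping.lookup m t))"

definition eval_at :: "(int list \<Rightarrow> complex) \<Rightarrow> mpoly \<Rightarrow> complex" where
  "eval_at x f = poly_hom (\<lambda>c. c) x f"

definition proj_Theta :: "nat \<Rightarrow> mpoly \<Rightarrow> mpoly" where
  "proj_Theta n = poly_hom Const (\<lambda>t. if t \<in> Theta n then Var t else 0)"

section \<open>Multiprojective spaces\<close>

text \<open>Let \<open>D\<close> be a set of tuples of lengths \<open>1, \<dots>, n\<close>, and \<open>D\<^sub>k\<close> its subset of \<open>k\<close>-tuples.
  A point of the product over \<open>k = 1, \<dots>, n\<close> of the projective spaces of \<open>\<complex>\<^bsup>D\<^sub>k\<^esup>\<close> is the set of all
  its vectors of multihomogeneous coordinates.  Such a vector is extended by zero outside \<open>D\<close>,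
  so for \<open>D \<subseteq> E\<close> the space of \<open>D\<close> literally is a coordinate subspace of the space of \<open>E\<close>.\<close>

type_synonym mpoint = "(int list \<Rightarrow> complex) set"

definition scaling_class :: "(int list \<Rightarrow> complex) \<Rightarrow> mpoint" where
  "scaling_class x = {\<lambda>t. c (length t) * x t | c :: nat \<Rightarrow> complex. \<forall>k. c k \<noteq> 0}"

definition multiproj :: "nat \<Rightarrow> int list set \<Rightarrow> mpoint set" where
  "multiproj n D = {scaling_class x | x.
     (\<forall>t. t \<notin> D \<longrightarrow> x t = 0) \<and> (\<forall>k\<in>{1..n}. \<exists>t\<in>D. length t = k \<and> x t \<noteq> 0)}"

definition vanishes_at :: "mpoly \<Rightarrow> mpoint \<Rightarrow> bool" where
  "vanishes_at f P \<longleftrightarrow> (\<forall>x\<in>P. eval_at x f = 0)"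

definition zero_locus :: "nat \<Rightarrow> int list set \<Rightarrow> mpoly set \<Rightarrow> mpoint set" where
  "zero_locus n D I = {P \<in> multiproj n D. \<forall>f\<in>I. vanishes_at f P}"

text \<open>Since a polynomial is required to vanish at all coordinate vectors of the points, this is
  the same as the ideal generated by the vanishing multihomogeneous polynomials.\<close>

definition vanishing_ideal :: "int list set \<Rightarrow> mpoint set \<Rightarrow> mpoly set" where
  "vanishing_ideal D Z = {f \<in> poly_ring D. \<forall>P\<in>Z. vanishes_at f P}"

definition zariski_closed :: "nat \<Rightarrow> int list set \<Rightarrow> mpoint set \<Rightarrow> bool" where
  "zariski_closed n D C \<longleftrightarrow> (\<exists>T \<subseteq> poly_ring D. C = zero_locus n D T)"

definition zariski_closure :: "nat \<Rightarrow> int list set \<Rightarrow> mpoint set \<Rightarrow> mpoint set" where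
  "zariski_closure n D Z = \<Inter>{C. zariski_closed n D C \<and> Z \<subseteq> C}"

section \<open>The flag variety\<close>

type_synonym cvec = "int \<Rightarrow> complex"

global_interpretation cvec: vector_space "\<lambda>(c::complex) (v::cvec) i. c * v i"
  by unfold_locales (auto simp: fun_eq_iff algebra_simps)

definition CN :: "nat \<Rightarrow> cvec set" where
  "CN n = {v. \<forall>i. i \<notin> N n \<longrightarrow> v i = 0}"

definition e :: "int \<Rightarrow> cvec" where
  "e i = (\<lambda>j. if j = i then 1 else 0)"

definition flags :: "nat \<Rightarrow> (nat \<Rightarrow> cvec set) set" where
  "flags n = {V \<in> {1..n} \<rightarrow>\<^sub>E {U. cvec.subspace U \<and> U \<subseteq> CN n}.
     (\<forall>k\<in>{1..n}. cvec.dim (V k) = k) \<and> (\<forall>k\<in>{1..<n}. V k \<subseteq> V (Suc k))}"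

definition is_basis :: "cvec list \<Rightarrow> cvec set \<Rightarrow> bool" where
  "is_basis bs U \<longleftrightarrow> distinct bs \<and> cvec.independent (set bs) \<and> cvec.span (set bs) = U"

text \<open>The coefficient of \<open>e t\<^sub>1 \<and> \<dots> \<and> e t\<^sub>k\<close> in the exterior product of the \<open>k\<close> vectors \<open>bs\<close>,
  where \<open>k\<close> is the length of \<open>t\<close>.\<close>

definition wedge_coord :: "cvec list \<Rightarrow> int list \<Rightarrow> complex" where
  "wedge_coord bs t = det (mat (length t) (length t) (\<lambda>(r, c). (bs ! r) (t ! c)))"

text \<open>As the basis of \<open>V k\<close> varies, the exterior product of its vectors takes all nonzero values on
  the line it spans; these choices are independent for different \<open>k\<close>.  So \<open>plucker n V\<close> is one whole
  scaling class, i.e. a point of \<open>multiproj n (tuples n)\<close>.\<close>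

definition plucker :: "nat \<Rightarrow> (nat \<Rightarrow> cvec set) \<Rightarrow> mpoint" where
  "plucker n V = {\<lambda>t. if t \<in> tuples n then wedge_coord (b (length t)) t else 0 | b.
     \<forall>k\<in>{1..n}. is_basis (b k) (V k)}"

definition flag_variety :: "nat \<Rightarrow> mpoint set" where
  "flag_variety n = plucker n ` flags n"

definition plucker_ideal :: "nat \<Rightarrow> mpoly set" where
  "plucker_ideal n = vanishing_ideal (tuples n) (flag_variety n)"

section \<open>The Schubert variety\<close>

text \<open>Matrices with rows and columns indexed by \<open>N n\<close>; the entries outside are irrelevant.\<close>

type_synonym cmat = "int \<Rightarrow> int \<Rightarrow> complex"

definition N_list :: "nat \<Rightarrow> int list" where
  "N_list n = [1..int n] @ [- int n..-1]"

definition SL :: "nat \<Rightarrow> cmat set" where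
  "SL n = {g. det (mat (2 * n) (2 * n) (\<lambda>(r, c). g (N_list n ! r) (N_list n ! c))) = 1}"

definition act :: "nat \<Rightarrow> cmat \<Rightarrow> cvec \<Rightarrow> cvec" where
  "act n g v = (\<lambda>i. if i \<in> N n then (\<Sum>j\<in>N n. g i j * v j) else 0)"

definition flag_act :: "nat \<Rightarrow> cmat \<Rightarrow> (nat \<Rightarrow> cvec set) \<Rightarrow> (nat \<Rightarrow> cvec set)" where
  "flag_act n g V = (\<lambda>k\<in>{1..n}. act n g ` V k)"

definition torus :: "nat \<Rightarrow> cmat set" where
  "torus n = {g \<in> SL n. \<forall>i\<in>N n. \<forall>j\<in>N n. i \<noteq> j \<longrightarrow> g i j = 0}"

definition borel :: "nat \<Rightarrow> cmat set" where
  "borel n = {g \<in> SL n. \<forall>i\<in>N n.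
     let U = cvec.span (e ` {j \<in> N n. j = i \<or> ord_lt' i j}) in act n g ` U = U}"

definition y_flag :: "nat \<Rightarrow> (nat \<Rightarrow> cvec set)" where
  "y_flag n = (\<lambda>k\<in>{1..n}. cvec.span (e ` {- int k..-1}))"

definition schubert_variety :: "nat \<Rightarrow> mpoint set" where
  "schubert_variety n = flag_variety n \<inter>
     zariski_closure n (tuples n) {plucker n (flag_act n g (y_flag n)) | g. g \<in> borel n}"

section \<open>The degenerate variety\<close>

definition I_tilde :: "nat \<Rightarrow> mpoly set" where
  "I_tilde n = proj_Theta n ` plucker_ideal n"

definition F_tilde :: "nat \<Rightarrow> mpoint set" where
  "F_tilde n = zero_locus n (Theta n) (I_tilde n)"

definition I_tilde_preimage :: "nat \<Rightarrow> mpoly set" where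
  "I_tilde_preimage n = {f \<in> poly_ring (tuples n). proj_Theta n f \<in> I_tilde n}"

end

theory Submission
  imports Defs "HOL-Computational_Algebra.Polynomial"
begin

text \<open>
  Order \<open>N\<close> by \<open>ord_lt'\<close>, and let \<open>I\<close> be the Pluecker ideal.  The flags in the Borel orbit of \<open>y\<close> are spanned
  by the rows of a matrix whose \<open>i\<close>-th row is supported on the indices \<open>j\<close> with \<open>\<bar>j\<bar> \<ge> i\<close>.  A minor of the generic such matrix
  on a column set \<open>t\<close> vanishes unless \<open>t\<close> is admissible, and if \<open>t\<close> is admissible its leading monomial
  is the diagonal one.  Hence the products of admissible columns forming a semistandard tableau have
  distinct leading monomials and are linearly independent on the orbit.  On the other hand,
  by the Garnir relations every polynomial is, modulo \<open>I\<close>, a combination of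
  semistandard products, and those with an inadmissible column are killed by \<open>\<pi>\<close>.  So a polynomial
  vanishing on the orbit lies in the ideal \<open>\<pi>\<^sup>-\<^sup>1(\<pi>(I))\<close>, and the converse inclusion is clear.
  Since \<open>I\<close> cuts out the flag variety, the zero sets agree as well.
\<close>

section \<open>Polynomials as a ring\<close>

text \<open>Two orders on the indices compete: coordinates are labelled by tuples sorted by
  \<open>ord_lt\<close>, whereas tableaux and the Borel group follow \<open>ord_lt'\<close>.
  Coordinates are therefore extended to arbitrary index lists, with the sign kept in
  \<open>delta\<close>, and columns are re-sorted by \<open>csort\<close> only where they are
  compared. For a tuple, admissibility amounts to the \<open>i\<close>-th smallest entry, counted
  from 0, having absolute value above \<open>i\<close>; this is what makes the diagonal term of the
  minor on the orbit survive. Leading monomials are compared without a monomial order on matrix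
  entries: the entry with number \<open>e\<close> is replaced by \<open>z ^ (D ^ e)\<close>, and
  degrees in the single variable \<open>z\<close> decide. The base \<open>D\<close> has to exceed
  \<open>n\<close>, so that the diagonal term dominates within one minor, and also the degree of
  every monomial at hand, so that the row contents of a tableau can be read off as digits. It is
  thus chosen only after the polynomial is known. Equality of ideals does not by itself place the
  zeros in the flag variety, since the Schubert variety is defined inside it; this comes from
  reconstructing a flag from coordinates satisfying the exchange relations.\<close>

definition ring_map :: "(complex \<Rightarrow> 'a::comm_ring_1) \<Rightarrow> bool" where
  "ring_map h \<longleftrightarrow> h 0 = 0 \<and> h 1 = 1 \<and> (\<forall>a b. h (a + b) = h a + h b) \<and> (\<forall>a b. h (a * b) = h a * h b)"

text \<open>The target ring is left general: it is instantiated with numbers (evaluation), with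
  \<open>mpoly\<close> (the projection) and with polynomials in one variable (the curve).\<close>

definition mon_val :: "(int list \<Rightarrow> 'a::comm_ring_1) \<Rightarrow> (int list \<Rightarrow>\<^sub>0 nat) \<Rightarrow> 'a" where
  "mon_val a m = (\<Prod>t\<in>Poly_Mapping.keys m. a t ^ Poly_Mapping.lookup m t)"

lemma mon_val_superset:
  assumes "finite A" "Poly_Mapping.keys m \<subseteq> A"
  shows "mon_val a m = (\<Prod>t\<in>A. a t ^ Poly_Mapping.lookup m t)"
  unfolding mon_val_def using assms
  by (intro prod.mono_neutral_left) (auto simp: in_keys_iff)

lemma mon_val_0 [simp]: "mon_val a 0 = 1"
  by (simp add: mon_val_def)

lemma mon_val_add: "mon_val a (m + m') = mon_val a m * mon_val a m'"
proof -
  let ?A = "Poly_Mapping.keys m \<union> Poly_Mapping.keys m'"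
  have "Poly_Mapping.keys (m + m') \<subseteq> ?A" by (rule keys_add)
  then show ?thesis
    by (simp add: mon_val_superset[where A = ?A] lookup_add power_add prod.distrib)
qed

lemma mon_val_single: "mon_val a (Poly_Mapping.single t k) = a t ^ k"
  by (cases "k = 0") (simp_all add: mon_val_def)

lemma poly_hom_eq: "poly_hom h a f = (\<Sum>m\<in>Poly_Mapping.keys f. h (Poly_Mapping.lookup f m) * mon_val a m)"
  by (simp add: poly_hom_def mon_val_def)

lemma poly_hom_superset:
  assumes "h 0 = 0" "finite A" "Poly_Mapping.keys f \<subseteq> A"
  shows "poly_hom h a f = (\<Sum>m\<in>A. h (Poly_Mapping.lookup f m) * mon_val a m)"
  unfolding poly_hom_eq using assms
  by (intro sum.mono_neutral_left) (auto simp: in_keys_iff)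

lemma poly_hom_0 [simp]: "poly_hom h a 0 = 0"
  by (simp add: poly_hom_def)

lemma poly_hom_single:
  assumes "ring_map h"
  shows "poly_hom h a (Poly_Mapping.single m c) = h c * mon_val a m"
  using assms by (cases "c = 0") (simp_all add: poly_hom_eq ring_map_def)

lemma poly_hom_add:
  assumes "ring_map h"
  shows "poly_hom h a (f + g) = poly_hom h a f + poly_hom h a g"
proof -
  let ?A = "Poly_Mapping.keys f \<union> Poly_Mapping.keys g"
  have "Poly_Mapping.keys (f + g) \<subseteq> ?A" by (rule keys_add)
  with assms show ?thesis
    by (simp add: ring_map_def poly_hom_superset[where A = ?A] lookup_add sum.distrib algebra_simps)
qed

lemma poly_hom_sum:
  assumes "ring_map h"
  shows "poly_hom h a (\<Sum>i\<in>A. f i) = (\<Sum>i\<in>A. poly_hom h a (f i))"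
  by (induction A rule: infinite_finite_induct) (auto simp: poly_hom_add[OF assms])

text \<open>Stated for arbitrary finite maps because it is applied both to polynomials and to
  exponent vectors.\<close>

lemma poly_sum_singles:
  fixes f :: "'b \<Rightarrow>\<^sub>0 'c::comm_monoid_add"
  assumes "finite A" "Poly_Mapping.keys f \<subseteq> A"
  shows "f = (\<Sum>m\<in>A. Poly_Mapping.single m (Poly_Mapping.lookup f m))"
proof (rule poly_mapping_eqI)
  fix k
  have "Poly_Mapping.lookup (\<Sum>m\<in>A. Poly_Mapping.single m (Poly_Mapping.lookup f m)) k =
    (\<Sum>m\<in>A. if m = k then Poly_Mapping.lookup f m else 0)"
    by (auto simp: lookup_sum lookup_single when_def intro!: sum.cong)
  also have "\<dots> = Poly_Mapping.lookup f k"
    using assms by (auto simp: sum.delta in_keys_iff)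
  finally show "Poly_Mapping.lookup f k = Poly_Mapping.lookup (\<Sum>m\<in>A. Poly_Mapping.single m (Poly_Mapping.lookup f m)) k" ..
qed

lemma poly_hom_mult:
  assumes "ring_map h"
  shows "poly_hom h a (f * g) = poly_hom h a f * poly_hom h a g"
proof -
  let ?F = "Poly_Mapping.keys f" and ?G = "Poly_Mapping.keys g"
  let ?l = "Poly_Mapping.lookup" and ?s = "Poly_Mapping.single"
  have "f * g = (\<Sum>m\<in>?F. ?s m (?l f m)) * (\<Sum>m\<in>?G. ?s m (?l g m))"
    using poly_sum_singles[of ?F f] poly_sum_singles[of ?G g] by simp
  also have "\<dots> = (\<Sum>m\<in>?F. \<Sum>m'\<in>?G. ?s (m + m') (?l f m * ?l g m'))"
    by (simp add: sum_product mult_single)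
  finally have "poly_hom h a (f * g) = (\<Sum>m\<in>?F. \<Sum>m'\<in>?G. h (?l f m * ?l g m') * mon_val a (m + m'))"
    by (simp add: poly_hom_sum[OF assms] poly_hom_single[OF assms])
  also have "\<dots> = (\<Sum>m\<in>?F. \<Sum>m'\<in>?G. (h (?l f m) * mon_val a m) * (h (?l g m') * mon_val a m'))"
    using assms by (intro sum.cong refl) (simp add: ring_map_def mon_val_add)
  also have "\<dots> = poly_hom h a f * poly_hom h a g"
    by (simp add: poly_hom_eq sum_product)
  finally show ?thesis .
qed

lemma ring_map_id: "ring_map (\<lambda>c::complex. c)"
  by (simp add: ring_map_def)

lemma ring_map_Const: "ring_map Const"
  by (simp add: ring_map_def Const_def single_add mult_single)

lemmas poly_hom_Const = poly_hom_single[where m = 0, folded Const_def]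

lemma poly_hom_Var: "ring_map h \<Longrightarrow> poly_hom h a (Var t) = a t"
  by (simp add: Var_def poly_hom_single mon_val_single ring_map_def)

lemma poly_hom_uminus:
  assumes "ring_map h"
  shows "poly_hom h a (- f) = - poly_hom h a f"
proof -
  have "poly_hom h a (f + - f) = poly_hom h a f + poly_hom h a (- f)"
    by (rule poly_hom_add[OF assms])
  then show ?thesis by (simp add: eq_neg_iff_add_eq_0 add.commute)
qed

lemma poly_hom_diff:
  assumes "ring_map h"
  shows "poly_hom h a (f - g) = poly_hom h a f - poly_hom h a g"
  using poly_hom_add[OF assms, of a f "- g"] by (simp add: poly_hom_uminus[OF assms])

lemma eval_at_simps [simp]:
  "eval_at x 0 = 0"
  "eval_at x (f + g) = eval_at x f + eval_at x g"
  "eval_at x (f - g) = eval_at x f - eval_at x g"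
  "eval_at x (f * g) = eval_at x f * eval_at x g"
  "eval_at x (Const c) = c"
  "eval_at x (Var t) = x t"
  "eval_at x (sum F A) = (\<Sum>i\<in>A. eval_at x (F i))"
  by (simp_all add: eval_at_def poly_hom_add poly_hom_diff poly_hom_mult poly_hom_sum poly_hom_Var
      poly_hom_Const ring_map_id)

lemma eval_at_single: "eval_at x (Poly_Mapping.single m c) = c * mon_val x m"
  by (simp add: eval_at_def poly_hom_single ring_map_id)

section \<open>Polynomials in a given set of variables\<close>

lemma poly_ring_0: "0 \<in> poly_ring D"
  by (simp add: poly_ring_def)

lemma poly_ring_Const: "Const c \<in> poly_ring D"
  by (simp add: poly_ring_def Const_def)

lemma poly_ring_Var: "t \<in> D \<Longrightarrow> Var t \<in> poly_ring D"
  by (simp add: poly_ring_def Var_def)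

lemma poly_ring_add: "f \<in> poly_ring D \<Longrightarrow> g \<in> poly_ring D \<Longrightarrow> f + g \<in> poly_ring D"
  using keys_add[of f g] by (auto simp: poly_ring_def)

lemma poly_ring_uminus: "f \<in> poly_ring D \<Longrightarrow> - f \<in> poly_ring D"
  by (simp add: poly_ring_def in_keys_iff)

lemma poly_ring_diff: "f \<in> poly_ring D \<Longrightarrow> g \<in> poly_ring D \<Longrightarrow> f - g \<in> poly_ring D"
  using poly_ring_add[of f D "- g"] poly_ring_uminus[of g D] by simp

lemma poly_ring_mult:
  assumes "f \<in> poly_ring D" "g \<in> poly_ring D"
  shows "f * g \<in> poly_ring D"
  unfolding poly_ring_def
proof (intro CollectI ballI)
  fix m assume "m \<in> Poly_Mapping.keys (f * g)"
  then obtain a b where "m = a + b" "a \<in> Poly_Mapping.keys f" "b \<in> Poly_Mapping.keys g"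
    using keys_mult[of f g] by auto
  then have "Poly_Mapping.keys m \<subseteq> Poly_Mapping.keys a \<union> Poly_Mapping.keys b"
    "Poly_Mapping.keys a \<subseteq> D" "Poly_Mapping.keys b \<subseteq> D"
    using assms keys_add[of a b] by (auto simp: poly_ring_def)
  then show "Poly_Mapping.keys m \<subseteq> D" by blast
qed

lemma poly_ring_sum: "(\<And>i. i \<in> A \<Longrightarrow> F i \<in> poly_ring D) \<Longrightarrow> sum F A \<in> poly_ring D"
  by (induction A rule: infinite_finite_induct) (auto simp: poly_ring_0 poly_ring_add)

lemma poly_ring_single: "c \<noteq> 0 \<Longrightarrow> Poly_Mapping.single m c \<in> poly_ring D \<longleftrightarrow> Poly_Mapping.keys m \<subseteq> D"
  by (simp add: poly_ring_def)

section \<open>The projection onto the admissible variables\<close>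

lemma Theta_subset: "Theta n \<subseteq> tuples n"
  by (auto simp: Theta_def)

lemma proj_Theta_add: "proj_Theta n (f + g) = proj_Theta n f + proj_Theta n g"
  by (simp add: proj_Theta_def poly_hom_add ring_map_Const)

lemma mon_val_Var: "mon_val Var m = Poly_Mapping.single m 1"
proof -
  have pow: "Var t ^ k = Poly_Mapping.single (Poly_Mapping.single t k) 1" for t k
    by (induction k) (simp_all add: Var_def mult_single single_add[symmetric])
  have prod: "finite A \<Longrightarrow> (\<Prod>t\<in>A. Poly_Mapping.single (F t) (1::complex)) = Poly_Mapping.single (\<Sum>t\<in>A. F t) 1" for A :: "int list set" and F :: "int list \<Rightarrow> int list \<Rightarrow>\<^sub>0 nat"
    by (induction A rule: finite_induct) (simp_all add: mult_single)
  show ?thesis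
    unfolding mon_val_def pow using poly_sum_singles[of "Poly_Mapping.keys m" m]
    by (simp add: prod)
qed

text \<open>A single inadmissible variable contributes a factor 0 and kills the monomial; otherwise
  nothing changes. So the projection merely deletes terms.\<close>

lemma proj_Theta_single:
  "proj_Theta n (Poly_Mapping.single m c) =
    (if Poly_Mapping.keys m \<subseteq> Theta n then Poly_Mapping.single m c else 0)"
proof -
  have "proj_Theta n (Poly_Mapping.single m c) = Const c * mon_val (\<lambda>t. if t \<in> Theta n then Var t else 0) m"
    by (simp add: proj_Theta_def poly_hom_single ring_map_Const)
  also have "mon_val (\<lambda>t. if t \<in> Theta n then Var t else 0) m =
     (if Poly_Mapping.keys m \<subseteq> Theta n then mon_val Var m else 0)"
  proof (cases "Poly_Mapping.keys m \<subseteq> Theta n")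
    case True
    then show ?thesis by (auto simp: mon_val_def intro!: prod.cong)
  next
    case False
    then obtain t where "t \<in> Poly_Mapping.keys m" "t \<notin> Theta n" by blast
    then have "(\<Prod>t\<in>Poly_Mapping.keys m. (if t \<in> Theta n then Var t else 0) ^ Poly_Mapping.lookup m t) = 0"
      by (intro prod_zero) (auto simp: zero_power in_keys_iff)
    with False show ?thesis by (simp add: mon_val_def)
  qed
  finally show ?thesis
    by (simp add: mon_val_Var Const_def mult_single)
qed

lemma proj_Theta_eq:
  "proj_Theta n f = (\<Sum>m | m \<in> Poly_Mapping.keys f \<and> Poly_Mapping.keys m \<subseteq> Theta n.
     Poly_Mapping.single m (Poly_Mapping.lookup f m))"
proof -
  have "proj_Theta n f = proj_Theta n (\<Sum>m\<in>Poly_Mapping.keys f. Poly_Mapping.single m (Poly_Mapping.lookup f m))"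
    using poly_sum_singles[of "Poly_Mapping.keys f" f] by simp
  also have "\<dots> = (\<Sum>m\<in>Poly_Mapping.keys f. proj_Theta n (Poly_Mapping.single m (Poly_Mapping.lookup f m)))"
    by (simp add: proj_Theta_def poly_hom_sum ring_map_Const)
  also have "\<dots> = (\<Sum>m | m \<in> Poly_Mapping.keys f \<and> Poly_Mapping.keys m \<subseteq> Theta n.
     Poly_Mapping.single m (Poly_Mapping.lookup f m))"
    unfolding proj_Theta_single by (intro sum.mono_neutral_cong_right) auto
  finally show ?thesis .
qed

lemma lookup_proj_Theta:
  "Poly_Mapping.lookup (proj_Theta n f) m = (if Poly_Mapping.keys m \<subseteq> Theta n then Poly_Mapping.lookup f m else 0)"
  unfolding proj_Theta_eq
  by (auto simp: lookup_sum lookup_single when_def sum.delta in_keys_iff)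

lemma proj_Theta_Var: "proj_Theta n (Var t) = (if t \<in> Theta n then Var t else 0)"
  by (simp add: Var_def proj_Theta_single)

text \<open>Each deleted term contains a coordinate that is 0 at \<open>x\<close>. At points
  supported on \<open>Theta n\<close>, polynomials with equal projections are therefore
  interchangeable.\<close>

lemma eval_at_proj_Theta:
  assumes "\<And>t. t \<notin> Theta n \<Longrightarrow> x t = 0"
  shows "eval_at x (proj_Theta n f) = eval_at x f"
proof -
  have 0: "mon_val x m = 0" if "\<not> Poly_Mapping.keys m \<subseteq> Theta n" for m
    using that assms by (fastforce simp: mon_val_def zero_power in_keys_iff)
  have "eval_at x f = (\<Sum>m\<in>Poly_Mapping.keys f. Poly_Mapping.lookup f m * mon_val x m)"
    by (simp add: eval_at_def poly_hom_eq)
  also have "\<dots> = (\<Sum>m | m \<in> Poly_Mapping.keys f \<and> Poly_Mapping.keys m \<subseteq> Theta n. Poly_Mapping.lookup f m * mon_val x m)"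
    using 0 by (intro sum.mono_neutral_right) auto
  also have "\<dots> = eval_at x (proj_Theta n f)"
    by (simp add: proj_Theta_eq eval_at_single)
  finally show ?thesis ..
qed

section \<open>Vanishing ideals\<close>

lemma vanishing_ideal_ops:
  "0 \<in> vanishing_ideal D Z"
  "f \<in> vanishing_ideal D Z \<Longrightarrow> g \<in> vanishing_ideal D Z \<Longrightarrow> f + g \<in> vanishing_ideal D Z"
  "f \<in> vanishing_ideal D Z \<Longrightarrow> g \<in> poly_ring D \<Longrightarrow> g * f \<in> vanishing_ideal D Z"
  by (auto simp: vanishing_ideal_def vanishes_at_def poly_ring_0 poly_ring_add poly_ring_mult)

section \<open>Minors\<close>

text \<open>The rows form an unbounded family, of which a list of length \<open>k\<close> uses the
  first \<open>k\<close>; one matrix thus serves columns of all lengths. The ring is general so that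
  entries may be polynomials.\<close>

definition minor :: "(nat \<Rightarrow> int \<Rightarrow> 'a::comm_ring_1) \<Rightarrow> int list \<Rightarrow> 'a" where
  "minor F P = det (mat (length P) (length P) (\<lambda>(r, c). F r (P ! c)))"

text \<open>If \<open>P\<close> rearranges the duplicate-free list \<open>S\<close>, this is the sign by which their minors differ.\<close>

definition delta :: "int list \<Rightarrow> int list \<Rightarrow> 'a::comm_ring_1" where
  "delta S P = minor (\<lambda>r j. if S ! r = j then 1 else 0) P"

lemma wedge_coord_minor: "wedge_coord bs t = minor (\<lambda>r. bs ! r) t"
  by (simp add: wedge_coord_def minor_def)

lemma minor_cong:
  assumes "\<And>r j. r < length P \<Longrightarrow> j \<in> set P \<Longrightarrow> F r j = G r j"
  shows "minor F P = minor G P"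
  unfolding minor_def using assms by (intro arg_cong[where f = det] eq_matI) auto

lemma minor_row_change:
  assumes "\<And>r j. r < length P \<Longrightarrow> j \<in> set P \<Longrightarrow> F r j = (\<Sum>a<length P. C r a * G a j)"
  shows "minor F P = det (mat (length P) (length P) (\<lambda>(r, a). C r a)) * minor G P"
proof -
  let ?k = "length P"
  have "mat ?k ?k (\<lambda>(r, c). F r (P ! c)) = mat ?k ?k (\<lambda>(r, a). C r a) * mat ?k ?k (\<lambda>(r, c). G r (P ! c))"
    using assms by (intro eq_matI) (auto simp: scalar_prod_def atLeast0LessThan intro!: sum.cong)
  then show ?thesis
    unfolding minor_def by (simp add: det_mult[where n = ?k])
qed

text \<open>Selecting columns from \<open>S\<close> is right multiplication by a 0/1 matrix with
  determinant \<open>delta S P\<close>. Repetitions in \<open>P\<close> are allowed.\<close>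

lemma minor_delta:
  assumes "distinct S" "length P = length S" "set P \<subseteq> set S"
  shows "minor F P = minor F S * delta S P"
proof -
  let ?k = "length S"
  let ?A = "mat ?k ?k (\<lambda>(r, c). F r (S ! c))"
  let ?D = "mat ?k ?k (\<lambda>(r, c). if S ! r = P ! c then 1 else 0)"
  have "mat ?k ?k (\<lambda>(r, c). F r (P ! c)) = ?A * ?D"
  proof (rule eq_matI)
    fix i j assume ij: "i < dim_row (?A * ?D)" "j < dim_col (?A * ?D)"
    then have "P ! j \<in> set S" using assms by (auto simp: subset_iff)
    then obtain l where l: "l < ?k" "S ! l = P ! j" by (auto simp: in_set_conv_nth)
    have "(?A * ?D) $$ (i, j) = (\<Sum>m<?k. F i (S ! m) * (if S ! m = P ! j then 1 else 0))"
      using ij by (auto simp: scalar_prod_def atLeast0LessThan intro!: sum.cong)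
    also have "\<dots> = (\<Sum>m<?k. if m = l then F i (S ! m) else 0)"
      using l assms(1) by (intro sum.cong refl) (auto simp flip: l(2) simp: nth_eq_iff_index_eq)
    also have "\<dots> = F i (P ! j)" using l by simp
    finally show "mat ?k ?k (\<lambda>(r, c). F r (P ! c)) $$ (i, j) = (?A * ?D) $$ (i, j)"
      using ij by simp
  qed auto
  then show ?thesis
    unfolding minor_def delta_def assms(2) by (simp add: det_mult[where n = ?k])
qed

lemma minor_not_distinct:
  assumes "\<not> distinct P"
  shows "minor F P = 0"
proof -
  obtain i j where ij: "i < length P" "j < length P" "i \<noteq> j" "P ! i = P ! j"
    using assms by (auto simp: distinct_conv_nth)
  show ?thesis unfolding minor_def
    by (rule det_identical_columns[where n = "length P" and i = i and j = j])
       (use ij in \<open>auto intro!: eq_vecI\<close>)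
qed

lemma delta_self:
  assumes "distinct S"
  shows "delta S S = (1::'a::comm_ring_1)"
proof -
  have "mat (length S) (length S) (\<lambda>(r, c). if S ! r = S ! c then 1 else 0) = (1\<^sub>m (length S) :: 'a mat)"
    using assms by (intro eq_matI) (auto simp: nth_eq_iff_index_eq)
  then show ?thesis by (simp add: delta_def minor_def)
qed

lemma delta_trans:
  assumes "distinct S" "length P = length S" "set P \<subseteq> set S"
  shows "delta R P = delta R S * delta S P"
  using minor_delta[OF assms] by (simp add: delta_def)

text \<open>Invertibility replaces a computation of the sign: a unit is nonzero, and as a polynomial
  over the complex numbers it is constant.\<close>

lemma delta_inverse:
  assumes "distinct S" "distinct P" "set P = set S"
  shows "delta S P * delta P S = (1::'a::comm_ring_1)"
proof -
  have "length P = length S" using assms by (metis distinct_card)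
  then show ?thesis
    using delta_trans[of P S S, where 'a = 'a] delta_self[of S, where 'a = 'a] assms by simp
qed

lemma minor_not_subset:
  assumes "c < length P" "\<And>r. r < length P \<Longrightarrow> F r (P ! c) = 0"
  shows "minor F P = 0"
proof -
  have "minor F P = (\<Sum>i<length P. mat (length P) (length P) (\<lambda>(r, c). F r (P ! c)) $$ (i, c)
      * cofactor (mat (length P) (length P) (\<lambda>(r, c). F r (P ! c))) i c)"
    unfolding minor_def by (rule laplace_expansion_column) (use assms in auto)
  also have "\<dots> = 0" using assms by (intro sum.neutral) auto
  finally show ?thesis .
qed

text \<open>Laplace expansion along column \<open>s\<close>: the cofactors do not see that column,
  so the dependence on \<open>x\<close> is linear with fixed coefficients.\<close>

lemma minor_update:
  assumes "s < length P"
  shows "minor F (P[s := x]) =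
    (\<Sum>b<length P. F b x * cofactor (mat (length P) (length P) (\<lambda>(r, c). F r (P ! c))) b s)"
proof -
  let ?k = "length P"
  let ?A = "mat ?k ?k (\<lambda>(r, c). F r (P ! c))" and ?B = "mat ?k ?k (\<lambda>(r, c). F r (P[s := x] ! c))"
  have cof: "cofactor ?B b s = cofactor ?A b s" if "b < ?k" for b
  proof -
    have "mat_delete ?B b s = mat_delete ?A b s"
      unfolding mat_delete_def using that assms by (intro eq_matI) auto
    then show ?thesis by (simp add: cofactor_def)
  qed
  have "minor F (P[s := x]) = (\<Sum>b<?k. ?B $$ (b, s) * cofactor ?B b s)"
    unfolding minor_def length_list_update by (rule laplace_expansion_column) (use assms in auto)
  also have "\<dots> = (\<Sum>b<?k. F b x * cofactor ?A b s)"
    using assms cof by (intro sum.cong) auto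
  finally show ?thesis .
qed

text \<open>Cramer's rule, obtained from row \<open>a\<close> of the identity
  \<open>A * adj A = det A * 1\<close>.\<close>

lemma minor_cramer:
  assumes "a < length P"
  shows "(\<Sum>i<length P. F a (P ! i) * minor F (P[i := q])) = minor F P * F a q"
proof -
  let ?k = "length P"
  let ?A = "mat ?k ?k (\<lambda>(r, c). F r (P ! c))"
  have adj: "(\<Sum>i<?k. F a (P ! i) * cofactor ?A b i) = (if a = b then minor F P else 0)" if "b < ?k" for b
  proof -
    have "(\<Sum>i<?k. F a (P ! i) * cofactor ?A b i) = (?A * adj_mat ?A) $$ (a, b)"
      using assms that by (auto simp: scalar_prod_def adj_mat_def atLeast0LessThan intro!: sum.cong)
    also have "\<dots> = (det ?A \<cdot>\<^sub>m 1\<^sub>m ?k) $$ (a, b)"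
      by (subst adj_mat(2)[of ?A ?k]) auto
    finally show ?thesis using assms that by (simp add: minor_def)
  qed
  have "(\<Sum>i<?k. F a (P ! i) * minor F (P[i := q])) = (\<Sum>i<?k. \<Sum>b<?k. F b q * (F a (P ! i) * cofactor ?A b i))"
    by (intro sum.cong refl) (simp add: minor_update sum_distrib_left algebra_simps)
  also have "\<dots> = (\<Sum>b<?k. F b q * (\<Sum>i<?k. F a (P ! i) * cofactor ?A b i))"
    by (subst sum.swap) (simp add: sum_distrib_left)
  also have "\<dots> = (\<Sum>b<?k. if a = b then F b q * minor F P else 0)"
    using adj by (intro sum.cong) auto
  also have "\<dots> = minor F P * F a q"
    using assms by (simp add: mult.commute)
  finally show ?thesis .
qed

text \<open>The Pluecker exchange relation. Expanding along column \<open>s\<close> makes it linear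
  in the rows of \<open>G\<close>; these lie in the row span of \<open>F\<close>, where Cramer's
  rule applies.\<close>

lemma minor_exchange:
  assumes s: "s < length Q"
    and G: "\<And>r j. r < length Q \<Longrightarrow> G r j = (\<Sum>a<length P. C r a * F a j)"
  shows "minor F P * minor G Q = (\<Sum>i<length P. minor F (P[i := Q ! s]) * minor G (Q[s := P ! i]))"
proof -
  let ?k = "length P"
  define cf where "cf r = cofactor (mat (length Q) (length Q) (\<lambda>(r, c). G r (Q ! c))) r s" for r
  have upd: "minor G (Q[s := x]) = (\<Sum>r<length Q. G r x * cf r)" for x
    unfolding cf_def by (rule minor_update[OF s])
  have G_cramer: "(\<Sum>i<?k. G r (P ! i) * minor F (P[i := q])) = minor F P * G r q" if "r < length Q" for r q
  proof -
    have "(\<Sum>i<?k. G r (P ! i) * minor F (P[i := q])) =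
        (\<Sum>i<?k. \<Sum>a<?k. C r a * (F a (P ! i) * minor F (P[i := q])))"
      using that by (simp add: G sum_distrib_right mult.assoc)
    also have "\<dots> = (\<Sum>a<?k. C r a * (\<Sum>i<?k. F a (P ! i) * minor F (P[i := q])))"
      by (subst sum.swap) (simp add: sum_distrib_left)
    also have "\<dots> = (\<Sum>a<?k. C r a * (minor F P * F a q))"
      by (intro sum.cong) (auto simp: minor_cramer)
    also have "\<dots> = minor F P * G r q"
      using that by (simp add: G sum_distrib_left algebra_simps)
    finally show ?thesis .
  qed
  have "(\<Sum>i<?k. minor F (P[i := Q ! s]) * minor G (Q[s := P ! i])) =
      (\<Sum>i<?k. \<Sum>r<length Q. cf r * (G r (P ! i) * minor F (P[i := Q ! s])))"
    by (intro sum.cong) (auto simp: upd sum_distrib_left algebra_simps)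
  also have "\<dots> = (\<Sum>r<length Q. cf r * (\<Sum>i<?k. G r (P ! i) * minor F (P[i := Q ! s])))"
    by (subst sum.swap) (simp add: sum_distrib_left)
  also have "\<dots> = minor F P * (\<Sum>r<length Q. G r (Q ! s) * cf r)"
    using G_cramer by (simp add: sum_distrib_left algebra_simps)
  also have "\<dots> = minor F P * minor G Q"
    using upd[of "Q ! s"] by simp
  finally show ?thesis ..
qed

section \<open>Garnir relations\<close>

text \<open>A form alternating in more than \<open>k\<close> vectors of a \<open>k\<close>-dimensional space vanishes.\<close>

lemma alternating_sum_zero:
  fixes T :: "nat \<Rightarrow> nat \<Rightarrow> complex"
  assumes fin: "finite U" and card: "card U > k"
    and T: "\<And>j i. j \<in> U \<Longrightarrow> T j i = (\<Sum>a<k. c j a * B a i)"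
  shows "(\<Sum>\<sigma> | \<sigma> permutes U. of_int (sign \<sigma>) * (\<Prod>j\<in>U. T j (\<sigma> j))) = 0"
proof -
  \<comment> \<open>Writing every vector in terms of the \<open>k\<close> rows of \<open>B\<close>
    gives one summand per map \<open>f\<close>. By the pigeonhole principle \<open>f\<close> takes
    the same value at some \<open>x\<close> and \<open>y\<close>, and composing with their
    transposition reverses the sign of the sum.\<close>
  have zero: "(\<Sum>\<sigma> | \<sigma> permutes U. of_int (sign \<sigma>) * (\<Prod>j\<in>U. B (f j) (\<sigma> j))) = 0" (is "?S = 0")
    if f: "f \<in> U \<rightarrow>\<^sub>E {..<k}" for f
  proof -
    have "\<not> inj_on f U"
    proof
      assume "inj_on f U"
      then have "card U \<le> card {..<k}" using f by (intro card_inj_on_le) auto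
      with card show False by simp
    qed
    then obtain x y where xy: "x \<in> U" "y \<in> U" "x \<noteq> y" "f x = f y"
      by (auto simp: inj_on_def)
    let ?t = "transpose x y"
    have t: "?t permutes U" using xy by (simp add: permutes_swap_id)
    have "?S = (\<Sum>\<sigma> | \<sigma> permutes U. of_int (sign (\<sigma> \<circ> ?t)) * (\<Prod>j\<in>U. B (f j) ((\<sigma> \<circ> ?t) j)))"
      by (rule sum_permutations_compose_right[OF t])
    also have "\<dots> = (\<Sum>\<sigma> | \<sigma> permutes U. - (of_int (sign \<sigma>) * (\<Prod>j\<in>U. B (f j) (\<sigma> j))))"
    proof (rule sum.cong)
      fix \<sigma> assume "\<sigma> \<in> {\<sigma>. \<sigma> permutes U}"
      then have \<sigma>: "\<sigma> permutes U" by simp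
      have sg: "sign (\<sigma> \<circ> ?t) = - sign \<sigma>"
        using permutation_permutes[of \<sigma>] fin \<sigma> t xy(3)
        by (subst sign_compose) (auto simp: sign_swap_id permutation_permutes)
      have "(\<Prod>j\<in>U. B (f j) ((\<sigma> \<circ> ?t) j)) = (\<Prod>j\<in>U. B (f (?t j)) ((\<sigma> \<circ> ?t) (?t j)))"
        using prod.permute[OF t, of "\<lambda>j. B (f j) ((\<sigma> \<circ> ?t) j)"] by (simp add: o_def)
      also have "\<dots> = (\<Prod>j\<in>U. B (f j) (\<sigma> j))"
      proof (rule prod.cong)
        fix j
        have "f (?t j) = f j" using xy(4) by (cases "j = x"; cases "j = y") simp_all
        then show "B (f (?t j)) ((\<sigma> \<circ> ?t) (?t j)) = B (f j) (\<sigma> j)" by simp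
      qed simp
      finally show "of_int (sign (\<sigma> \<circ> ?t)) * (\<Prod>j\<in>U. B (f j) ((\<sigma> \<circ> ?t) j)) =
          - (of_int (sign \<sigma>) * (\<Prod>j\<in>U. B (f j) (\<sigma> j)))"
        by (simp add: sg)
    qed simp
    also have "\<dots> = - ?S" by (simp add: sum_negf)
    finally show ?thesis by simp
  qed
  have "(\<Prod>j\<in>U. T j (\<sigma> j)) = (\<Sum>f\<in>U \<rightarrow>\<^sub>E {..<k}. (\<Prod>j\<in>U. c j (f j)) * (\<Prod>j\<in>U. B (f j) (\<sigma> j)))" for \<sigma>
    using prod_sum_PiE[OF fin, of "\<lambda>_. {..<k}" "\<lambda>j a. c j a * B a (\<sigma> j)"] T
    by (simp add: prod.distrib)
  then have "(\<Sum>\<sigma> | \<sigma> permutes U. of_int (sign \<sigma>) * (\<Prod>j\<in>U. T j (\<sigma> j))) =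
    (\<Sum>\<sigma> | \<sigma> permutes U. \<Sum>f\<in>U \<rightarrow>\<^sub>E {..<k}. (\<Prod>j\<in>U. c j (f j)) * (of_int (sign \<sigma>) * (\<Prod>j\<in>U. B (f j) (\<sigma> j))))"
    by (simp add: sum_distrib_left algebra_simps)
  also have "\<dots> = (\<Sum>f\<in>U \<rightarrow>\<^sub>E {..<k}. (\<Prod>j\<in>U. c j (f j)) *
      (\<Sum>\<sigma> | \<sigma> permutes U. of_int (sign \<sigma>) * (\<Prod>j\<in>U. B (f j) (\<sigma> j))))"
    by (subst sum.swap) (simp add: sum_distrib_left)
  also have "\<dots> = 0" by (simp add: zero)
  finally show ?thesis .
qed

text \<open>A product of two minors is the determinant of a block diagonal matrix, so that the columns of
  both can be permuted together.\<close>

definition block_entry ::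
  "nat \<Rightarrow> (nat \<Rightarrow> int \<Rightarrow> complex) \<Rightarrow> (nat \<Rightarrow> int \<Rightarrow> complex) \<Rightarrow> nat \<Rightarrow> nat \<Rightarrow> int \<Rightarrow> complex" where
  "block_entry k F G i j x = (if i < k then if j < k then F i x else 0 else if j < k then 0 else G (i - k) x)"

lemma minor_mult_block:
  fixes F G :: "nat \<Rightarrow> int \<Rightarrow> complex"
  shows "minor F (map w [0..<k]) * minor G (map w [k..<k + l]) =
    det (mat (k + l) (k + l) (\<lambda>(i, j). block_entry k F G i j (w j)))"
proof -
  let ?A = "mat k k (\<lambda>(i, j). F i (w j))" and ?B = "mat l l (\<lambda>(i, j). G i (w (k + j)))"
  have "mat (k + l) (k + l) (\<lambda>(i, j). block_entry k F G i j (w j)) = four_block_mat ?A (0\<^sub>m k l) (0\<^sub>m l k) ?B"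
    by (intro eq_matI) (auto simp: block_entry_def)
  then have "det (mat (k + l) (k + l) (\<lambda>(i, j). block_entry k F G i j (w j))) = det ?A * det ?B"
    by (simp add: det_four_block_mat_lower_left_zero[where n = k and m = l])
  also have "det ?A = minor F (map w [0..<k])"
    unfolding minor_def by (intro arg_cong[where f = det] eq_matI) auto
  also have "det ?B = minor G (map w [k..<k + l])"
    unfolding minor_def by (intro arg_cong[where f = det] eq_matI) auto
  finally show ?thesis ..
qed

text \<open>The zero pattern of the block matrix only depends on the blocks of row and column, which
  \<open>\<sigma>\<close> respects. Permuting the labels is then the same as permuting
  columns.\<close>

lemma minor_mult_permute:
  fixes F G :: "nat \<Rightarrow> int \<Rightarrow> complex"
  assumes \<sigma>: "\<sigma> permutes {0..<k + l}" and im: "\<And>j. j < k + l \<Longrightarrow> \<sigma> j < k \<longleftrightarrow> j < k"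
  shows "minor F (map (w \<circ> \<sigma>) [0..<k]) * minor G (map (w \<circ> \<sigma>) [k..<k + l]) =
    of_int (sign \<sigma>) * (minor F (map w [0..<k]) * minor G (map w [k..<k + l]))"
proof -
  let ?n = "k + l"
  let ?A = "mat ?n ?n (\<lambda>(i, j). block_entry k F G i j (w j))"
  let ?B = "mat ?n ?n (\<lambda>(i, j). block_entry k F G i j ((w \<circ> \<sigma>) j))"
  have lt: "j < ?n \<Longrightarrow> \<sigma> j < ?n" for j
    using permutes_in_image[OF \<sigma>, of j] by simp
  have "?B = transpose_mat (mat ?n ?n (\<lambda>(i, j). transpose_mat ?A $$ (\<sigma> i, j)))"
    using lt im by (intro eq_matI) (auto simp: block_entry_def)
  then have "det ?B = det (mat ?n ?n (\<lambda>(i, j). transpose_mat ?A $$ (\<sigma> i, j)))"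
    by (simp add: det_transpose[where n = ?n])
  also have "\<dots> = of_int (sign \<sigma>) * det (transpose_mat ?A)"
    by (rule det_permute_rows[OF _ \<sigma>]) auto
  also have "\<dots> = of_int (sign \<sigma>) * det ?A"
    by (simp add: det_transpose[where n = ?n])
  finally show ?thesis by (simp add: minor_mult_block)
qed

text \<open>In the Leibniz expansion of the block determinant, the zero pattern is a factor
  \<open>ok p\<close> that is independent of \<open>\<sigma>\<close>. What depends on
  \<open>\<sigma>\<close> alternates in more than \<open>k\<close> vectors of the span of the
  \<open>k\<close> rows of \<open>F\<close>.\<close>

lemma garnir_relation:
  fixes F G :: "nat \<Rightarrow> int \<Rightarrow> complex"
  assumes U: "U \<subseteq> {0..<k + l}" and card: "card U > k"
    and G: "\<And>r x. r < l \<Longrightarrow> G r x = (\<Sum>a<k. C r a * F a x)"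
  shows "(\<Sum>\<sigma> | \<sigma> permutes U. of_int (sign \<sigma>) *
    (minor F (map (w \<circ> \<sigma>) [0..<k]) * minor G (map (w \<circ> \<sigma>) [k..<k + l]))) = 0"
proof -
  let ?n = "k + l"
  define R where "R i x = (if i < k then F i x else G (i - k) x)" for i x
  define D where "D i a = (if i < k then if a = i then 1 else 0 else C (i - k) a)" for i a :: nat
  have R: "R i x = (\<Sum>a<k. D i a * F a x)" if "i < ?n" for i x
  proof (cases "i < k")
    case True
    then have "(\<Sum>a<k. D i a * F a x) = (\<Sum>a<k. if a = i then F a x else 0)"
      by (intro sum.cong) (auto simp: D_def)
    with True show ?thesis by (simp add: R_def)
  next
    case False
    with that show ?thesis by (simp add: R_def D_def G)
  qed
  have finU: "finite U" using U by (rule finite_subset) simp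
  define ok where "ok p = (\<Prod>j<?n. if (p j < k) = (j < k) then 1 else 0::complex)" for p :: "nat \<Rightarrow> nat"
  have det: "det (mat ?n ?n (\<lambda>(i, j). block_entry k F G i j ((w \<circ> \<sigma>) j))) =
    (\<Sum>p | p permutes {0..<?n}. of_int (sign p) * ok p * (\<Prod>j<?n. R (p j) (w (\<sigma> j))))" for \<sigma>
  proof -
    have "det (mat ?n ?n (\<lambda>(i, j). block_entry k F G i j ((w \<circ> \<sigma>) j))) =
      (\<Sum>p | p permutes {0..<?n}. of_int (sign p) *
         (\<Prod>j<?n. mat ?n ?n (\<lambda>(i, j). block_entry k F G i j ((w \<circ> \<sigma>) j)) $$ (p j, j)))"
      by (rule det_col) auto
    also have "\<dots> = (\<Sum>p | p permutes {0..<?n}. of_int (sign p) * ok p * (\<Prod>j<?n. R (p j) (w (\<sigma> j))))"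
    proof (rule sum.cong)
      fix p assume "p \<in> {p. p permutes {0..<?n}}"
      then have "p j < ?n" if "j < ?n" for j using that permutes_in_image[of p "{0..<?n}" j] by simp
      then have "(\<Prod>j<?n. mat ?n ?n (\<lambda>(i, j). block_entry k F G i j ((w \<circ> \<sigma>) j)) $$ (p j, j)) =
        (\<Prod>j<?n. (if (p j < k) = (j < k) then 1 else 0) * R (p j) (w (\<sigma> j)))"
        by (intro prod.cong) (auto simp: block_entry_def R_def)
      then show "of_int (sign p) * (\<Prod>j<?n. mat ?n ?n (\<lambda>(i, j). block_entry k F G i j ((w \<circ> \<sigma>) j)) $$ (p j, j)) =
         of_int (sign p) * ok p * (\<Prod>j<?n. R (p j) (w (\<sigma> j)))"
        by (simp add: ok_def prod.distrib)
    qed simp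
    finally show ?thesis .
  qed
  have inner: "(\<Sum>\<sigma> | \<sigma> permutes U. of_int (sign \<sigma>) * (\<Prod>j<?n. R (p j) (w (\<sigma> j)))) = 0"
    if p: "p permutes {0..<?n}" for p
  proof -
    have lt: "p j < ?n" if "j \<in> U" for j using that U permutes_in_image[OF p, of j] by auto
    have *: "(\<Prod>j<?n. R (p j) (w (\<sigma> j))) = (\<Prod>j\<in>{..<?n} - U. R (p j) (w j)) * (\<Prod>j\<in>U. R (p j) (w (\<sigma> j)))"
      if "\<sigma> permutes U" for \<sigma>
    proof -
      have "(\<Prod>j<?n. R (p j) (w (\<sigma> j))) = (\<Prod>j\<in>{..<?n} - U. R (p j) (w (\<sigma> j))) * (\<Prod>j\<in>U. R (p j) (w (\<sigma> j)))"
        using U by (intro prod.subset_diff) auto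
      also have "(\<Prod>j\<in>{..<?n} - U. R (p j) (w (\<sigma> j))) = (\<Prod>j\<in>{..<?n} - U. R (p j) (w j))"
        using permutes_not_in[OF that] by (intro prod.cong) auto
      finally show ?thesis .
    qed
    have "(\<Sum>\<sigma> | \<sigma> permutes U. of_int (sign \<sigma>) * (\<Prod>j<?n. R (p j) (w (\<sigma> j)))) =
      (\<Prod>j\<in>{..<?n} - U. R (p j) (w j)) * (\<Sum>\<sigma> | \<sigma> permutes U. of_int (sign \<sigma>) * (\<Prod>j\<in>U. R (p j) (w (\<sigma> j))))"
      unfolding sum_distrib_left by (intro sum.cong) (auto simp: *)
    also have "(\<Sum>\<sigma> | \<sigma> permutes U. of_int (sign \<sigma>) * (\<Prod>j\<in>U. R (p j) (w (\<sigma> j)))) = 0"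
      by (rule alternating_sum_zero[OF finU card, where c = "\<lambda>j. D (p j)" and B = "\<lambda>a i. F a (w i)"
            and T = "\<lambda>j i. R (p j) (w i)"]) (use R lt in auto)
    finally show ?thesis by simp
  qed
  have "(\<Sum>\<sigma> | \<sigma> permutes U. of_int (sign \<sigma>) *
      (minor F (map (w \<circ> \<sigma>) [0..<k]) * minor G (map (w \<circ> \<sigma>) [k..<k + l]))) =
    (\<Sum>\<sigma> | \<sigma> permutes U. \<Sum>p | p permutes {0..<?n}.
       of_int (sign p) * ok p * (of_int (sign \<sigma>) * (\<Prod>j<?n. R (p j) (w (\<sigma> j)))))"
    unfolding minor_mult_block det by (simp add: sum_distrib_left algebra_simps)
  also have "\<dots> = (\<Sum>p | p permutes {0..<?n}. of_int (sign p) * ok p *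
      (\<Sum>\<sigma> | \<sigma> permutes U. of_int (sign \<sigma>) * (\<Prod>j<?n. R (p j) (w (\<sigma> j)))))"
    by (subst sum.swap) (simp add: sum_distrib_left)
  also have "\<dots> = 0" by (simp add: inner)
  finally show ?thesis .
qed

section \<open>Sorted tuples\<close>

text \<open>The position of an index in \<open>ord_lt\<close>, from 1 to \<open>2 * n\<close>, as an
  integer key for sorting.\<close>

definition pos :: "nat \<Rightarrow> int \<Rightarrow> int" where
  "pos n i = (if 0 < i then i else 2 * int n + 1 + i)"

definition srt :: "nat \<Rightarrow> int list \<Rightarrow> int list" where
  "srt n P = sort_key (pos n) P"

text \<open>A numerical key for \<open>ord_lt'\<close>: \<open>-l\<close> goes to
  \<open>2 * l\<close> and \<open>l\<close> to \<open>2 * l + 1\<close>, so halving recovers the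
  absolute value.\<close>

definition code :: "int \<Rightarrow> nat" where
  "code i = 2 * nat \<bar>i\<bar> + (if 0 < i then 1 else 0)"

definition csort :: "int list \<Rightarrow> int list" where
  "csort P = sort_key code P"

lemma finite_N: "finite (N n)"
  by (simp add: N_def)

lemma pos_less: "i \<in> N n \<Longrightarrow> j \<in> N n \<Longrightarrow> pos n i < pos n j \<longleftrightarrow> ord_lt i j"
  by (auto simp: pos_def N_def ord_lt_def)

lemma pos_inj: "i \<in> N n \<Longrightarrow> j \<in> N n \<Longrightarrow> pos n i = pos n j \<longleftrightarrow> i = j"
  by (auto simp: pos_def N_def)

lemma code_inj: "code i = code j \<longleftrightarrow> i = j"
proof
  assume "code i = code j"
  then have "code i mod 2 = code j mod 2" "code i div 2 = code j div 2" by simp_all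
  then show "i = j" by (auto simp: code_def split: if_splits)
qed simp

lemma code_less: "i \<noteq> 0 \<Longrightarrow> j \<noteq> 0 \<Longrightarrow> code i < code j \<longleftrightarrow> ord_lt' i j"
  by (auto simp: code_def ord_lt'_def)

lemma N_nonzero: "i \<in> N n \<Longrightarrow> i \<noteq> 0"
  by (auto simp: N_def)

lemma code_bounds: "i \<in> N n \<Longrightarrow> 2 \<le> code i \<and> code i \<le> 2 * n + 1"
  by (auto simp: code_def N_def)

lemma set_srt [simp]: "set (srt n P) = set P" and length_srt [simp]: "length (srt n P) = length P"
  and distinct_srt [simp]: "distinct (srt n P) = distinct P" and mset_srt [simp]: "mset (srt n P) = mset P"
  by (simp_all add: srt_def)

lemma set_csort [simp]: "set (csort P) = set P" and length_csort [simp]: "length (csort P) = length P"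
  and distinct_csort [simp]: "distinct (csort P) = distinct P" and mset_csort [simp]: "mset (csort P) = mset P"
  by (simp_all add: csort_def)

lemma csort_strict:
  assumes "distinct P" "i < j" "j < length P"
  shows "code (csort P ! i) < code (csort P ! j)"
proof -
  have "sorted (map code (csort P))" by (simp add: csort_def)
  then have "map code (csort P) ! i \<le> map code (csort P) ! j"
    using assms by (intro sorted_nth_mono) auto
  moreover have "csort P ! i \<noteq> csort P ! j"
    using assms by (simp add: nth_eq_iff_index_eq)
  ultimately show ?thesis using assms by (simp add: code_inj order_less_le)
qed

lemma tuples_sorted:
  "t \<in> tuples n \<longleftrightarrow> set t \<subseteq> N n \<and> length t \<in> {1..n} \<and> distinct t \<and> sorted (map (pos n) t)"
proof -
  have "sorted_wrt ord_lt t \<longleftrightarrow> distinct t \<and> sorted (map (pos n) t)" if "set t \<subseteq> N n"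
  proof -
    have "sorted_wrt ord_lt t \<longleftrightarrow> sorted_wrt (\<lambda>i j. pos n i < pos n j) t"
      using that pos_less by (intro iffI; elim sorted_wrt_mono_rel[rotated]) (auto simp: subset_iff)
    also have "\<dots> \<longleftrightarrow> sorted_wrt (<) (map (pos n) t)"
      by (simp add: sorted_wrt_map)
    also have "\<dots> \<longleftrightarrow> distinct (map (pos n) t) \<and> sorted (map (pos n) t)"
      by (auto simp: strict_sorted_iff)
    also have "distinct (map (pos n) t) \<longleftrightarrow> distinct t"
      using that pos_inj by (auto simp: distinct_map inj_on_def subset_iff)
    finally show ?thesis .
  qed
  then show ?thesis by (auto simp: tuples_def)
qed

lemma srt_tuples: "set P \<subseteq> N n \<Longrightarrow> length P \<in> {1..n} \<Longrightarrow> distinct P \<Longrightarrow> srt n P \<in> tuples n"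
  unfolding tuples_sorted by (simp add: srt_def)

lemma srt_id: "t \<in> tuples n \<Longrightarrow> srt n t = t"
  unfolding tuples_sorted srt_def by (simp add: sort_key_id_if_sorted)

lemma srt_cong:
  assumes "set P \<subseteq> N n" "distinct P" "distinct Q" "set P = set Q"
  shows "srt n P = srt n Q"
proof -
  have "mset P = mset Q" using assms by (metis set_eq_iff_mset_eq_distinct)
  then have "mset (map (pos n) (srt n P)) = mset (map (pos n) (srt n Q))" by simp
  moreover have "sorted (map (pos n) (srt n P))" "sorted (map (pos n) (srt n Q))" by (simp_all add: srt_def)
  ultimately have "map (pos n) (srt n P) = map (pos n) (srt n Q)"
    by (metis properties_for_sort sorted_sort_id)
  moreover have "inj_on (pos n) (set (srt n P) \<union> set (srt n Q))"
    using assms pos_inj by (auto simp: inj_on_def subset_iff)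
  ultimately show ?thesis by (simp add: inj_on_map_eq_map)
qed

lemma tuples_eqI: "s \<in> tuples n \<Longrightarrow> t \<in> tuples n \<Longrightarrow> set s = set t \<Longrightarrow> s = t"
  using srt_cong[of s n t] by (simp add: srt_id) (simp add: tuples_sorted)

section \<open>Coordinates of arbitrary index lists\<close>

text \<open>The coordinate function whose value at a flag is the minor with columns \<open>P\<close>.\<close>

definition col_poly :: "nat \<Rightarrow> int list \<Rightarrow> mpoly" where
  "col_poly n P = Const (delta (srt n P) P) * Var (srt n P)"

definition pcoord :: "nat \<Rightarrow> (nat \<Rightarrow> cvec list) \<Rightarrow> int list \<Rightarrow> complex" where
  "pcoord n b t = (if t \<in> tuples n then wedge_coord (b (length t)) t else 0)"

lemma plucker_eq: "plucker n V = {pcoord n b | b. \<forall>k\<in>{1..n}. is_basis (b k) (V k)}"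
  by (simp add: plucker_def pcoord_def[abs_def])

lemma Const_0 [simp]: "Const 0 = 0"
  by (simp add: Const_def)

lemma col_poly_not_distinct: "\<not> distinct P \<Longrightarrow> col_poly n P = 0"
  by (simp add: col_poly_def delta_def minor_not_distinct)

lemma col_poly_ring:
  assumes "set P \<subseteq> N n" "length P \<in> {1..n}"
  shows "col_poly n P \<in> poly_ring (tuples n)"
proof (cases "distinct P")
  case True
  then show ?thesis unfolding col_poly_def
    using srt_tuples[OF assms] by (intro poly_ring_mult poly_ring_Const poly_ring_Var)
qed (simp add: col_poly_not_distinct poly_ring_0)

lemma col_poly_tuple: "t \<in> tuples n \<Longrightarrow> col_poly n t = Var t"
  by (simp add: col_poly_def srt_id tuples_sorted delta_self Const_def)

lemma col_poly_delta:
  assumes "set P \<subseteq> N n" "distinct P" "length Q = length P" "set Q \<subseteq> set P"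
  shows "col_poly n Q = Const (delta P Q) * col_poly n P"
proof (cases "distinct Q")
  case True
  then have "set Q = set P"
    using assms by (intro card_subset_eq) (auto simp: distinct_card)
  then have s: "srt n Q = srt n P" using assms True by (intro srt_cong) auto
  have "delta (srt n P) Q = delta (srt n P) P * (delta P Q :: complex)"
    by (rule delta_trans) (use assms in auto)
  then show ?thesis
    by (simp add: col_poly_def s Const_def mult_single Var_def mult.commute)
qed (simp add: col_poly_not_distinct delta_def minor_not_distinct)

lemma eval_col_poly_pcoord:
  assumes "set P \<subseteq> N n" "length P \<in> {1..n}"
  shows "eval_at (pcoord n b) (col_poly n P) = wedge_coord (b (length P)) P"
proof (cases "distinct P")
  case True
  have "wedge_coord (b (length P)) P = wedge_coord (b (length P)) (srt n P) * delta (srt n P) P"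
    unfolding wedge_coord_minor by (rule minor_delta) (use True in auto)
  moreover have "srt n P \<in> tuples n" by (rule srt_tuples[OF assms True])
  ultimately show ?thesis by (simp add: col_poly_def pcoord_def)
qed (simp add: col_poly_not_distinct wedge_coord_minor minor_not_distinct)

section \<open>Bases and exterior products\<close>

lemma sum_fun_apply: "(\<Sum>a\<in>A. f a) x = (\<Sum>a\<in>A. f a x)" for f :: "'b \<Rightarrow> 'c \<Rightarrow> complex"
  by (induction A rule: infinite_finite_induct) auto

lemma span_list:
  assumes "v \<in> cvec.span (set bs)"
  shows "\<exists>c. \<forall>j. v j = (\<Sum>a<length bs. c a * (bs ! a) j)"
  using assms
proof (induction rule: cvec.span_induct_alt)
  case base
  show ?case by (intro exI[of _ "\<lambda>_. 0"]) simp
next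
  case (step c x y)
  then obtain i d where i: "i < length bs" "x = bs ! i"
    and d: "\<And>j. y j = (\<Sum>a<length bs. d a * (bs ! a) j)"
    by (auto simp: in_set_conv_nth)
  have "(\<Sum>a<length bs. (d a + (if a = i then c else 0)) * (bs ! a) j) =
      (\<Sum>a<length bs. d a * (bs ! a) j) + (\<Sum>a<length bs. if a = i then c * (bs ! a) j else 0)" for j
    unfolding sum.distrib[symmetric] by (intro sum.cong) (auto simp: algebra_simps)
  then show ?case using i d
    by (intro exI[of _ "\<lambda>a. d a + (if a = i then c else 0)"]) simp
qed

lemma span_listI:
  assumes "\<And>j. v j = (\<Sum>a<length bs. c a * (bs ! a) j)"
  shows "v \<in> cvec.span (set bs)"
proof -
  have "(\<Sum>a<length bs. (\<lambda>j. c a * (bs ! a) j)) \<in> cvec.span (set bs)"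
    by (intro cvec.span_sum cvec.span_scale cvec.span_base) auto
  also have "(\<Sum>a<length bs. (\<lambda>j. c a * (bs ! a) j)) = v"
    using assms by (simp add: fun_eq_iff sum_fun_apply)
  finally show ?thesis .
qed

lemma wedge_coord_span:
  assumes "set bs \<subseteq> cvec.span (set rs)" "length bs = length rs"
  obtains c where "\<And>t. length t = length rs \<Longrightarrow> wedge_coord bs t = c * wedge_coord rs t"
proof -
  have "\<forall>r<length rs. \<exists>c. \<forall>j. (bs ! r) j = (\<Sum>a<length rs. c a * (rs ! a) j)"
    using assms by (intro allI impI span_list) (auto simp: subset_iff)
  then obtain C where C: "\<And>r j. r < length rs \<Longrightarrow> (bs ! r) j = (\<Sum>a<length rs. C r a * (rs ! a) j)"
    by metis
  have "wedge_coord bs t = det (mat (length rs) (length rs) (\<lambda>(r, a). C r a)) * wedge_coord rs t"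
    if "length t = length rs" for t
    using minor_row_change[of t "\<lambda>r. bs ! r" C "\<lambda>r. rs ! r"] C that
    by (simp add: wedge_coord_minor)
  then show ?thesis by (rule that)
qed

text \<open>A repeated vector gives two equal rows; the coefficients of a linear relation form a
  kernel vector of the transposed matrix.\<close>

lemma wedge_coord_nonzero:
  assumes len: "length bs = length t" and nz: "wedge_coord bs t \<noteq> 0"
  shows "distinct bs \<and> cvec.independent (set bs)"
proof -
  let ?k = "length t"
  let ?A = "mat ?k ?k (\<lambda>(r, c). (bs ! r) (t ! c))"
  have dist: "distinct bs"
  proof (rule ccontr)
    assume "\<not> distinct bs"
    then obtain i j where ij: "i < ?k" "j < ?k" "i \<noteq> j" "bs ! i = bs ! j"
      using len by (auto simp: distinct_conv_nth)
    have "det ?A = 0"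
      by (rule det_identical_rows[where n = ?k and i = i and j = j]) (use ij in \<open>auto intro!: eq_vecI\<close>)
    with nz show False by (simp add: wedge_coord_def)
  qed
  have "\<not> cvec.dependent (set bs)"
  proof
    assume "cvec.dependent (set bs)"
    then obtain u v where v: "v \<in> set bs" "u v \<noteq> 0" and u: "(\<Sum>v\<in>set bs. (\<lambda>i. u v * v i)) = 0"
      by (auto simp: cvec.dependent_finite)
    have u': "(\<Sum>a<?k. (bs ! a) j * u (bs ! a)) = 0" for j
    proof -
      have "(\<Sum>a<?k. (bs ! a) j * u (bs ! a)) = (\<Sum>v\<in>set bs. v j * u v)"
        using len dist
        by (intro sum.reindex_bij_betw[of "(!) bs" "{..<?k}" "set bs" "\<lambda>v. v j * u v"] bij_betw_nth) auto
      also have "\<dots> = (\<Sum>v\<in>set bs. (\<lambda>i. u v * v i)) j" by (simp add: sum_fun_apply mult.commute)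
      finally show ?thesis by (simp add: u)
    qed
    let ?x = "vec ?k (\<lambda>a. u (bs ! a))"
    obtain i where i: "i < ?k" "v = bs ! i" using v len by (auto simp: in_set_conv_nth)
    have "?x \<noteq> 0\<^sub>v ?k"
    proof
      assume "?x = 0\<^sub>v ?k"
      then have "?x $ i = 0\<^sub>v ?k $ i" by simp
      with i v show False by simp
    qed
    moreover have "transpose_mat ?A *\<^sub>v ?x = 0\<^sub>v ?k"
      using u' by (intro eq_vecI) (auto simp: scalar_prod_def atLeast0LessThan)
    ultimately have "det (transpose_mat ?A) = 0"
      by (subst det_0_iff_vec_prod_zero[of _ ?k]) (auto intro!: exI[of _ ?x])
    then have "det ?A = 0" by (simp add: det_transpose[where n = ?k])
    with nz show False by (simp add: wedge_coord_def)
  qed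
  with dist show ?thesis by simp
qed

lemma is_basis_length: "is_basis bs U \<Longrightarrow> length bs = cvec.dim U"
  unfolding is_basis_def
  by (metis cvec.dim_eq_card cvec.span_span distinct_card)

lemma is_basis_span: "is_basis bs U \<Longrightarrow> cvec.span (set bs) = U"
  by (simp add: is_basis_def)

lemma basis_list_exists:
  assumes "cvec.subspace U" "cvec.dim U \<ge> 1"
  shows "\<exists>bs. is_basis bs U"
proof -
  obtain B where B: "B \<subseteq> U" "cvec.independent B" "U \<subseteq> cvec.span B" "card B = cvec.dim U"
    by (rule cvec.basis_exists)
  then have "finite B" using assms by (intro card_ge_0_finite) simp
  then obtain bs where bs: "set bs = B" "distinct bs" using finite_distinct_list by blast
  have "cvec.span B = U"
    using B assms by (intro antisym cvec.span_minimal) auto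
  with bs B show ?thesis by (auto simp: is_basis_def)
qed

lemma flags_mono:
  assumes V: "V \<in> flags n" and kl: "1 \<le> l" "l \<le> k" "k \<le> n"
  shows "V l \<subseteq> V k"
  using kl(2,3)
proof (induction k rule: dec_induct)
  case (step m)
  then have "V m \<subseteq> V (Suc m)" using V kl(1) by (auto simp: flags_def)
  with step show ?case by auto
qed simp

lemma flags_dim: "V \<in> flags n \<Longrightarrow> k \<in> {1..n} \<Longrightarrow> cvec.dim (V k) = k"
  and flags_subspace: "V \<in> flags n \<Longrightarrow> k \<in> {1..n} \<Longrightarrow> cvec.subspace (V k)"
  by (auto simp: flags_def PiE_def Pi_def)

lemma flags_bases:
  assumes "V \<in> flags n"
  obtains b where "\<And>k. k \<in> {1..n} \<Longrightarrow> is_basis (b k) (V k)"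
proof -
  have "\<exists>bs. is_basis bs (V k)" if "k \<in> {1..n}" for k
    using flags_dim[OF assms that] flags_subspace[OF assms that] that by (intro basis_list_exists) auto
  then show ?thesis using that by metis
qed

text \<open>The nesting of the flag in coordinates, in the form required by the exchange and Garnir
  relations; \<open>l = k\<close> is included.\<close>

lemma flags_coeffs:
  assumes V: "V \<in> flags n" and b: "\<And>k. k \<in> {1..n} \<Longrightarrow> is_basis (b k) (V k)"
    and kl: "1 \<le> l" "l \<le> k" "k \<le> n"
  obtains C where "\<And>r x. r < l \<Longrightarrow> (b l ! r) x = (\<Sum>a<k. C r a * (b k ! a) x)"
proof -
  have len: "length (b k) = k" "length (b l) = l"
    using is_basis_length[OF b] flags_dim[OF V] kl by auto
  have "b l ! r \<in> cvec.span (set (b k))" if "r < l" for r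
  proof -
    have "b l ! r \<in> cvec.span (set (b l))" using that len by (intro cvec.span_base) simp
    then show ?thesis using is_basis_span[OF b] flags_mono[OF V kl] kl by auto
  qed
  then have "\<forall>r<l. \<exists>c. \<forall>j. (b l ! r) j = (\<Sum>a<k. c a * (b k ! a) j)"
    using span_list[of _ "b k"] len by auto
  then show ?thesis using that by metis
qed

section \<open>Relations in the Pluecker ideal\<close>

text \<open>Every coordinate vector of a point of the flag variety is \<open>pcoord n b\<close> for
  suitable bases, so relations between minors are relations in the ideal.\<close>

lemma plucker_idealI:
  assumes "f \<in> poly_ring (tuples n)"
    and "\<And>V b. V \<in> flags n \<Longrightarrow> (\<And>k. k \<in> {1..n} \<Longrightarrow> is_basis (b k) (V k)) \<Longrightarrow> eval_at (pcoord n b) f = 0"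
  shows "f \<in> plucker_ideal n"
  using assms by (auto simp: plucker_ideal_def vanishing_ideal_def flag_variety_def vanishes_at_def plucker_eq)

lemma exchange_in_plucker_ideal:
  assumes P: "set P \<subseteq> N n" "length P \<le> n" and Q: "set Q \<subseteq> N n" "1 \<le> length Q" "length Q \<le> length P"
    and s: "s < length Q"
  shows "col_poly n P * col_poly n Q -
    (\<Sum>i<length P. col_poly n (P[i := Q ! s]) * col_poly n (Q[s := P ! i])) \<in> plucker_ideal n"
proof (rule plucker_idealI)
  have upd: "set (P[i := Q ! s]) \<subseteq> N n" "set (Q[s := P ! i]) \<subseteq> N n" if "i < length P" for i
    using that P(1) Q(1) s by (auto dest!: subsetD[OF set_update_subset_insert])
  have len: "length P \<in> {1..n}" "length Q \<in> {1..n}" using P Q by auto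
  show "col_poly n P * col_poly n Q -
    (\<Sum>i<length P. col_poly n (P[i := Q ! s]) * col_poly n (Q[s := P ! i])) \<in> poly_ring (tuples n)"
    using upd len P Q
    by (intro poly_ring_diff poly_ring_mult poly_ring_sum col_poly_ring) auto
  fix V b assume V: "V \<in> flags n" and b: "\<And>k. k \<in> {1..n} \<Longrightarrow> is_basis (b k) (V k)"
  obtain C where C: "\<And>r x. r < length Q \<Longrightarrow>
      (b (length Q) ! r) x = (\<Sum>a<length P. C r a * (b (length P) ! a) x)"
    using flags_coeffs[OF V b, of "length Q" "length P"] P Q by auto
  have "wedge_coord (b (length P)) P * wedge_coord (b (length Q)) Q =
    (\<Sum>i<length P. wedge_coord (b (length P)) (P[i := Q ! s]) * wedge_coord (b (length Q)) (Q[s := P ! i]))"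
    unfolding wedge_coord_minor by (rule minor_exchange[OF s C])
  then show "eval_at (pcoord n b) (col_poly n P * col_poly n Q -
    (\<Sum>i<length P. col_poly n (P[i := Q ! s]) * col_poly n (Q[s := P ! i]))) = 0"
    using upd len P Q by (simp add: eval_col_poly_pcoord)
qed

lemma garnir_in_plucker_ideal:
  assumes w: "\<And>j. j < k + l \<Longrightarrow> w j \<in> N n" and kl: "1 \<le> l" "l \<le> k" "k \<le> n"
    and U: "U \<subseteq> {0..<k + l}" "card U > k"
  shows "(\<Sum>\<sigma> | \<sigma> permutes U. Const (of_int (sign \<sigma>)) *
    (col_poly n (map (w \<circ> \<sigma>) [0..<k]) * col_poly n (map (w \<circ> \<sigma>) [k..<k + l]))) \<in> plucker_ideal n"
proof (rule plucker_idealI)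
  have in_N: "set (map (w \<circ> \<sigma>) [0..<k]) \<subseteq> N n" "set (map (w \<circ> \<sigma>) [k..<k + l]) \<subseteq> N n"
    if "\<sigma> permutes U" for \<sigma>
  proof -
    have "\<sigma> permutes {0..<k + l}" using that U(1) by (rule permutes_subset)
    then have "\<sigma> j < k + l" if "j < k + l" for j
      using that permutes_in_image[of \<sigma> "{0..<k + l}" j] by simp
    then show "set (map (w \<circ> \<sigma>) [0..<k]) \<subseteq> N n" "set (map (w \<circ> \<sigma>) [k..<k + l]) \<subseteq> N n"
      using w by auto
  qed
  show "(\<Sum>\<sigma> | \<sigma> permutes U. Const (of_int (sign \<sigma>)) *
    (col_poly n (map (w \<circ> \<sigma>) [0..<k]) * col_poly n (map (w \<circ> \<sigma>) [k..<k + l]))) \<in> poly_ring (tuples n)"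
    using in_N kl by (intro poly_ring_sum poly_ring_mult poly_ring_Const col_poly_ring) auto
  fix V b assume V: "V \<in> flags n" and b: "\<And>k. k \<in> {1..n} \<Longrightarrow> is_basis (b k) (V k)"
  obtain C where C: "\<And>r x. r < l \<Longrightarrow> (b l ! r) x = (\<Sum>a<k. C r a * (b k ! a) x)"
    using flags_coeffs[OF V b kl] by auto
  have "eval_at (pcoord n b) (\<Sum>\<sigma> | \<sigma> permutes U. Const (of_int (sign \<sigma>)) *
      (col_poly n (map (w \<circ> \<sigma>) [0..<k]) * col_poly n (map (w \<circ> \<sigma>) [k..<k + l]))) =
    (\<Sum>\<sigma> | \<sigma> permutes U. of_int (sign \<sigma>) *
      (wedge_coord (b k) (map (w \<circ> \<sigma>) [0..<k]) * wedge_coord (b l) (map (w \<circ> \<sigma>) [k..<k + l])))"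
    unfolding eval_at_simps using in_N kl
    by (intro sum.cong refl) (simp add: eval_col_poly_pcoord)
  also have "\<dots> = 0"
    unfolding wedge_coord_minor using U C by (rule garnir_relation)
  finally show "eval_at (pcoord n b) (\<Sum>\<sigma> | \<sigma> permutes U. Const (of_int (sign \<sigma>)) *
      (col_poly n (map (w \<circ> \<sigma>) [0..<k]) * col_poly n (map (w \<circ> \<sigma>) [k..<k + l]))) = 0" .
qed

section \<open>Additive functionals on monomials\<close>

text \<open>Degrees, sums of squared heights, row contents and orders of growth are all of this
  form.\<close>

definition wt :: "(int list \<Rightarrow> 'b::comm_semiring_1) \<Rightarrow> (int list \<Rightarrow>\<^sub>0 nat) \<Rightarrow> 'b" where
  "wt f m = (\<Sum>c\<in>Poly_Mapping.keys m. of_nat (Poly_Mapping.lookup m c) * f c)"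

lemma wt_superset:
  assumes "finite A" "Poly_Mapping.keys m \<subseteq> A"
  shows "wt f m = (\<Sum>c\<in>A. of_nat (Poly_Mapping.lookup m c) * f c)"
  unfolding wt_def using assms by (intro sum.mono_neutral_left) (auto simp: in_keys_iff)

lemma wt_add: "wt f (m + m') = wt f m + wt f m'"
proof -
  let ?A = "Poly_Mapping.keys m \<union> Poly_Mapping.keys m'"
  have "Poly_Mapping.keys (m + m') \<subseteq> ?A" by (rule keys_add)
  then show ?thesis
    by (simp add: wt_superset[where A = ?A] lookup_add algebra_simps sum.distrib)
qed

lemma wt_single: "wt f (Poly_Mapping.single c k) = of_nat k * f c"
  by (cases "k = 0") (simp_all add: wt_def)

lemma wt_mono:
  fixes f g :: "int list \<Rightarrow> 'b::linordered_semidom"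
  assumes "\<And>c. c \<in> Poly_Mapping.keys m \<Longrightarrow> f c \<le> g c"
  shows "wt f m \<le> wt g m"
  unfolding wt_def using assms by (intro sum_mono mult_left_mono) auto

section \<open>Straightening\<close>

text \<open>Columns, sorted with respect to \<open>ord_lt'\<close>, that may stand next to each other in a
  semistandard tableau.\<close>

definition col_le :: "int list \<Rightarrow> int list \<Rightarrow> bool" where
  "col_le c d \<longleftrightarrow> length d \<le> length c \<and> (\<forall>r<length d. code (csort c ! r) \<le> code (csort d ! r))"

text \<open>A monomial is a multiset of columns. Pairwise comparability says that they can be lined
  up to a semistandard tableau, without choosing the arrangement.\<close>

definition standard :: "(int list \<Rightarrow>\<^sub>0 nat) \<Rightarrow> bool" where
  "standard m \<longleftrightarrow> (\<forall>c\<in>Poly_Mapping.keys m. \<forall>d\<in>Poly_Mapping.keys m. col_le c d \<or> col_le d c)"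

text \<open>The constant is so large that a longer column always has the greater height.\<close>

definition height :: "nat \<Rightarrow> int list \<Rightarrow> int" where
  "height n P = (\<Sum>i\<leftarrow>P. (2 * int n + 2)\<^sup>2 - int (code i))"

lemma height_const_ge: "2 * int n + 1 \<le> (2 * int n + 2)\<^sup>2"
proof -
  have "0 \<le> int n * int n" by simp
  then show ?thesis by (simp add: power2_eq_square algebra_simps)
qed

lemma height_cong: "mset P = mset Q \<Longrightarrow> height n P = height n Q"
  unfolding height_def by (metis mset_map sum_mset_sum_list)

lemma height_map: "height n (map f [a..<b]) = (\<Sum>j\<in>{a..<b}. (2 * int n + 2)\<^sup>2 - int (code (f j)))"
  unfolding height_def by (simp add: interv_sum_list_conv_sum_set_nat)

lemma height_bounds:
  assumes "set P \<subseteq> N n"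
  shows "int (length P) * ((2 * int n + 2)\<^sup>2 - (2 * int n + 1)) \<le> height n P"
    "height n P \<le> int (length P) * (2 * int n + 2)\<^sup>2"
  using assms
proof (induction P)
  case (Cons i P)
  { case 1 then show ?case using Cons code_bounds[of i n] by (auto simp: height_def algebra_simps) }
  { case 2 then show ?case using Cons code_bounds[of i n] by (auto simp: height_def algebra_simps) }
qed (auto simp: height_def)

text \<open>Each entry falls short of \<open>(2 * n + 2)\<^sup>2\<close> by at most
  \<open>2 * n + 1\<close>. Over \<open>length Q + 1\<close> entries the total shortfall is at most
  the full value of the one extra entry.\<close>

lemma height_length:
  assumes "set P \<subseteq> N n" "set Q \<subseteq> N n" "length Q < length P" "length Q \<le> n"
  shows "height n Q \<le> height n P"
proof -
  let ?B = "(2 * int n + 2)\<^sup>2" and ?l = "int (length Q)"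
  have "(?l + 1) * (2 * int n + 1) \<le> (2 * int n + 2) * (2 * int n + 2)"
    using assms by (intro mult_mono) auto
  then have "?l * ?B \<le> (?l + 1) * (?B - (2 * int n + 1))"
    by (simp add: algebra_simps power2_eq_square)
  also have "\<dots> \<le> int (length P) * (?B - (2 * int n + 1))"
    using assms height_const_ge[of n] by (intro mult_right_mono) auto
  finally show ?thesis using height_bounds[OF assms(1)] height_bounds[OF assms(2)] by linarith
qed

lemma height_tuple:
  assumes "c \<in> tuples n"
  shows "(height n c)\<^sup>2 \<le> (int n * (2 * int n + 2)\<^sup>2)\<^sup>2"
proof (rule power_mono)
  have c: "set c \<subseteq> N n" "length c \<le> n" using assms by (auto simp: tuples_sorted)
  have "0 \<le> int (length c) * ((2 * int n + 2)\<^sup>2 - (2 * int n + 1))"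
    using height_const_ge[of n] by (intro mult_nonneg_nonneg) auto
  then show "0 \<le> height n c" using height_bounds(1)[OF c(1)] by linarith
  have "int (length c) * (2 * int n + 2)\<^sup>2 \<le> int n * (2 * int n + 2)\<^sup>2"
    using c by (intro mult_right_mono) auto
  then show "height n c \<le> int n * (2 * int n + 2)\<^sup>2"
    using height_bounds(2)[OF c(1)] by linarith
qed

text \<open>\<open>X\<close> consists of the positions that enter the first \<open>k\<close> places
  and \<open>Y\<close> of those that leave them. They are equally many, but values on
  \<open>X\<close> are at most \<open>q\<close> and those on \<open>Y\<close> at least
  \<open>p\<close>.\<close>

lemma sum_exchange_less:
  fixes f :: "nat \<Rightarrow> nat"
  assumes \<sigma>: "\<sigma> permutes {r..k + r}" and rk: "r < k"
    and le: "\<And>x. k \<le> x \<Longrightarrow> x \<le> k + r \<Longrightarrow> f x \<le> q" and ge: "\<And>y. r \<le> y \<Longrightarrow> y < k \<Longrightarrow> p \<le> f y"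
    and qp: "q < p" and j0: "j0 < k" "k \<le> \<sigma> j0"
  shows "(\<Sum>j<k. f (\<sigma> j)) < (\<Sum>j<k. f j)"
proof -
  have inj: "inj \<sigma>" using \<sigma> by (rule permutes_inj)
  define A where "A = \<sigma> ` {..<k}"
  define X where "X = A - {..<k}"
  define Y where "Y = {..<k} - A"
  have fin: "finite A" "finite X" "finite Y" by (auto simp: A_def X_def Y_def)
  have cA: "card A = k" unfolding A_def using inj by (subst card_image) (auto intro: inj_on_subset)
  have cXY: "card X = card Y"
  proof -
    have "card A = card (A \<inter> {..<k}) + card X" unfolding X_def using fin(1) by (rule card_Int_Diff)
    moreover have "card {..<k} = card ({..<k} \<inter> A) + card Y" unfolding Y_def by (rule card_Int_Diff) simp
    ultimately show ?thesis using cA by (simp add: Int_commute)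
  qed
  have X0: "card X > 0"
  proof -
    have "\<sigma> j0 \<in> X" using j0 by (auto simp: X_def A_def)
    with fin(2) show ?thesis by (auto simp: card_gt_0_iff)
  qed
  have fX: "f x \<le> q" if x: "x \<in> X" for x
  proof -
    obtain j where j: "j < k" "x = \<sigma> j" "k \<le> x" using x by (auto simp: X_def A_def)
    have "x \<in> {r..k + r}"
    proof (rule ccontr)
      assume "x \<notin> {r..k + r}"
      then have "\<sigma> x = \<sigma> j" using permutes_not_in[OF \<sigma>] j by simp
      then have "x = j" by (rule injD[OF inj])
      with j show False by simp
    qed
    with j le show ?thesis by auto
  qed
  have fY: "p \<le> f y" if y: "y \<in> Y" for y
  proof -
    have "y \<in> {r..k + r}"
    proof (rule ccontr)
      assume "y \<notin> {r..k + r}"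
      then have "\<sigma> y = y" using permutes_not_in[OF \<sigma>] by simp
      with y show False by (metis A_def DiffE Y_def imageI)
    qed
    with y ge show ?thesis by (auto simp: Y_def)
  qed
  have "sum f X \<le> card X * q" using sum_bounded_above[of X f q] fX by simp
  also have "\<dots> < card Y * p" using cXY X0 qp by simp
  also have "\<dots> \<le> sum f Y" using sum_bounded_below[of Y p f] fY by simp
  finally have less: "sum f X < sum f Y" .
  have "(\<Sum>j<k. f (\<sigma> j)) = sum f A"
    unfolding A_def using inj by (subst sum.reindex) (auto intro: inj_on_subset)
  also have "\<dots> = sum f (A \<inter> {..<k}) + sum f X"
    unfolding X_def using fin(1) by (subst sum.Int_Diff[of A f "{..<k}"]) auto
  also have "\<dots> < sum f (A \<inter> {..<k}) + sum f Y" using less by simp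
  also have "\<dots> = (\<Sum>j<k. f j)"
    unfolding Y_def by (subst sum.Int_Diff[of "{..<k}" f A]) (auto simp: Int_commute)
  finally show ?thesis .
qed

section \<open>Standard representatives modulo the Pluecker ideal\<close>

lemma Const_mult: "Const a * Const b = Const (a * b)"
  by (simp add: Const_def mult_single)

lemma Const_1: "Const 1 = 1"
  by (simp add: Const_def)

lemma Const_uminus: "Const (- a) = - Const a"
  by (simp add: Const_def single_uminus)

lemma Const_inverse: "a \<noteq> 0 \<Longrightarrow> Const (inverse a) * (Const a * f) = f"
  by (simp add: Const_mult Const_1 flip: mult.assoc)

lemma of_nat_Const: "of_nat k = Const (of_nat k)"
  by (simp add: Const_def)

lemma scaled_product:
  "Const a * ((Const b * Var c) * (Const b' * Var d)) = Const (a * (b * b')) * (Var c * Var d)"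
  by (simp add: Const_mult[symmetric] ac_simps)

lemma Var_mult_single:
  "Var c * Var d * Poly_Mapping.single m 1 =
    Poly_Mapping.single (Poly_Mapping.single c 1 + Poly_Mapping.single d 1 + m) 1"
  by (simp add: Var_def mult_single)

definition straightenable :: "nat \<Rightarrow> mpoly \<Rightarrow> bool" where
  "straightenable n f \<longleftrightarrow> (\<exists>h\<in>plucker_ideal n. \<exists>s\<in>poly_ring (tuples n).
     f = h + s \<and> (\<forall>m\<in>Poly_Mapping.keys s. standard m))"

lemma plucker_ideal_ops:
  "0 \<in> plucker_ideal n"
  "f \<in> plucker_ideal n \<Longrightarrow> g \<in> plucker_ideal n \<Longrightarrow> f + g \<in> plucker_ideal n"
  "f \<in> plucker_ideal n \<Longrightarrow> g \<in> poly_ring (tuples n) \<Longrightarrow> g * f \<in> plucker_ideal n"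
  unfolding plucker_ideal_def by (fact vanishing_ideal_ops)+

lemma straightenable_ideal: "h \<in> plucker_ideal n \<Longrightarrow> straightenable n h"
  unfolding straightenable_def by (intro bexI[of _ h] bexI[of _ 0]) (auto simp: poly_ring_0)

lemma straightenable_add:
  assumes "straightenable n f" "straightenable n g"
  shows "straightenable n (f + g)"
proof -
  obtain h s h' s' where *: "h \<in> plucker_ideal n" "s \<in> poly_ring (tuples n)" "f = h + s"
    "\<forall>m\<in>Poly_Mapping.keys s. standard m"
    "h' \<in> plucker_ideal n" "s' \<in> poly_ring (tuples n)" "g = h' + s'"
    "\<forall>m\<in>Poly_Mapping.keys s'. standard m"
    using assms unfolding straightenable_def by blast
  then show ?thesis unfolding straightenable_def using keys_add[of s s']
    by (intro bexI[of _ "h + h'"] bexI[of _ "s + s'"])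
      (auto simp: algebra_simps intro: plucker_ideal_ops poly_ring_add)
qed

lemma lookup_Const_mult: "Poly_Mapping.lookup (Const a * f) m = a * Poly_Mapping.lookup f m"
proof -
  have "Const a * f = Poly_Mapping.map ((*) a) f"
    unfolding Const_def by (rule mult_map_scale_conv_mult[symmetric])
  then show ?thesis by (simp add: map.rep_eq when_def)
qed

lemma straightenable_scale:
  assumes "straightenable n f"
  shows "straightenable n (Const a * f)"
proof -
  obtain h s where *: "h \<in> plucker_ideal n" "s \<in> poly_ring (tuples n)" "f = h + s"
    "\<forall>m\<in>Poly_Mapping.keys s. standard m"
    using assms unfolding straightenable_def by blast
  moreover have "Poly_Mapping.keys (Const a * s) \<subseteq> Poly_Mapping.keys s"
    by (auto simp: in_keys_iff lookup_Const_mult)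
  ultimately show ?thesis unfolding straightenable_def
    by (intro bexI[of _ "Const a * h"] bexI[of _ "Const a * s"])
      (auto simp: distrib_left intro: plucker_ideal_ops poly_ring_mult poly_ring_Const)
qed

lemma straightenable_sum:
  "(\<And>i. i \<in> A \<Longrightarrow> straightenable n (f i)) \<Longrightarrow> straightenable n (sum f A)"
  by (induction A rule: infinite_finite_induct)
    (auto intro: straightenable_add straightenable_ideal plucker_ideal_ops)

text \<open>Two columns \<open>c\<close>, \<open>d\<close> that violate the tableau condition in row \<open>r\<close> are straightened by
  alternating over the entries of \<open>c\<close> from row \<open>r\<close> on and those of \<open>d\<close> up to row \<open>r\<close>.  All the
  former exceed all the latter, so every other term raises the height of the higher column at the
  expense of the lower one.  This increases the sum of the squared heights, which is bounded.\<close>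

lemma straightenable_monomial:
  assumes "Poly_Mapping.keys m \<subseteq> tuples n"
  shows "straightenable n (Poly_Mapping.single m 1)"
  using assms
\<comment> \<open>The first term is the degree times the largest possible squared height.
  Straightening preserves it while the second term grows.\<close>
proof (induction "nat (wt (\<lambda>_. (int n * (2 * int n + 2)\<^sup>2)\<^sup>2) m - wt (\<lambda>c. (height n c)\<^sup>2) m)"
    arbitrary: m rule: less_induct)
  case less
  let ?B = "(int n * (2 * int n + 2)\<^sup>2)\<^sup>2"
  let ?W = "wt (\<lambda>c. (height n c)\<^sup>2)"
  have bound: "?W m' \<le> wt (\<lambda>_. ?B) m'" if "Poly_Mapping.keys m' \<subseteq> tuples n" for m'
    using that height_tuple by (intro wt_mono) auto
  show ?case
  proof (cases "standard m")
    case True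
    then show ?thesis unfolding straightenable_def using less.prems
      by (intro bexI[of _ 0] bexI[of _ "Poly_Mapping.single m 1"])
        (auto simp: plucker_ideal_ops poly_ring_single)
  next
    case False
    then obtain c0 d0 where cd0: "c0 \<in> Poly_Mapping.keys m" "d0 \<in> Poly_Mapping.keys m"
      "\<not> col_le c0 d0" "\<not> col_le d0 c0" by (auto simp: standard_def)
    have tup: "c0 \<in> tuples n" "d0 \<in> tuples n" using cd0 less.prems by auto
    \<comment> \<open>A longer column is automatically at least as high, and columns of equal length
      can be swapped. Hence \<open>c\<close> can be taken to lead in length and height
      simultaneously.\<close>
    obtain c d where cd: "c \<in> Poly_Mapping.keys m" "d \<in> Poly_Mapping.keys m" "\<not> col_le c d"
      "length d \<le> length c" "height n d \<le> height n c"
    proof (cases "length c0 = length d0")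
      case True
      then show ?thesis using that[of c0 d0] that[of d0 c0] cd0 by linarith
    next
      case False
      then consider "length d0 < length c0" | "length c0 < length d0" by linarith
      then show ?thesis
      proof cases
        case 1
        then have "height n d0 \<le> height n c0"
          using tup by (intro height_length) (auto simp: tuples_sorted)
        with 1 that[of c0 d0] cd0 show ?thesis by auto
      next
        case 2
        then have "height n c0 \<le> height n d0"
          using tup by (intro height_length) (auto simp: tuples_sorted)
        with 2 that[of d0 c0] cd0 show ?thesis by auto
      qed
    qed
    define k l where "k = length c" and "l = length d"
    have c: "c \<in> tuples n" and d: "d \<in> tuples n" using cd less.prems by auto
    have kl: "1 \<le> l" "l \<le> k" "k \<le> n" using c d cd(4) by (auto simp: tuples_sorted k_def l_def)
    obtain r where r: "r < l" "code (csort d ! r) < code (csort c ! r)"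
      using cd(3,4) by (auto simp: col_le_def l_def)
    \<comment> \<open>Subtraction of exponents is truncated; since the columns differ, both can be
      split off from \<open>m\<close> even if each occurs only once.\<close>
    have cd_ne: "c \<noteq> d" using cd(3) by (auto simp: col_le_def)
    define m' where "m' = m - Poly_Mapping.single c 1 - Poly_Mapping.single d 1"
    have m: "m = Poly_Mapping.single c 1 + Poly_Mapping.single d 1 + m'"
    proof (rule poly_mapping_eqI)
      fix x
      show "Poly_Mapping.lookup m x = Poly_Mapping.lookup (Poly_Mapping.single c 1 + Poly_Mapping.single d 1 + m') x"
        using cd cd_ne by (auto simp: m'_def lookup_add lookup_minus lookup_single when_def in_keys_iff)
    qed
    have m'_keys: "Poly_Mapping.keys m' \<subseteq> tuples n"
      using less.prems by (auto simp: m'_def in_keys_iff lookup_minus)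
    define w where "w j = (csort c @ csort d) ! j" for j
    have w1: "map w [0..<k] = csort c" and w2: "map w [k..<k + l] = csort d"
      by (auto intro!: nth_equalityI simp: w_def k_def l_def nth_append)
    have wN: "w j \<in> N n" if "j < k + l" for j
    proof -
      have "w j \<in> set (csort c @ csort d)" unfolding w_def using that by (intro nth_mem) (simp add: k_def l_def)
      then show ?thesis using c d by (auto simp: tuples_sorted)
    qed
    \<comment> \<open>In the concatenation the tail of \<open>c\<close> occupies
      \<open>r..k - 1\<close> and the head of \<open>d\<close> occupies \<open>k..k + r\<close>:
      together \<open>k + 1\<close> positions, one more than the dimension.\<close>
    define U where "U = {r..k + r}"
    have U: "U \<subseteq> {0..<k + l}" "card U > k" using r by (auto simp: U_def)
    let ?L1 = "\<lambda>\<sigma>. map (w \<circ> \<sigma>) [0..<k]" and ?L2 = "\<lambda>\<sigma>. map (w \<circ> \<sigma>) [k..<k + l]"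
    define tm where "tm \<sigma> = Const (of_int (sign \<sigma>)) * (col_poly n (?L1 \<sigma>) * col_poly n (?L2 \<sigma>))" for \<sigma>
    have rel: "(\<Sum>\<sigma> | \<sigma> permutes U. tm \<sigma>) \<in> plucker_ideal n"
      unfolding tm_def using wN kl U by (rule garnir_in_plucker_ideal)
    have perm: "\<sigma> permutes {0..<k + l}" if "\<sigma> permutes U" for \<sigma>
      using that U(1) by (rule permutes_subset)
    have lt: "\<sigma> j < k + l" if "\<sigma> permutes U" "j < k + l" for \<sigma> j
      using that permutes_in_image[OF perm[OF that(1)], of j] by simp
    \<comment> \<open>These permutations preserve both columns as sets. Reordering the entries
      produces \<open>sign \<sigma>\<close> a second time, so all their terms are equal, sign
      included.\<close>
    define good where "good \<sigma> \<longleftrightarrow> (\<forall>j<k. \<sigma> j < k)" for \<sigma> :: "nat \<Rightarrow> nat"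
    define \<kappa> :: complex where "\<kappa> = delta c (csort c) * delta d (csort d)"
    have \<kappa>: "\<kappa> \<noteq> 0"
    proof -
      have "delta c (csort c) * delta (csort c) c = (1 :: complex)"
        "delta d (csort d) * delta (csort d) d = (1 :: complex)"
        using c d by (auto intro!: delta_inverse simp: tuples_sorted)
      then show ?thesis by (auto simp: \<kappa>_def)
    qed
    have good: "tm \<sigma> = Const \<kappa> * (Var c * Var d)" if \<sigma>: "\<sigma> permutes U" "good \<sigma>" for \<sigma>
    proof -
      have inj: "inj \<sigma>" using \<sigma>(1) by (rule permutes_inj)
      have card: "card (\<sigma> ` A) = card A" for A
        using inj by (intro card_image) (auto intro: inj_on_subset)
      have im1: "\<sigma> ` {..<k} = {..<k}"
        using \<sigma>(2) by (intro card_subset_eq) (auto simp: good_def card)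
      have iff: "\<sigma> j < k \<longleftrightarrow> j < k" for j
        using im1 inj by (metis image_iff injD lessThan_iff)
      have im2: "\<sigma> ` {k..<k + l} = {k..<k + l}"
        using lt[OF \<sigma>(1)] iff by (intro card_subset_eq) (auto simp: card simp flip: not_less)
      have s1: "set (?L1 \<sigma>) = set c"
      proof -
        have "set (?L1 \<sigma>) = w ` \<sigma> ` {..<k}" by (auto simp: atLeast0LessThan)
        also have "\<dots> = set (map w [0..<k])" by (simp add: im1 atLeast0LessThan)
        finally show ?thesis by (simp add: w1)
      qed
      have s2: "set (?L2 \<sigma>) = set d"
      proof -
        have "set (?L2 \<sigma>) = w ` \<sigma> ` {k..<k + l}" by auto
        also have "\<dots> = set (map w [k..<k + l])" by (simp add: im2)
        finally show ?thesis by (simp add: w2)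
      qed
      have d1: "distinct (?L1 \<sigma>)"
        using s1 c by (intro card_distinct) (simp add: distinct_card tuples_sorted k_def)
      have d2: "distinct (?L2 \<sigma>)"
        using s2 d by (intro card_distinct) (simp add: distinct_card tuples_sorted l_def)
      have srt1: "srt n (?L1 \<sigma>) = c"
        using srt_cong[of "?L1 \<sigma>" n c] s1 d1 c srt_id[OF c] by (simp add: tuples_sorted)
      have srt2: "srt n (?L2 \<sigma>) = d"
        using srt_cong[of "?L2 \<sigma>" n d] s2 d2 d srt_id[OF d] by (simp add: tuples_sorted)
      have "delta c (?L1 \<sigma>) * delta d (?L2 \<sigma>) = of_int (sign \<sigma>) * \<kappa>"
        unfolding delta_def \<kappa>_def
        using minor_mult_permute[OF perm[OF \<sigma>(1)], where w = w] iff by (simp add: w1 w2)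
      then have "of_int (sign \<sigma>) * (delta c (?L1 \<sigma>) * delta d (?L2 \<sigma>)) = \<kappa>"
        by (simp flip: of_int_mult mult.assoc)
      then show ?thesis
        by (simp add: tm_def col_poly_def srt1 srt2 scaled_product)
    qed
    have bad: "straightenable n (tm \<sigma> * Poly_Mapping.single m' 1)"
      if \<sigma>: "\<sigma> permutes U" "\<not> good \<sigma>" for \<sigma>
    proof (cases "distinct (?L1 \<sigma>) \<and> distinct (?L2 \<sigma>)")
      case False
      then have "tm \<sigma> = 0" by (auto simp: tm_def col_poly_not_distinct)
      then show ?thesis by (simp add: straightenable_ideal plucker_ideal_ops)
    next
      case True
      define c' d' where "c' = srt n (?L1 \<sigma>)" and "d' = srt n (?L2 \<sigma>)"
      have c': "c' \<in> tuples n" and d': "d' \<in> tuples n"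
        unfolding c'_def d'_def using True kl lt[OF \<sigma>(1)] wN by (auto intro!: srt_tuples)
      define M where "M = Poly_Mapping.single c' 1 + Poly_Mapping.single d' 1 + m'"
      have "(\<Sum>j<k. code (w (\<sigma> j))) < (\<Sum>j<k. code (w j))"
      proof -
        obtain j0 where j0: "j0 < k" "k \<le> \<sigma> j0" using \<sigma>(2) by (auto simp: good_def not_less)
        have dist: "distinct c" "distinct d" using c d by (auto simp: tuples_sorted)
        have le: "code (w x) \<le> code (csort d ! r)" if "k \<le> x" "x \<le> k + r" for x
        proof -
          have "x - k < r \<or> x = k + r" using that by auto
          then have "code (csort d ! (x - k)) \<le> code (csort d ! r)"
            using csort_strict[OF dist(2), of "x - k" r] r by (auto simp: l_def)
          then show ?thesis using that by (simp add: w_def nth_append k_def)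
        qed
        have ge: "code (csort c ! r) \<le> code (w y)" if "r \<le> y" "y < k" for y
        proof -
          have "r < y \<or> y = r" using that by auto
          then have "code (csort c ! r) \<le> code (csort c ! y)"
            using csort_strict[OF dist(1), of r y] that by (auto simp: k_def)
          then show ?thesis using that by (simp add: w_def nth_append k_def)
        qed
        show ?thesis
          by (rule sum_exchange_less[OF \<sigma>(1)[unfolded U_def], where f = "\<lambda>x. code (w x)", OF _ le ge r(2) j0])
            (use r kl in auto)
      qed
      then have "(\<Sum>j<k. int (code (w (\<sigma> j)))) < (\<Sum>j<k. int (code (w j)))"
        by (simp flip: of_nat_sum)
      then have "height n (map w [0..<k]) < height n (?L1 \<sigma>)"
        by (simp add: height_map sum_subtractf atLeast0LessThan)
      then have h1: "height n c < height n c'"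
        by (simp add: w1 c'_def height_cong[of "srt n (?L1 \<sigma>)" "?L1 \<sigma>"] height_cong[of "csort c" c])
      have tot: "height n (?L1 \<sigma>) + height n (?L2 \<sigma>) = height n (map w [0..<k]) + height n (map w [k..<k + l])"
        using sum.permute[OF perm[OF \<sigma>(1)], of "\<lambda>j. (2 * int n + 2)\<^sup>2 - int (code (w j))"]
          sum.atLeastLessThan_concat[of 0 k "k + l" "\<lambda>j. (2 * int n + 2)\<^sup>2 - int (code (w j))"]
          sum.atLeastLessThan_concat[of 0 k "k + l" "\<lambda>j. (2 * int n + 2)\<^sup>2 - int (code (w (\<sigma> j)))"]
        by (simp add: height_map o_def)
      then have h2: "height n c' + height n d' = height n c + height n d"
        by (simp add: w1 w2 c'_def d'_def height_cong[of "srt n (?L1 \<sigma>)" "?L1 \<sigma>"]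
            height_cong[of "srt n (?L2 \<sigma>)" "?L2 \<sigma>"] height_cong[of "csort c" c] height_cong[of "csort d" d])
      \<comment> \<open>The heights change by opposite amounts \<open>\<delta>\<close> and
        \<open>- \<delta>\<close>. As \<open>c\<close> was at least as high as \<open>d\<close>, the
        squares gain at least \<open>2 * \<delta> * \<delta>\<close>.\<close>
      have "(height n c)\<^sup>2 + (height n d)\<^sup>2 < (height n c')\<^sup>2 + (height n d')\<^sup>2"
      proof -
        define \<delta> where "\<delta> = height n c' - height n c"
        have \<delta>: "height n c' = height n c + \<delta>" "height n d' = height n d - \<delta>" "0 < \<delta>"
          using h1 h2 by (auto simp: \<delta>_def)
        have "0 < 2 * \<delta> * (height n c - height n d) + 2 * \<delta> * \<delta>"
          using \<delta>(3) cd(5) by (intro add_nonneg_pos mult_nonneg_nonneg mult_pos_pos) auto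
        then show ?thesis unfolding \<delta>(1,2) by (simp add: power2_eq_square algebra_simps)
      qed
      then have W: "?W m < ?W M"
        unfolding m M_def by (simp add: wt_add wt_single)
      have deg: "wt (\<lambda>_. ?B) M = wt (\<lambda>_. ?B) m"
        unfolding m M_def by (simp add: wt_add wt_single)
      have M_keys: "Poly_Mapping.keys M \<subseteq> tuples n"
        using c' d' m'_keys keys_add[of "Poly_Mapping.single c' 1 + Poly_Mapping.single d' 1" m']
          keys_add[of "Poly_Mapping.single c' 1" "Poly_Mapping.single d' (1::nat)"]
        by (auto simp: M_def)
      have "straightenable n (Poly_Mapping.single M 1)"
        using W deg bound[OF M_keys] M_keys by (intro less.hyps) auto
      moreover have "tm \<sigma> * Poly_Mapping.single m' 1 =
        Const (of_int (sign \<sigma>) * (delta c' (?L1 \<sigma>) * delta d' (?L2 \<sigma>))) * Poly_Mapping.single M 1"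
        unfolding tm_def col_poly_def scaled_product M_def c'_def[symmetric] d'_def[symmetric]
          Var_mult_single[symmetric] by (simp only: ac_simps)
      ultimately show ?thesis by (simp add: straightenable_scale)
    qed
    have finU: "finite {\<sigma>. \<sigma> permutes U}" by (rule finite_permutations) (simp add: U_def)
    \<comment> \<open>The good terms add up to \<open>g\<close> copies of the original product, and
      \<open>g\<close> is invertible in characteristic 0.\<close>
    define g where "g = card {\<sigma>. \<sigma> permutes U \<and> good \<sigma>}"
    have g: "g \<noteq> 0"
    proof -
      have "{\<sigma>. \<sigma> permutes U \<and> good \<sigma>} \<noteq> {}" using permutes_id[of U] by (auto simp: good_def intro!: exI[of _ id])
      moreover have "finite {\<sigma>. \<sigma> permutes U \<and> good \<sigma>}" by (rule finite_subset[OF _ finU]) auto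
      ultimately show ?thesis unfolding g_def by (simp only: card_eq_0_iff) simp
    qed
    have "(\<Sum>\<sigma> | \<sigma> permutes U. tm \<sigma>) =
      (\<Sum>\<sigma> | \<sigma> permutes U \<and> good \<sigma>. tm \<sigma>) + (\<Sum>\<sigma> | \<sigma> permutes U \<and> \<not> good \<sigma>. tm \<sigma>)"
      using sum.Int_Diff[OF finU, of "tm" "{\<sigma>. good \<sigma>}"]
      by (simp add: Collect_conj_eq Diff_eq Collect_neg_eq)
    moreover have "(\<Sum>\<sigma> | \<sigma> permutes U \<and> good \<sigma>. tm \<sigma>) = of_nat g * (Const \<kappa> * (Var c * Var d))"
      by (simp add: good g_def)
    ultimately have split: "Const (of_nat g * \<kappa>) * (Var c * Var d) =
      (\<Sum>\<sigma> | \<sigma> permutes U. tm \<sigma>) + Const (- 1) * (\<Sum>\<sigma> | \<sigma> permutes U \<and> \<not> good \<sigma>. tm \<sigma>)"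
      by (simp add: of_nat_Const Const_mult[symmetric] mult.assoc algebra_simps Const_uminus Const_1)
    have mono_ring: "Poly_Mapping.single m' 1 \<in> poly_ring (tuples n)"
      using m'_keys by (simp add: poly_ring_single)
    have "straightenable n (Poly_Mapping.single m' 1 * (\<Sum>\<sigma> | \<sigma> permutes U. tm \<sigma>) +
       Const (- 1) * (\<Sum>\<sigma> | \<sigma> permutes U \<and> \<not> good \<sigma>. tm \<sigma> * Poly_Mapping.single m' 1))"
      using bad by (intro straightenable_add straightenable_scale straightenable_sum
          straightenable_ideal[OF plucker_ideal_ops(3)[OF rel mono_ring]]) auto
    also have "Poly_Mapping.single m' 1 * (\<Sum>\<sigma> | \<sigma> permutes U. tm \<sigma>) +
       Const (- 1) * (\<Sum>\<sigma> | \<sigma> permutes U \<and> \<not> good \<sigma>. tm \<sigma> * Poly_Mapping.single m' 1) =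
       Poly_Mapping.single m' 1 * (Const (of_nat g * \<kappa>) * (Var c * Var d))"
      unfolding split by (simp add: algebra_simps flip: sum_distrib_right)
    also have "\<dots> = Const (of_nat g * \<kappa>) * Poly_Mapping.single m 1"
      unfolding m unfolding Var_mult_single[symmetric] by (simp only: ac_simps)
    finally have "straightenable n (Const (inverse (of_nat g * \<kappa>)) *
        (Const (of_nat g * \<kappa>) * Poly_Mapping.single m 1))"
      by (rule straightenable_scale)
    also have "Const (inverse (of_nat g * \<kappa>)) * (Const (of_nat g * \<kappa>) * Poly_Mapping.single m 1) =
        Poly_Mapping.single m 1"
      using g \<kappa> by (intro Const_inverse) simp
    finally show ?thesis .
  qed
qed

lemma straightening:
  assumes "f \<in> poly_ring (tuples n)"
  obtains h s where "h \<in> plucker_ideal n" "s \<in> poly_ring (tuples n)" "f = h + s"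
    "\<And>m. m \<in> Poly_Mapping.keys s \<Longrightarrow> standard m"
proof -
  have "straightenable n (\<Sum>m\<in>Poly_Mapping.keys f. Const (Poly_Mapping.lookup f m) * Poly_Mapping.single m 1)"
    using assms by (intro straightenable_sum straightenable_scale straightenable_monomial) (auto simp: poly_ring_def)
  also have "(\<Sum>m\<in>Poly_Mapping.keys f. Const (Poly_Mapping.lookup f m) * Poly_Mapping.single m 1) = f"
    using poly_sum_singles[of "Poly_Mapping.keys f" f] by (simp add: Const_def mult_single)
  finally show ?thesis using that unfolding straightenable_def by blast
qed

section \<open>Flags and their points\<close>

lemma subspace_CN: "cvec.subspace (CN n)"
  by (auto simp: cvec.subspace_def CN_def)

lemma basis_of_wedge:
  assumes "length bs = length t" "wedge_coord bs t \<noteq> 0"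
  shows "is_basis bs (cvec.span (set bs))" "cvec.dim (cvec.span (set bs)) = length bs"
proof -
  show b: "is_basis bs (cvec.span (set bs))"
    using wedge_coord_nonzero[OF assms] by (simp add: is_basis_def)
  show "cvec.dim (cvec.span (set bs)) = length bs" using is_basis_length[OF b] by simp
qed

text \<open>The last entry is set to the dummy value 0 inside the cofactors, which makes their
  independence of \<open>x\<close> visible.\<close>

lemma minor_snoc:
  "minor F (P @ [x]) = (\<Sum>b<length P. F b x * cofactor (mat (Suc (length P)) (Suc (length P)) (\<lambda>(r, c). F r ((P @ [0]) ! c))) b (length P))
     + F (length P) x * minor F P"
proof -
  let ?k = "length P"
  let ?A = "mat (Suc ?k) (Suc ?k) (\<lambda>(r, c). F r ((P @ [0]) ! c))"
  have "minor F (P @ [x]) = minor F ((P @ [0])[?k := x])" by simp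
  also have "\<dots> = (\<Sum>b<Suc ?k. F b x * cofactor ?A b ?k)"
    by (subst minor_update) auto
  also have "mat_delete ?A ?k ?k = mat ?k ?k (\<lambda>(r, c). F r (P ! c))"
    unfolding mat_delete_def by (intro eq_matI) (auto simp: nth_append)
  then have "cofactor ?A ?k ?k = minor F P"
    by (simp add: cofactor_def minor_def power_add[symmetric] flip: mult_2)
  then have "(\<Sum>b<Suc ?k. F b x * cofactor ?A b ?k) = (\<Sum>b<?k. F b x * cofactor ?A b ?k) + F ?k x * minor F P"
    by simp
  finally show ?thesis .
qed

text \<open>If the nonzero minor of \<open>bs\<close> on \<open>t\<close> could not be enlarged,
  expanding the minors on \<open>t @ [j]\<close> along the last column would express
  \<open>v\<close> through \<open>bs\<close>. Here \<open>j\<close> ranges over all integers;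
  confinement to \<open>N n\<close> is a separate matter.\<close>

lemma independent_minor:
  assumes "distinct bs" "cvec.independent (set bs)"
  shows "\<exists>t. length t = length bs \<and> wedge_coord bs t \<noteq> 0"
  using assms
proof (induction bs rule: rev_induct)
  case Nil
  then show ?case by (intro exI[of _ "[]"]) (simp add: wedge_coord_def)
next
  case (snoc v bs)
  have "cvec.independent (set bs)"
    using snoc.prems(2) by (rule cvec.independent_mono) auto
  with snoc obtain t where t: "length t = length bs" "wedge_coord bs t \<noteq> 0" by auto
  let ?F = "\<lambda>r. (bs @ [v]) ! r"
  have mt: "minor ?F t = wedge_coord bs t"
    unfolding wedge_coord_minor using t by (intro minor_cong) (simp add: nth_append)
  show ?case
  proof (rule ccontr)
    assume "\<not> ?thesis"
    then have z: "minor ?F (t @ [j]) = 0" for j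
      using t by (auto simp: wedge_coord_minor)
    define cf where "cf b = cofactor (mat (Suc (length t)) (Suc (length t)) (\<lambda>(r, c). ?F r ((t @ [0]) ! c))) b (length t)" for b
    have "v j = (\<Sum>a<length bs. (- cf a / wedge_coord bs t) * (bs ! a) j)" for j
    proof -
      have "0 = (\<Sum>b<length bs. ?F b j * cf b) + v j * wedge_coord bs t"
        using minor_snoc[of ?F t j] z[of j] t by (simp add: cf_def mt)
      also have "(\<Sum>b<length bs. ?F b j * cf b) = (\<Sum>b<length bs. (bs ! b) j * cf b)"
        by (intro sum.cong) (auto simp: nth_append)
      finally have "v j = - (\<Sum>b<length bs. (bs ! b) j * cf b) / wedge_coord bs t"
        using t by (simp add: field_simps eq_neg_iff_add_eq_0)
      then show ?thesis by (simp add: sum_divide_distrib sum_negf mult.commute)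
    qed
    then have "v \<in> cvec.span (set bs)" by (rule span_listI)
    moreover have "set (bs @ [v]) - {v} = set bs" using snoc.prems(1) by auto
    ultimately have "cvec.dependent (set (bs @ [v]))"
      unfolding cvec.dependent_def by (intro bexI[of _ v]) auto
    with snoc.prems(2) show False by simp
  qed
qed

text \<open>A column outside \<open>N n\<close> would be zero and a repeated one would kill the
  minor; sorting then only costs the factor \<open>delta\<close>.\<close>

lemma basis_coordinate_nonzero:
  assumes b: "is_basis bs U" and U: "U \<subseteq> CN n" and len: "length bs \<in> {1..n}"
  shows "\<exists>t\<in>tuples n. length t = length bs \<and> wedge_coord bs t \<noteq> 0"
proof -
  obtain t where t: "length t = length bs" "wedge_coord bs t \<noteq> 0"
    using independent_minor[of bs] b by (auto simp: is_basis_def)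
  have dist: "distinct t"
    using t(2) minor_not_distinct[of t] by (auto simp: wedge_coord_minor)
  have "set bs \<subseteq> CN n"
    using U is_basis_span[OF b] cvec.span_superset[of "set bs"] by blast
  then have bN: "(bs ! r) j = 0" if "r < length bs" "j \<notin> N n" for r j
    using that by (auto simp: CN_def subset_iff)
  have tN: "set t \<subseteq> N n"
  proof
    fix j assume "j \<in> set t"
    then obtain c where c: "c < length t" "j = t ! c" by (auto simp: in_set_conv_nth)
    show "j \<in> N n"
    proof (rule ccontr)
      assume "j \<notin> N n"
      then have "minor (\<lambda>r. bs ! r) t = 0"
        using c t(1) bN by (intro minor_not_subset[of c]) auto
      with t(2) show False by (simp add: wedge_coord_minor)
    qed
  qed
  have "wedge_coord bs t = wedge_coord bs (srt n t) * delta (srt n t) t"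
    unfolding wedge_coord_minor by (rule minor_delta) (use dist in auto)
  then have "wedge_coord bs (srt n t) \<noteq> 0" using t(2) by auto
  moreover have "srt n t \<in> tuples n" using tN len t(1) dist by (intro srt_tuples) auto
  ultimately show ?thesis using t(1) by (intro bexI[of _ "srt n t"]) auto
qed

text \<open>Rescaling the first basis vector alone rescales the exterior product, so every nonzero
  multiple comes from a basis.\<close>

lemma scale_basis:
  assumes b: "is_basis bs U" and c: "c \<noteq> 0" and ne: "bs \<noteq> []"
  obtains bs' where "is_basis bs' U" "\<And>t. length t = length bs \<Longrightarrow> wedge_coord bs' t = c * wedge_coord bs t"
proof -
  define bs' where "bs' = bs[0 := (\<lambda>i. c * (bs ! 0) i)]"
  have len: "length bs' = length bs" by (simp add: bs'_def)
  have w: "wedge_coord bs' t = c * wedge_coord bs t" if "length t = length bs" for t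
  proof -
    let ?A = "mat (length t) (length t) (\<lambda>(r, c). (bs ! r) (t ! c))"
    have "mat (length t) (length t) (\<lambda>(r, c). (bs' ! r) (t ! c)) = multrow 0 c ?A"
      using that ne by (intro eq_matI) (auto simp: bs'_def nth_list_update)
    then show ?thesis
      using that ne by (simp add: wedge_coord_def det_multrow[where n = "length t"])
  qed
  obtain t where t: "length t = length bs" "wedge_coord bs t \<noteq> 0"
    using independent_minor[of bs] b by (auto simp: is_basis_def)
  have b': "is_basis bs' (cvec.span (set bs'))"
    using t w c len by (intro basis_of_wedge[of _ t]) auto
  have "(\<lambda>i. c * (bs ! 0) i) \<in> cvec.span (set bs)"
    using ne by (intro cvec.span_scale cvec.span_base) auto
  then have "bs' ! r \<in> cvec.span (set bs)" if "r < length bs" for r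
    using that ne by (cases "r = 0") (auto simp: bs'_def intro: cvec.span_base)
  then have s1: "set bs' \<subseteq> cvec.span (set bs)" using len by (auto simp: in_set_conv_nth)
  have "bs ! r \<in> cvec.span (set bs')" if "r < length bs" for r
  proof (cases "r = 0")
    case True
    have "(\<lambda>i. inverse c * (bs' ! 0) i) \<in> cvec.span (set bs')"
      using ne len by (intro cvec.span_scale cvec.span_base) auto
    also have "(\<lambda>i. inverse c * (bs' ! 0) i) = bs ! 0"
      using c ne by (simp add: bs'_def fun_eq_iff)
    finally show ?thesis using True by simp
  next
    case False
    then have "bs ! r = bs' ! r" by (simp add: bs'_def)
    with that len show ?thesis by (auto intro: cvec.span_base)
  qed
  then have s2: "set bs \<subseteq> cvec.span (set bs')" by (auto simp: in_set_conv_nth)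
  have "cvec.span (set bs') = U"
    using s1 s2 is_basis_span[OF b] cvec.span_minimal[OF _ cvec.subspace_span] by blast
  with b' w that show ?thesis by auto
qed

text \<open>A change of basis multiplies all coordinates of one length by the same determinant, and
  \<open>scale_basis\<close> realises every nonzero factor.\<close>

lemma plucker_scaling_class:
  assumes V: "V \<in> flags n" and b: "\<And>k. k \<in> {1..n} \<Longrightarrow> is_basis (b k) (V k)"
  shows "plucker n V = scaling_class (pcoord n b)"
proof (intro equalityI subsetI)
  have len: "length bs = k" if "k \<in> {1..n}" "is_basis bs (V k)" for bs k
    using is_basis_length[OF that(2)] flags_dim[OF V that(1)] by simp
  fix x assume "x \<in> plucker n V"
  then obtain b' where b': "\<And>k. k \<in> {1..n} \<Longrightarrow> is_basis (b' k) (V k)" "x = pcoord n b'"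
    unfolding plucker_eq by blast
  have "\<exists>c. c \<noteq> 0 \<and> (\<forall>t. length t = k \<longrightarrow> wedge_coord (b' k) t = c * wedge_coord (b k) t)" if k: "k \<in> {1..n}" for k
  proof -
    have "set (b' k) \<subseteq> cvec.span (set (b k))"
      using is_basis_span[OF b[OF k]] is_basis_span[OF b'(1)[OF k]] cvec.span_superset by blast
    moreover have lens: "length (b' k) = k" "length (b k) = k" using len k b b' by auto
    ultimately obtain c where c: "\<And>t. length t = k \<Longrightarrow> wedge_coord (b' k) t = c * wedge_coord (b k) t"
      by (metis wedge_coord_span)
    obtain t where "length t = k" "wedge_coord (b' k) t \<noteq> 0"
      using independent_minor[of "b' k"] b'(1)[OF k] lens by (auto simp: is_basis_def)
    with c have "c \<noteq> 0" by auto
    with c show ?thesis by blast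
  qed
  then obtain c where c: "\<And>k. k \<in> {1..n} \<Longrightarrow> c k \<noteq> 0"
    "\<And>k t. k \<in> {1..n} \<Longrightarrow> length t = k \<Longrightarrow> wedge_coord (b' k) t = c k * wedge_coord (b k) t"
    by metis
  \<comment> \<open>Coordinates of lengths outside \<open>1..n\<close> are 0; the value 1 there
    keeps the scaling factors nonzero.\<close>
  have "x = (\<lambda>t. (if length t \<in> {1..n} then c (length t) else 1) * pcoord n b t)"
    using c by (auto simp: b'(2) pcoord_def fun_eq_iff tuples_sorted)
  then show "x \<in> scaling_class (pcoord n b)"
    using c(1) unfolding scaling_class_def
    by (intro CollectI exI[of _ "\<lambda>k. if k \<in> {1..n} then c k else 1"]) auto
next
  fix x assume "x \<in> scaling_class (pcoord n b)"
  then obtain c where c: "x = (\<lambda>t. c (length t) * pcoord n b t)" "\<And>k. c k \<noteq> 0"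
    by (auto simp: scaling_class_def)
  have "\<exists>bs. is_basis bs (V k) \<and> (\<forall>t. length t = k \<longrightarrow> wedge_coord bs t = c k * wedge_coord (b k) t)"
    if k: "k \<in> {1..n}" for k
  proof -
    have len: "length (b k) = k" using is_basis_length[OF b[OF k]] flags_dim[OF V k] by simp
    then have "b k \<noteq> []" using k by auto
    then show ?thesis using scale_basis[OF b[OF k] c(2)[of k]] len by metis
  qed
  then obtain b' where b': "\<And>k. k \<in> {1..n} \<Longrightarrow> is_basis (b' k) (V k)"
    "\<And>k t. k \<in> {1..n} \<Longrightarrow> length t = k \<Longrightarrow> wedge_coord (b' k) t = c k * wedge_coord (b k) t"
    by metis
  have "x = pcoord n b'"
    using b'(2) by (auto simp: c(1) pcoord_def fun_eq_iff tuples_sorted)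
  with b'(1) show "x \<in> plucker n V" unfolding plucker_eq by blast
qed

lemma plucker_in_multiproj:
  assumes V: "V \<in> flags n"
  shows "plucker n V \<in> multiproj n (tuples n)"
proof -
  obtain b where b: "\<And>k. k \<in> {1..n} \<Longrightarrow> is_basis (b k) (V k)" using flags_bases[OF V] by blast
  have "\<exists>t\<in>tuples n. length t = k \<and> pcoord n b t \<noteq> 0" if k: "k \<in> {1..n}" for k
  proof -
    have "V k \<subseteq> CN n" using V k by (auto simp: flags_def PiE_def Pi_def)
    moreover have "length (b k) = k" using is_basis_length[OF b[OF k]] flags_dim[OF V k] by simp
    ultimately show ?thesis
      using basis_coordinate_nonzero[OF b[OF k]] k by (auto simp: pcoord_def)
  qed
  then show ?thesis unfolding multiproj_def using plucker_scaling_class[OF V b]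
    by (intro CollectI exI[of _ "pcoord n b"] conjI) (simp_all add: pcoord_def)
qed

lemma scaling_class_self: "x \<in> scaling_class x"
  unfolding scaling_class_def by (intro CollectI exI[of _ "\<lambda>_. 1"]) simp

lemma scaling_class_scale:
  assumes "\<And>k. c k \<noteq> 0"
  shows "scaling_class (\<lambda>t. c (length t) * x t) = scaling_class x"
proof (intro equalityI subsetI)
  fix y assume "y \<in> scaling_class (\<lambda>t. c (length t) * x t)"
  then obtain d where "y = (\<lambda>t. d (length t) * (c (length t) * x t))" "\<And>k. d k \<noteq> 0"
    by (auto simp: scaling_class_def)
  then show "y \<in> scaling_class x" unfolding scaling_class_def using assms
    by (intro CollectI exI[of _ "\<lambda>k. d k * c k"]) (auto simp: mult.assoc)
next
  fix y assume "y \<in> scaling_class x"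
  then obtain d where "y = (\<lambda>t. d (length t) * x t)" "\<And>k. d k \<noteq> 0"
    by (auto simp: scaling_class_def)
  then show "y \<in> scaling_class (\<lambda>t. c (length t) * x t)" unfolding scaling_class_def using assms
    by (intro CollectI exI[of _ "\<lambda>k. d k / c k"]) auto
qed

section \<open>The Pluecker ideal cuts out the flag variety\<close>

text \<open>In an affine chart where the coordinates \<open>T k\<close> are nonzero, a flag has
  unique bases with the identity matrix in the columns \<open>T k\<close>. Their entries are
  quotients of coordinates, and the exchange relations show that the resulting spaces are nested and
  have the given coordinates.\<close>

lemma zero_locus_plucker_ideal: "zero_locus n (tuples n) (plucker_ideal n) \<subseteq> flag_variety n"
proof
  fix Z assume Z: "Z \<in> zero_locus n (tuples n) (plucker_ideal n)"
  then obtain x where x: "Z = scaling_class x" "\<And>t. t \<notin> tuples n \<Longrightarrow> x t = 0"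
    "\<forall>k\<in>{1..n}. \<exists>t\<in>tuples n. length t = k \<and> x t \<noteq> 0"
    by (auto simp: zero_locus_def multiproj_def)
  have van: "eval_at x f = 0" if "f \<in> plucker_ideal n" for f
    using Z that scaling_class_self[of x] by (auto simp: zero_locus_def vanishes_at_def x(1))
  obtain T where T: "\<And>k. k \<in> {1..n} \<Longrightarrow> T k \<in> tuples n" "\<And>k. k \<in> {1..n} \<Longrightarrow> length (T k) = k"
    "\<And>k. k \<in> {1..n} \<Longrightarrow> x (T k) \<noteq> 0"
    using x(3) by metis
  have TN: "set (T k) \<subseteq> N n" "distinct (T k)" if "k \<in> {1..n}" for k
    using T(1)[OF that] by (auto simp: tuples_sorted)
  define X where "X L = eval_at x (col_poly n L)" for L
  have X_tuple: "X t = x t" if "t \<in> tuples n" for t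
    using that by (simp add: X_def col_poly_tuple)
  have X_T: "X (T k) \<noteq> 0" if "k \<in> {1..n}" for k
    using T that by (simp add: X_tuple)
  have X_dist: "X L = 0" if "\<not> distinct L" for L
    using that by (simp add: X_def col_poly_not_distinct)
  have exch: "X P * X Q = (\<Sum>i<length P. X (P[i := Q ! s]) * X (Q[s := P ! i]))"
    if "set P \<subseteq> N n" "length P \<le> n" "set Q \<subseteq> N n" "1 \<le> length Q" "length Q \<le> length P" "s < length Q" for P Q s
    using van[OF exchange_in_plucker_ideal[OF that]] by (simp add: X_def)
  \<comment> \<open>By Cramer's rule these are the only possible entries of a basis normalised on
    the columns \<open>T k\<close>.\<close>
  define b where "b k = map (\<lambda>i j. if j \<in> N n then X ((T k)[i := j]) / X (T k) else 0) [0..<k]" for k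
  have b_nth: "(b k ! i) j = (if j \<in> N n then X ((T k)[i := j]) / X (T k) else 0)" if "i < k" for k i j
    using that by (simp add: b_def)
  have len_b: "length (b k) = k" for k by (simp add: b_def)
  have b_T: "(b k ! i) (T k ! j) = (if i = j then 1 else 0)" if k: "k \<in> {1..n}" and ij: "i < k" "j < k" for k i j
  proof (cases "i = j")
    case True
    then show ?thesis using X_T[OF k] TN[OF k] T(2)[OF k] ij by (auto simp: b_nth)
  next
    case False
    have "\<not> distinct ((T k)[i := T k ! j])"
    proof
      assume "distinct ((T k)[i := T k ! j])"
      then show False
        using nth_eq_iff_index_eq[of "(T k)[i := T k ! j]" i j] False ij T(2)[OF k] by simp
    qed
    then show ?thesis using False ij by (simp add: b_nth X_dist)
  qed
  have w_T: "wedge_coord (b k) (T k) = 1" if k: "k \<in> {1..n}" for k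
  proof -
    have "wedge_coord (b k) (T k) = delta (T k) (T k)"
      unfolding wedge_coord_minor delta_def
      using b_T[OF k] T(2)[OF k] TN(2)[OF k]
      by (intro minor_cong) (auto simp: in_set_conv_nth nth_eq_iff_index_eq)
    then show ?thesis using TN(2)[OF k] by (simp add: delta_self)
  qed
  have w_upd: "wedge_coord (b k) ((T k)[a := q]) = (b k ! a) q" if k: "k \<in> {1..n}" and a: "a < k" for k a q
  proof -
    have "(\<Sum>i<k. (b k ! a) (T k ! i) * wedge_coord (b k) ((T k)[i := q])) = (b k ! a) q"
      using minor_cramer[of a "T k" "\<lambda>r. b k ! r" q] w_T[OF k] T(2)[OF k] a
      by (simp add: wedge_coord_minor)
    moreover have "(\<Sum>i<k. (b k ! a) (T k ! i) * wedge_coord (b k) ((T k)[i := q])) =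
        (\<Sum>i<k. if a = i then wedge_coord (b k) ((T k)[i := q]) else 0)"
      using b_T[OF k a] by (intro sum.cong) auto
    ultimately show ?thesis using a by simp
  qed
  have X_wedge: "X L = X (T k) * wedge_coord (b k) L" if k: "k \<in> {1..n}" and "length L = k" "set L \<subseteq> N n" for k L
    using that(2,3)
  \<comment> \<open>Exchanging an entry of \<open>L\<close> outside \<open>T k\<close> against the
    entries of \<open>T k\<close> lowers their number. The relation holds for \<open>X\<close> and
    for the minors alike, and coefficients agree because both are one-entry changes of
    \<open>T k\<close>.\<close>
  proof (induction "card {s. s < k \<and> L ! s \<notin> set (T k)}" arbitrary: L rule: less_induct)
    case less
    show ?case
    proof (cases "set L \<subseteq> set (T k)")
      case True
      have "X L = delta (T k) L * X (T k)"
        using col_poly_delta[OF TN[OF k], of L] True less.prems T(2)[OF k] by (simp add: X_def)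
      moreover have "wedge_coord (b k) L = wedge_coord (b k) (T k) * delta (T k) L"
        unfolding wedge_coord_minor using True less.prems T(2)[OF k] TN(2)[OF k] by (intro minor_delta) auto
      ultimately show ?thesis using w_T[OF k] by simp
    next
      case False
      then obtain s where s: "s < k" "L ! s \<notin> set (T k)"
        using less.prems(1) by (auto simp: in_set_conv_nth subset_iff)
      have IH: "X (L[s := T k ! i]) = X (T k) * wedge_coord (b k) (L[s := T k ! i])" if i: "i < k" for i
      proof (rule less.hyps)
        have "T k ! i \<in> set (T k)" using i T(2)[OF k] by simp
        then have "{s'. s' < k \<and> L[s := T k ! i] ! s' \<notin> set (T k)} \<subset> {s. s < k \<and> L ! s \<notin> set (T k)}"
          using s less.prems(1) by (auto simp: nth_list_update)
        then show "card {s'. s' < k \<and> L[s := T k ! i] ! s' \<notin> set (T k)} < card {s. s < k \<and> L ! s \<notin> set (T k)}"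
          by (intro psubset_card_mono) auto
        show "length (L[s := T k ! i]) = k" using less.prems by simp
        show "set (L[s := T k ! i]) \<subseteq> N n"
          using less.prems \<open>T k ! i \<in> set (T k)\<close> TN(1)[OF k] set_update_subset_insert[of L s] by blast
      qed
      have LN: "L ! s \<in> N n" using less.prems s by auto
      have "X (T k) * X L = (\<Sum>i<k. X ((T k)[i := L ! s]) * X (L[s := T k ! i]))"
        using exch[of "T k" L s] TN[OF k] T(2)[OF k] k s less.prems by simp
      also have "\<dots> = (\<Sum>i<k. (X (T k) * X (T k)) * (wedge_coord (b k) ((T k)[i := L ! s]) * wedge_coord (b k) (L[s := T k ! i])))"
        using IH w_upd[OF k] X_T[OF k] LN by (intro sum.cong) (auto simp: b_nth)
      also have "\<dots> = (X (T k) * X (T k)) * (wedge_coord (b k) (T k) * wedge_coord (b k) L)"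
      proof -
        have "minor (\<lambda>r. b k ! r) (T k) * minor (\<lambda>r. b k ! r) L =
          (\<Sum>i<length (T k). minor (\<lambda>r. b k ! r) ((T k)[i := L ! s]) * minor (\<lambda>r. b k ! r) (L[s := T k ! i]))"
        proof (rule minor_exchange)
          show "s < length L" using s less.prems by simp
          show "(b k ! r) j = (\<Sum>a<length (T k). (if a = r then 1 else 0) * (b k ! a) j)" if "r < length L" for r j
            using that less.prems T(2)[OF k] by (simp add: if_distrib[of "\<lambda>c. c * _"] cong: if_cong)
        qed
        then show ?thesis using T(2)[OF k] by (simp add: wedge_coord_minor sum_distrib_left)
      qed
      finally show ?thesis using w_T[OF k] X_T[OF k] by simp
    qed
  qed
  define V where "V = (\<lambda>k\<in>{1..n}. cvec.span (set (b k)))"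
  have basis: "is_basis (b k) (V k)" "cvec.dim (V k) = k" if k: "k \<in> {1..n}" for k
    using basis_of_wedge[of "b k" "T k"] w_T[OF k] T(2)[OF k] k by (auto simp: V_def len_b)
  have "b k ! i \<in> CN n" if "i < k" for k i using that by (simp add: CN_def b_nth)
  then have "set (b k) \<subseteq> CN n" for k by (auto simp: in_set_conv_nth len_b)
  then have sub: "cvec.span (set (b k)) \<subseteq> CN n" for k by (intro cvec.span_minimal subspace_CN)
  have mono: "V k \<subseteq> V (Suc k)" if k: "k \<in> {1..<n}" for k
  proof -
    have k1: "k \<in> {1..n}" "Suc k \<in> {1..n}" using k by auto
    \<comment> \<open>The exchange relation between \<open>T (Suc k)\<close> and \<open>T k\<close>
      with entry \<open>s\<close> replaced by \<open>j\<close>. The coefficients are the entries of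
      \<open>b k ! s\<close> in the columns \<open>T (Suc k)\<close>.\<close>
    have "b k ! s \<in> cvec.span (set (b (Suc k)))" if s: "s < k" for s
    proof (rule span_listI)
      fix j
      show "(b k ! s) j = (\<Sum>a<length (b (Suc k)). (X ((T k)[s := T (Suc k) ! a]) / X (T k)) * (b (Suc k) ! a) j)"
      proof (cases "j \<in> N n")
        case True
        have "set ((T k)[s := j]) \<subseteq> N n"
          using True TN(1)[OF k1(1)] set_update_subset_insert[of "T k" s j] by blast
        then have "X (T (Suc k)) * X ((T k)[s := j]) =
            (\<Sum>i<Suc k. X ((T (Suc k))[i := j]) * X ((T k)[s := T (Suc k) ! i]))"
          using exch[of "T (Suc k)" "(T k)[s := j]" s] TN(1)[OF k1(2)] T(2)[OF k1(1)] T(2)[OF k1(2)] k1 s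
          by (simp del: sum.lessThan_Suc)
        then have "X ((T k)[s := j]) / X (T k) =
            (\<Sum>i<Suc k. X ((T (Suc k))[i := j]) * X ((T k)[s := T (Suc k) ! i])) / (X (T (Suc k)) * X (T k))"
          using X_T[OF k1(1)] X_T[OF k1(2)] by (simp add: divide_simps mult.commute del: sum.lessThan_Suc)
        also have "\<dots> = (\<Sum>a<Suc k. (X ((T k)[s := T (Suc k) ! a]) / X (T k)) * (b (Suc k) ! a) j)"
          unfolding sum_divide_distrib using True by (intro sum.cong) (auto simp: b_nth mult.commute)
        finally show ?thesis using True s by (simp add: b_nth len_b del: sum.lessThan_Suc)
      next
        case False
        then have "(\<Sum>a<length (b (Suc k)). (X ((T k)[s := T (Suc k) ! a]) / X (T k)) * (b (Suc k) ! a) j) = 0"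
          by (intro sum.neutral) (auto simp: b_nth len_b)
        with False s show ?thesis by (simp add: b_nth)
      qed
    qed
    then have "set (b k) \<subseteq> cvec.span (set (b (Suc k)))" by (auto simp: in_set_conv_nth len_b)
    then show ?thesis using k1 by (simp add: V_def cvec.span_minimal)
  qed
  have V: "V \<in> flags n"
    unfolding flags_def using basis(2) mono sub by (auto simp: V_def)
  have "pcoord n b = (\<lambda>t. (if length t \<in> {1..n} then 1 / x (T (length t)) else 1) * x t)"
  proof
    fix t
    show "pcoord n b t = (if length t \<in> {1..n} then 1 / x (T (length t)) else 1) * x t"
    proof (cases "t \<in> tuples n")
      case True
      then have k: "length t \<in> {1..n}" and "set t \<subseteq> N n" by (auto simp: tuples_sorted)
      then have "x t = x (T (length t)) * wedge_coord (b (length t)) t"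
        using X_wedge[OF k, of t] X_tuple[OF True] X_tuple[OF T(1)[OF k]] by simp
      then show ?thesis using True k T(3)[OF k] by (simp add: pcoord_def)
    qed (simp add: pcoord_def x(2))
  qed
  then have "scaling_class (pcoord n b) = scaling_class x"
    using scaling_class_scale[of "\<lambda>k. if k \<in> {1..n} then 1 / x (T k) else 1" x] T(3) by simp
  then have "plucker n V = Z"
    using plucker_scaling_class[OF V basis(1)] x(1) by simp
  with V show "Z \<in> flag_variety n" by (auto simp: flag_variety_def)
qed

section \<open>Standard monomials are determined by their row contents\<close>

lemma col_le_trans: "col_le c d \<Longrightarrow> col_le d f \<Longrightarrow> col_le c f"
  unfolding col_le_def by (meson le_trans less_le_trans)

lemma least_column:
  assumes "finite A" "A \<noteq> {}" "\<And>c d. c \<in> A \<Longrightarrow> d \<in> A \<Longrightarrow> col_le c d \<or> col_le d c"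
  shows "\<exists>c\<in>A. \<forall>d\<in>A. col_le c d"
  using assms
proof (induction A rule: finite_ne_induct)
  case (insert x A)
  then obtain c where c: "c \<in> A" "\<forall>d\<in>A. col_le c d" by auto
  then consider "col_le c x" | "col_le x c" using insert.prems by blast
  then show ?case
  proof cases
    case 1
    with c insert.prems show ?thesis by (intro bexI[of _ c]) auto
  next
    case 2
    then have "col_le x d" if "d \<in> insert x A" for d
      using that c insert.prems[of x x] col_le_trans by blast
    then show ?thesis by blast
  qed
qed (auto simp: col_le_def)

definition row_count :: "nat \<Rightarrow> int \<Rightarrow> (int list \<Rightarrow>\<^sub>0 nat) \<Rightarrow> nat" where
  "row_count i j = wt (\<lambda>t. if i < length t \<and> csort t ! i = j then 1 else 0)"

lemma row_count_nonzero:
  "row_count i j m \<noteq> 0 \<longleftrightarrow> (\<exists>t\<in>Poly_Mapping.keys m. i < length t \<and> csort t ! i = j)"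
  by (auto simp: row_count_def wt_def in_keys_iff)

text \<open>Rows of a semistandard tableau increase weakly, so its first column consists of the
  least entries of the rows and is visible in the row counts. Removing it leaves a smaller
  tableau.\<close>

lemma standard_eqI:
  assumes "standard m" "standard m'" "Poly_Mapping.keys m \<subseteq> tuples n" "Poly_Mapping.keys m' \<subseteq> tuples n"
    and "\<And>i j. row_count i j m = row_count i j m'"
  shows "m = m'"
  using assms
proof (induction "wt (\<lambda>_. 1::nat) m" arbitrary: m m' rule: less_induct)
  case less
  have nonzero: "\<exists>i j. row_count i j k \<noteq> 0" if "k \<noteq> 0" "Poly_Mapping.keys k \<subseteq> tuples n" for k
  proof -
    obtain c where c: "c \<in> Poly_Mapping.keys k" using \<open>k \<noteq> 0\<close> by (metis keys_eq_empty ex_in_conv)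
    then have "0 < length c" using that by (auto simp: tuples_sorted)
    with c show ?thesis unfolding row_count_nonzero by blast
  qed
  have zero: "row_count i j 0 = 0" for i j by (simp add: row_count_def wt_def)
  show ?case
  proof (cases "m = 0 \<or> m' = 0")
    case True
    then show ?thesis using nonzero[of m] nonzero[of m'] less.prems zero by metis
  next
    case False
    obtain c where c: "c \<in> Poly_Mapping.keys m" "\<And>d. d \<in> Poly_Mapping.keys m \<Longrightarrow> col_le c d"
      using least_column[of "Poly_Mapping.keys m"] False less.prems(1) unfolding standard_def by auto
    obtain c' where c': "c' \<in> Poly_Mapping.keys m'" "\<And>d. d \<in> Poly_Mapping.keys m' \<Longrightarrow> col_le c' d"
      using least_column[of "Poly_Mapping.keys m'"] False less.prems(2) unfolding standard_def by auto
    \<comment> \<open>An entry of row \<open>i\<close> in one tableau occurs in row \<open>i\<close>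
      of the other, hence is at least the entry of the other's first column. Applied in both
      directions.\<close>
    have rows: "i < length d' \<and> code (csort d' ! i) \<le> code (csort d ! i)"
      if d: "d \<in> Poly_Mapping.keys k" and d': "\<And>f. f \<in> Poly_Mapping.keys k' \<Longrightarrow> col_le d' f"
        and eq: "row_count i (csort d ! i) k = row_count i (csort d ! i) k'" and i: "i < length d" for d d' k k' i
    proof -
      have "row_count i (csort d ! i) k \<noteq> 0" using d i row_count_nonzero by blast
      then obtain f where "f \<in> Poly_Mapping.keys k'" "i < length f" "csort f ! i = csort d ! i"
        using eq row_count_nonzero by metis
      with d'[of f] show ?thesis by (auto simp: col_le_def)
    qed
    have r1: "i < length c' \<and> code (csort c' ! i) \<le> code (csort c ! i)" if "i < length c" for i
      by (rule rows[OF c(1) c'(2) less.prems(5) that])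
    have r2: "i < length c \<and> code (csort c ! i) \<le> code (csort c' ! i)" if "i < length c'" for i
      by (rule rows[OF c'(1) c(2) less.prems(5)[symmetric] that])
    have "length c = length c'"
      using r1[of "length c'"] r2[of "length c"] by (metis less_irrefl linorder_neqE_nat)
    then have "csort c = csort c'"
      using r1 r2 by (intro nth_equalityI) (auto simp: code_inj[symmetric] intro: antisym)
    then have "set c = set c'" by (metis set_csort)
    then have cc: "c = c'" using c(1) c'(1) less.prems by (intro tuples_eqI[of c n c']) auto
    define k k' where "k = m - Poly_Mapping.single c 1" and "k' = m' - Poly_Mapping.single c 1"
    have m: "m = k + Poly_Mapping.single c 1" and m': "m' = k' + Poly_Mapping.single c 1"
      using c(1) c'(1) cc
      by (auto intro!: poly_mapping_eqI simp: k_def k'_def lookup_add lookup_minus lookup_single when_def in_keys_iff)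
    have sub: "Poly_Mapping.keys k \<subseteq> Poly_Mapping.keys m" "Poly_Mapping.keys k' \<subseteq> Poly_Mapping.keys m'"
      by (auto simp: k_def k'_def in_keys_iff lookup_minus)
    have "k = k'"
    proof (rule less.hyps)
      show "wt (\<lambda>_. 1) k < wt (\<lambda>_. 1::nat) m" unfolding m by (simp add: wt_add wt_single)
      show "standard k" "standard k'" using less.prems(1,2) sub unfolding standard_def by blast+
      show "Poly_Mapping.keys k \<subseteq> tuples n" "Poly_Mapping.keys k' \<subseteq> tuples n" using less.prems sub by auto
      show "row_count i j k = row_count i j k'" for i j
        using less.prems(5)[of i j] unfolding m m' row_count_def by (simp add: wt_add)
    qed
    then show ?thesis using m m' by simp
  qed
qed

lemma digits_unique:
  fixes a b :: "nat \<Rightarrow> nat"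
  assumes "\<And>q. q < E \<Longrightarrow> a q < D" "\<And>q. q < E \<Longrightarrow> b q < D"
    and "(\<Sum>q<E. a q * D ^ q) = (\<Sum>q<E. b q * D ^ q)" "q < E"
  shows "a q = b q"
  using assms
proof (induction E arbitrary: a b q)
  case (Suc E)
  have shift: "(\<Sum>q<Suc E. f q * D ^ q) = f 0 + D * (\<Sum>q<E. f (Suc q) * D ^ q)" for f :: "nat \<Rightarrow> nat"
    by (simp add: sum.lessThan_Suc_shift sum_distrib_left algebra_simps del: sum.lessThan_Suc)
  have eq: "a 0 + D * (\<Sum>q<E. a (Suc q) * D ^ q) = b 0 + D * (\<Sum>q<E. b (Suc q) * D ^ q)"
    using Suc.prems(3) unfolding shift .
  have lt: "a 0 < D" "b 0 < D" using Suc.prems(1,2) by auto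
  have "a 0 = b 0" using arg_cong[OF eq, of "\<lambda>x. x mod D"] lt by simp
  have tails: "(\<Sum>q<E. a (Suc q) * D ^ q) = (\<Sum>q<E. b (Suc q) * D ^ q)"
    using eq lt \<open>a 0 = b 0\<close> by simp
  have "a (Suc q) = b (Suc q)" if "q < E" for q
  proof (rule Suc.IH[OF _ _ tails])
    show "a (Suc r) < D" if "r < E" for r using that by (intro Suc.prems(1)) simp
    show "b (Suc r) < D" if "r < E" for r using that by (intro Suc.prems(2)) simp
  qed (rule that)
  then show ?case using Suc.prems(4) \<open>a 0 = b 0\<close> by (cases q) auto
qed simp

section \<open>A curve on which standard monomials have different orders of growth\<close>

text \<open>Numbers the matrix entries row by row. Codes are at most \<open>2 * n + 1\<close>, so
  the blocks of length \<open>2 * n + 2\<close> do not overlap and later rows outrank earlier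
  ones.\<close>

definition idx :: "nat \<Rightarrow> nat \<Rightarrow> int \<Rightarrow> nat" where
  "idx n i j = i * (2 * n + 2) + code j"

lemma idx_mono: "j \<in> N n \<Longrightarrow> i < i' \<Longrightarrow> idx n i j < idx n i' j'"
proof -
  assume "j \<in> N n" "i < i'"
  then have "idx n i j < Suc i * (2 * n + 2)" using code_bounds[of j n] by (simp add: idx_def)
  also have "\<dots> \<le> i' * (2 * n + 2)" using \<open>i < i'\<close> by (intro mult_right_mono) auto
  finally show ?thesis by (simp add: idx_def)
qed

lemma idx_inj: "j \<in> N n \<Longrightarrow> j' \<in> N n \<Longrightarrow> idx n i j = idx n i' j' \<longleftrightarrow> i = i' \<and> j = j'"
  using idx_mono[of j n i i' j'] idx_mono[of j' n i' i j]
  by (cases i i' rule: linorder_cases) (auto simp: idx_def code_inj)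

text \<open>The zero pattern is that of the Borel orbit, with rows counted from 0; the double
  exponential makes the degree behave like a monomial order.\<close>

definition curve_row :: "nat \<Rightarrow> nat \<Rightarrow> nat \<Rightarrow> int \<Rightarrow> complex poly" where
  "curve_row n D i j = (if j \<in> N n \<and> i < nat \<bar>j\<bar> then monom 1 (D ^ idx n i j) else 0)"

definition growth :: "nat \<Rightarrow> nat \<Rightarrow> int list \<Rightarrow> nat" where
  "growth n D t = (\<Sum>i<length t. D ^ idx n i (csort t ! i))"

text \<open>If the entry had absolute value \<open>l \<le> i\<close>, the entries
  \<open>0..i\<close> would be \<open>i + 1 > l\<close> entries of absolute value at most
  \<open>l\<close>.\<close>

lemma admissible_entry:
  assumes t: "t \<in> Theta n" and i: "i < length t"
  shows "i < nat \<bar>csort t ! i\<bar>"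
proof (rule ccontr)
  assume not: "\<not> i < nat \<bar>csort t ! i\<bar>"
  define l where "l = nat \<bar>csort t ! i\<bar>"
  have t': "t \<in> tuples n" "admissible n t" using t by (auto simp: Theta_def)
  have "csort t ! i \<in> set (csort t)" using i by (intro nth_mem) simp
  then have "csort t ! i \<in> N n" using t' by (auto simp: tuples_sorted)
  then have l: "l \<in> {1..n}" "l \<le> i" using not by (auto simp: l_def N_def)
  have "{..i} \<subseteq> {r. r < length (csort t) \<and> \<bar>csort t ! r\<bar> \<le> int l}"
  proof
    fix r assume r: "r \<in> {..i}"
    then have "code (csort t ! r) \<le> code (csort t ! i)"
      using csort_strict[of t r i] i t' by (cases "r = i") (auto simp: tuples_sorted)
    then have "code (csort t ! r) div 2 \<le> code (csort t ! i) div 2" by (rule div_le_mono)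
    then show "r \<in> {r. r < length (csort t) \<and> \<bar>csort t ! r\<bar> \<le> int l}"
      using r i by (auto simp: code_def l_def)
  qed
  then have "card {..i} \<le> card {r. r < length (csort t) \<and> \<bar>csort t ! r\<bar> \<le> int l}"
    by (intro card_mono) auto
  also have "\<dots> = length (filter (\<lambda>i. \<bar>i\<bar> \<le> int l) (csort t))"
    by (simp add: length_filter_conv_card)
  also have "\<dots> = length (filter (\<lambda>i. \<bar>i\<bar> \<le> int l) t)"
    by (metis mset_csort mset_filter size_mset)
  also have "\<dots> \<le> l" using t'(2) l by (auto simp: admissible_def)
  finally show False using l by simp
qed

text \<open>The largest row moved by \<open>p\<close> gets a smaller entry, and as \<open>D > n\<close> its loss outweighs what the
  other rows gain.\<close>

lemma growth_permute_less:
  assumes t: "t \<in> tuples n" and D: "n < D" and p: "p permutes {0..<length t}" "p \<noteq> id"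
  shows "(\<Sum>i<length t. D ^ idx n i (csort t ! p i)) < growth n D t"
proof -
  let ?k = "length t"
  have t': "set t \<subseteq> N n" "distinct t" "?k \<le> n" using t by (auto simp: tuples_sorted)
  have tN: "csort t ! i \<in> N n" if "i < ?k" for i
    using that t'(1) nth_mem[of i "csort t"] by auto
  have fixed: "p i = i" if "i \<ge> ?k" for i using that permutes_not_in[OF p(1)] by simp
  have lt: "p i < ?k" if "i < ?k" for i using that permutes_in_image[OF p(1), of i] by simp
  define A where "A = {i. p i \<noteq> i}"
  have A: "finite A" "A \<noteq> {}"
    using p(2) fixed by (auto simp: A_def fun_eq_iff intro!: finite_subset[of _ "{..<?k}"])
      (metis lessThan_iff not_le)
  define i0 where "i0 = Max A"
  have i0: "p i0 \<noteq> i0" using Max_in[OF A] by (auto simp: i0_def A_def)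
  have above: "p i = i" if "i0 < i" for i
  proof (rule ccontr)
    assume "p i \<noteq> i"
    then have "i \<le> i0" unfolding i0_def using A by (intro Max_ge) (auto simp: A_def)
    with that show False by simp
  qed
  have i0k: "i0 < ?k" using i0 fixed by (metis not_le)
  have "p i0 < i0"
  proof (rule ccontr)
    assume "\<not> p i0 < i0"
    then have "p (p i0) = p i0" using i0 above by simp
    then have "p i0 = i0" by (rule injD[OF permutes_inj[OF p(1)]])
    with i0 show False by simp
  qed
  then have code0: "code (csort t ! p i0) < code (csort t ! i0)"
    using csort_strict[OF t'(2) _ i0k] by simp
  define M where "M = idx n i0 (csort t ! i0)"
  have M0: "M > 0" using code_bounds[OF tN[OF i0k]] by (simp add: M_def idx_def)
  \<comment> \<open>In row \<open>i0\<close> the entry has a smaller code, and earlier rows are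
    outranked by the row number. So all exponents drop below \<open>M\<close>, and the at most
    \<open>n\<close> summands stay below \<open>D * D ^ (M - 1)\<close>.\<close>
  have le: "D ^ idx n i (csort t ! p i) \<le> D ^ (M - 1)" if "i \<le> i0" for i
  proof -
    have "idx n i (csort t ! p i) < M"
    proof (cases "i = i0")
      case True
      with code0 show ?thesis by (simp add: M_def idx_def)
    next
      case False
      with that i0k show ?thesis unfolding M_def by (intro idx_mono tN lt) auto
    qed
    then show ?thesis using D by (intro power_increasing) auto
  qed
  have "(\<Sum>i\<le>i0. D ^ idx n i (csort t ! p i)) \<le> card {..i0} * D ^ (M - 1)"
    using sum_bounded_above[of "{..i0}" "\<lambda>i. D ^ idx n i (csort t ! p i)" "D ^ (M - 1)"] le by simp
  also have "\<dots> < D * D ^ (M - 1)"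
    using D i0k t'(3) by (intro mult_strict_right_mono) auto
  also have "\<dots> = D ^ idx n i0 (csort t ! i0)" using M0 by (simp add: M_def flip: power_Suc)
  also have "\<dots> \<le> (\<Sum>i\<le>i0. D ^ idx n i (csort t ! i))"
    by (rule member_le_sum) auto
  finally have less: "(\<Sum>i\<le>i0. D ^ idx n i (csort t ! p i)) < (\<Sum>i\<le>i0. D ^ idx n i (csort t ! i))" .
  have split: "(\<Sum>i<?k. f i) = (\<Sum>i\<le>i0. f i) + (\<Sum>i\<in>{i0<..<?k}. f i)" for f :: "nat \<Rightarrow> nat"
  proof -
    have eq: "{..<?k} = {..i0} \<union> {i0<..<?k}" using i0k by auto
    have "{..i0} \<inter> {i0<..<?k} = {}" by auto
    then show ?thesis unfolding eq by (intro sum.union_disjoint) simp_all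
  qed
  have "(\<Sum>i\<in>{i0<..<?k}. D ^ idx n i (csort t ! p i)) = (\<Sum>i\<in>{i0<..<?k}. D ^ idx n i (csort t ! i))"
    using above by (intro sum.cong) auto
  with less show ?thesis unfolding growth_def split by simp
qed

text \<open>Admissibility keeps the diagonal term alive and every other permutation has smaller
  degree. Passing to the \<open>ord_lt\<close>-sorted column multiplies by a unit, which has degree
  0.\<close>

lemma degree_curve_minor:
  assumes t: "t \<in> Theta n" and D: "n < D"
  shows "minor (curve_row n D) t \<noteq> 0" "degree (minor (curve_row n D) t) = growth n D t"
proof -
  let ?k = "length t" and ?u = "csort t"
  have tt: "t \<in> tuples n" using t Theta_subset by blast
  then have t': "set t \<subseteq> N n" "distinct t" by (auto simp: tuples_sorted)
  have tN: "?u ! i \<in> N n" if "i < ?k" for i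
    using that t'(1) nth_mem[of i "csort t"] by auto
  let ?P = "{p. p permutes {0..<?k}}"
  have fin: "finite ?P" by (rule finite_permutations) simp
  define tm where "tm p = of_int (sign p) * (\<Prod>i = 0..<?k. curve_row n D i (?u ! p i))" for p
  have expand: "minor (curve_row n D) ?u = (\<Sum>p\<in>?P. tm p)"
    unfolding minor_def tm_def
    by (subst det_def'[of _ ?k]) (auto intro!: sum.cong prod.cong dest: permutes_in_image)
  have tm_id: "tm id = monom 1 (growth n D t)"
  proof -
    have "(\<Prod>i = 0..<k. curve_row n D i (?u ! i)) = monom 1 (\<Sum>i<k. D ^ idx n i (?u ! i))" if "k \<le> ?k" for k
      using that
    proof (induction k)
      case (Suc k)
      then show ?case using tN[of k] admissible_entry[OF t, of k] by (simp add: curve_row_def mult_monom)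
    qed simp
    then show ?thesis by (simp add: tm_def growth_def)
  qed
  have ord_pos: "growth n D t > 0"
  proof -
    have "0 < ?k" using tt by (auto simp: tuples_sorted)
    then show ?thesis unfolding growth_def using D by (intro sum_pos) auto
  qed
  have tm_other: "degree (tm p) < growth n D t" if p: "p \<in> ?P" "p \<noteq> id" for p
  proof (cases "tm p = 0")
    case False
    have "degree (tm p) \<le> degree (of_int (sign p) :: complex poly) + degree (\<Prod>i = 0..<?k. curve_row n D i (?u ! p i))"
      unfolding tm_def by (rule degree_mult_le)
    also have "degree (of_int (sign p) :: complex poly) = 0" by simp
    also have "degree (\<Prod>i = 0..<?k. curve_row n D i (?u ! p i)) \<le> (\<Sum>i = 0..<?k. degree (curve_row n D i (?u ! p i)))"
      using degree_prod_sum_le[of "{0..<?k}" "\<lambda>i. curve_row n D i (?u ! p i)"] by (simp add: o_def)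
    also have "\<dots> \<le> (\<Sum>i<?k. D ^ idx n i (?u ! p i))"
      unfolding atLeast0LessThan by (intro sum_mono) (auto simp: curve_row_def degree_monom_eq)
    also have "\<dots> < growth n D t" using p by (intro growth_permute_less tt D) auto
    finally show ?thesis by simp
  qed (simp add: ord_pos)
  have "id \<in> ?P" by (simp add: permutes_id)
  then have "minor (curve_row n D) ?u = monom 1 (growth n D t) + (\<Sum>p\<in>?P - {id}. tm p)"
    unfolding expand using fin by (simp add: sum.remove[of _ id tm] tm_id)
  moreover have small: "degree (\<Sum>p\<in>?P - {id}. tm p) < growth n D t"
    using fin tm_other ord_pos by (intro degree_sum_less) auto
  ultimately have deg: "degree (minor (curve_row n D) ?u) = growth n D t"
    by (simp add: degree_add_eq_left degree_monom_eq)
  have unit: "delta ?u t * delta t ?u = (1 :: complex poly)"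
    using t' by (intro delta_inverse) auto
  have m: "minor (curve_row n D) t = minor (curve_row n D) ?u * delta ?u t"
    using t' by (intro minor_delta) auto
  have nz: "minor (curve_row n D) ?u \<noteq> 0" using deg ord_pos by auto
  have d: "delta ?u t \<noteq> (0 :: complex poly)" using unit by auto
  have "(delta ?u t :: complex poly) dvd 1" using unit by (metis dvd_triv_left)
  then have "degree (delta ?u t :: complex poly) = 0" using d by (simp add: is_unit_iff_degree)
  note d = d this
  show "minor (curve_row n D) t \<noteq> 0" using m nz d by simp
  show "degree (minor (curve_row n D) t) = growth n D t" using m nz d deg by (simp add: degree_mult_eq)
qed

lemma degree_curve_monomial:
  assumes m: "Poly_Mapping.keys m \<subseteq> Theta n" and D: "n < D"
  shows "mon_val (minor (curve_row n D)) m \<noteq> 0"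
    "degree (mon_val (minor (curve_row n D)) m) = wt (growth n D) m"
proof -
  have nz: "minor (curve_row n D) t ^ Poly_Mapping.lookup m t \<noteq> 0" if "t \<in> Poly_Mapping.keys m" for t
    using degree_curve_minor(1)[OF _ D] m that by auto
  then show "mon_val (minor (curve_row n D)) m \<noteq> 0" by (simp add: mon_val_def)
  have "degree (mon_val (minor (curve_row n D)) m) =
      (\<Sum>t\<in>Poly_Mapping.keys m. degree (minor (curve_row n D) t ^ Poly_Mapping.lookup m t))"
    unfolding mon_val_def using nz by (intro degree_prod_eq_sum_degree) auto
  also have "\<dots> = wt (growth n D) m"
    unfolding wt_def using degree_curve_minor[OF _ D] m
    by (intro sum.cong refl) (auto simp: degree_power_eq subset_iff)
  finally show "degree (mon_val (minor (curve_row n D)) m) = wt (growth n D) m" .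
qed

text \<open>The row contents are the base \<open>D\<close> digits of the order of growth.\<close>

lemma wt_growth_inj:
  assumes st: "standard m" "standard m'" and keys: "Poly_Mapping.keys m \<subseteq> tuples n" "Poly_Mapping.keys m' \<subseteq> tuples n"
    and D: "wt (\<lambda>_. 1) m < D" "wt (\<lambda>_. 1) m' < D" and eq: "wt (growth n D) m = wt (growth n D) m'"
  shows "m = m'"
proof (rule standard_eqI[OF st keys])
  fix i j
  define E where "E = n * (2 * n + 2)"
  define ind where "ind e t = (if \<exists>r<length t. idx n r (csort t ! r) = e then 1 else 0 :: nat)" for e t
  have tN: "csort t ! r \<in> N n" if "t \<in> tuples n" "r < length t" for t r
    using that nth_mem[of r "csort t"] by (auto simp: tuples_sorted)
  have ord: "growth n D t = (\<Sum>e<E. ind e t * D ^ e)" if t: "t \<in> tuples n" for t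
  proof -
    have "idx n r (csort t ! r) < E" if "r < length t" for r
    proof -
      have "idx n r (csort t ! r) < idx n n 0" using that t by (intro idx_mono tN) (auto simp: tuples_sorted)
      then show ?thesis by (simp add: idx_def E_def code_def)
    qed
    then have im: "(\<lambda>r. idx n r (csort t ! r)) ` {..<length t} = {e. e < E \<and> (\<exists>r<length t. idx n r (csort t ! r) = e)}"
      by auto
    have "inj_on (\<lambda>r. idx n r (csort t ! r)) {..<length t}"
      using tN[OF t] by (auto simp: inj_on_def idx_inj)
    then have "growth n D t = (\<Sum>e | e < E \<and> (\<exists>r<length t. idx n r (csort t ! r) = e). D ^ e)"
      unfolding growth_def by (simp add: im[symmetric] sum.reindex)
    also have "\<dots> = (\<Sum>e<E. ind e t * D ^ e)"
      by (intro sum.mono_neutral_cong_left) (auto simp: ind_def)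
    finally show ?thesis .
  qed
  have wt_ord: "wt (growth n D) k = (\<Sum>e<E. wt (ind e) k * D ^ e)" if "Poly_Mapping.keys k \<subseteq> tuples n" for k
  proof -
    have "wt (growth n D) k = (\<Sum>c\<in>Poly_Mapping.keys k. \<Sum>e<E. Poly_Mapping.lookup k c * ind e c * D ^ e)"
      unfolding wt_def using that ord by (intro sum.cong) (auto simp: sum_distrib_left mult.assoc)
    also have "\<dots> = (\<Sum>e<E. wt (ind e) k * D ^ e)"
      by (subst sum.swap) (simp add: wt_def sum_distrib_right)
    finally show ?thesis .
  qed
  \<comment> \<open>A column has at most one entry at each place, so a digit is bounded by the
    degree and no carrying occurs.\<close>
  have digit: "wt (ind e) k < D" if "wt (\<lambda>_. 1) k < D" for e and k :: "int list \<Rightarrow>\<^sub>0 nat"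
  proof -
    have "wt (ind e) k \<le> wt (\<lambda>_. 1) k" by (intro wt_mono) (simp add: ind_def)
    with that show ?thesis by simp
  qed
  have same: "wt (ind e) m = wt (ind e) m'" if "e < E" for e
    using eq that unfolding wt_ord[OF keys(1)] wt_ord[OF keys(2)]
    by (intro digits_unique[where E = E and D = D and a = "\<lambda>e. wt (ind e) m"] digit D) auto
  show "row_count i j m = row_count i j m'"
  proof (cases "i < n \<and> j \<in> N n")
    case True
    have "row_count i j k = wt (ind (idx n i j)) k" if "Poly_Mapping.keys k \<subseteq> tuples n" for k
      unfolding row_count_def wt_def
      using that True tN by (intro sum.cong refl arg_cong2[where f = "(*)"]) (auto simp: ind_def idx_inj subset_iff)
    moreover have "idx n i j < E"
      using idx_mono[of j n i n 0] True by (simp add: idx_def E_def code_def)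
    ultimately show ?thesis using same keys by simp
  next
    case False
    then have "row_count i j k = 0" if "Poly_Mapping.keys k \<subseteq> tuples n" for k
      unfolding row_count_def wt_def
      using that tN by (intro sum.neutral) (force simp: tuples_sorted)
    then show ?thesis using keys by simp
  qed
qed

section \<open>Linear independence of standard monomials on the orbit\<close>

definition curve_point :: "nat \<Rightarrow> nat \<Rightarrow> complex \<Rightarrow> nat \<Rightarrow> int \<Rightarrow> complex" where
  "curve_point n D z i j = (if j \<in> N n \<and> i < nat \<bar>j\<bar> then z ^ (D ^ idx n i j) else 0)"

lemma poly_curve_minor: "poly (minor (curve_row n D) t) z = minor (curve_point n D z) t"
proof -
  have "poly (curve_row n D i j) z = curve_point n D z i j" for i j
    by (simp add: curve_row_def curve_point_def poly_monom)
  then show ?thesis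
    unfolding minor_def det_def
    by (auto simp: poly_sum poly_prod intro!: sum.cong prod.cong dest: permutes_in_image)
qed

text \<open>Distinct standard monomials have distinct degrees along the curve, so the highest one
  cannot cancel, and a nonzero polynomial in one variable has only finitely many roots.\<close>

lemma standard_independent:
  assumes s: "s \<noteq> 0" "\<And>m. m \<in> Poly_Mapping.keys s \<Longrightarrow> standard m \<and> Poly_Mapping.keys m \<subseteq> Theta n"
  obtains D z where "z \<noteq> 0"
    "eval_at (\<lambda>t. if t \<in> tuples n then minor (curve_point n D z) t else 0) s \<noteq> 0"
proof -
  let ?K = "Poly_Mapping.keys s"
  \<comment> \<open>The summand \<open>n + 1\<close> serves the dominance of diagonal terms, the sum
    bounds the degree of every monomial of \<open>s\<close>.\<close>
  define D where "D = n + 1 + (\<Sum>m\<in>?K. wt (\<lambda>_. 1) m)"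
  have D: "n < D" by (simp add: D_def)
  have Dm: "wt (\<lambda>_. 1) m < D" if "m \<in> ?K" for m
  proof -
    have "wt (\<lambda>_. 1) m \<le> (\<Sum>m\<in>?K. wt (\<lambda>_. 1::nat) m)" using that by (intro member_le_sum) auto
    then show ?thesis by (simp add: D_def)
  qed
  let ?v = "mon_val (minor (curve_row n D))" and ?w = "wt (growth n D)"
  have keys: "Poly_Mapping.keys m \<subseteq> tuples n" if "m \<in> ?K" for m
    using s(2)[OF that] Theta_subset by blast
  define G where "G = (\<Sum>m\<in>?K. smult (Poly_Mapping.lookup s m) (?v m))"
  have "?K \<noteq> {}" using s(1) by simp
  then have "Max (?w ` ?K) \<in> ?w ` ?K" by (intro Max_in) auto
  then obtain m0 where m0: "m0 \<in> ?K" "?w m0 = Max (?w ` ?K)" by (metis imageE)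
  have less: "?w m < ?w m0" if "m \<in> ?K" "m \<noteq> m0" for m
  proof -
    have "?w m \<le> ?w m0" unfolding m0(2) using that by (intro Max_ge) auto
    moreover have "?w m \<noteq> ?w m0"
      using wt_growth_inj[of m m0 n D] s(2) keys Dm that m0(1) by blast
    ultimately show ?thesis by simp
  qed
  have "coeff G (?w m0) = (\<Sum>m\<in>?K. Poly_Mapping.lookup s m * coeff (?v m) (?w m0))"
    by (simp add: G_def coeff_sum)
  also have "\<dots> = (\<Sum>m\<in>?K. if m = m0 then Poly_Mapping.lookup s m0 * lead_coeff (?v m0) else 0)"
  proof (intro sum.cong refl)
    fix m assume m: "m \<in> ?K"
    show "Poly_Mapping.lookup s m * coeff (?v m) (?w m0) =
        (if m = m0 then Poly_Mapping.lookup s m0 * lead_coeff (?v m0) else 0)"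
      using less[OF m] degree_curve_monomial(2)[OF _ D, of m] s(2)[OF m]
      by (auto simp: coeff_eq_0)
  qed
  also have "\<dots> = Poly_Mapping.lookup s m0 * lead_coeff (?v m0)"
    using m0(1) by simp
  also have "\<dots> \<noteq> 0"
    using m0(1) degree_curve_monomial(1)[OF _ D, of m0] s(2) by (auto simp: in_keys_iff)
  finally have "G \<noteq> 0" by auto
  \<comment> \<open>The extra factor excludes \<open>z = 0\<close>, where the matrix entries
    degenerate and the curve leaves the orbit.\<close>
  then have "finite {z. poly (G * [:0, 1:]) z = 0}" by (intro poly_roots_finite) simp
  then obtain z where "poly (G * [:0, 1:]) z \<noteq> 0"
    using infinite_UNIV_char_0[where 'a = complex] by (metis (mono_tags, lifting) UNIV_eq_I mem_Collect_eq)
  then have z: "z \<noteq> 0" "poly G z \<noteq> 0" by auto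
  have "poly G z = (\<Sum>m\<in>?K. Poly_Mapping.lookup s m * poly (?v m) z)"
    by (simp add: G_def poly_sum)
  also have "\<dots> = (\<Sum>m\<in>?K. Poly_Mapping.lookup s m *
      mon_val (\<lambda>t. if t \<in> tuples n then minor (curve_point n D z) t else 0) m)"
    using keys by (intro sum.cong refl arg_cong2[where f = "(*)"])
      (auto simp: mon_val_def poly_prod poly_curve_minor subset_iff intro!: prod.cong)
  also have "\<dots> = eval_at (\<lambda>t. if t \<in> tuples n then minor (curve_point n D z) t else 0) s"
    by (simp add: eval_at_def poly_hom_eq)
  finally show ?thesis using z that[of z D] by simp
qed

section \<open>The Borel subgroup\<close>

lemma span_e:
  assumes "finite A"
  shows "v \<in> cvec.span (e ` A) \<longleftrightarrow> (\<forall>j. j \<notin> A \<longrightarrow> v j = 0)"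
proof
  assume v: "v \<in> cvec.span (e ` A)"
  have "cvec.subspace {v. \<forall>j. j \<notin> A \<longrightarrow> v j = 0}" by (auto simp: cvec.subspace_def)
  moreover have "e ` A \<subseteq> {v. \<forall>j. j \<notin> A \<longrightarrow> v j = 0}" by (auto simp: e_def)
  ultimately show "\<forall>j. j \<notin> A \<longrightarrow> v j = 0"
    using v cvec.span_minimal[of "e ` A" "{v. \<forall>j. j \<notin> A \<longrightarrow> v j = 0}"] by blast
next
  assume v: "\<forall>j. j \<notin> A \<longrightarrow> v j = 0"
  have "(\<Sum>j\<in>A. (\<lambda>i. v j * e j i)) \<in> cvec.span (e ` A)"
    by (intro cvec.span_sum cvec.span_scale cvec.span_base) auto
  also have "(\<Sum>j\<in>A. (\<lambda>i. v j * e j i)) = v"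
  proof
    fix i
    have "(\<Sum>j\<in>A. v j * e j i) = (\<Sum>j\<in>A. if j = i then v i else 0)"
      by (intro sum.cong) (auto simp: e_def)
    also have "\<dots> = v i" using assms v by simp
    finally show "(\<Sum>j\<in>A. (\<lambda>i. v j * e j i)) i = v i" by (simp add: sum_fun_apply)
  qed
  finally show "v \<in> cvec.span (e ` A)" .
qed

lemma act_hom: "module_hom (\<lambda>(c::complex) (v::cvec) i. c * v i) (\<lambda>c v i. c * v i) (act n g)"
proof -
  have "act n g (v + w) = act n g v + act n g w" for v w
    by (auto simp: act_def fun_eq_iff sum.distrib algebra_simps)
  moreover have "act n g (\<lambda>i. c * v i) = (\<lambda>i. c * act n g v i)" for c v
    by (auto simp: act_def fun_eq_iff sum_distrib_left algebra_simps)
  ultimately show ?thesis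
    by (intro module_hom.intro module_hom_axioms.intro cvec.module_axioms)
qed

lemma act_e: "j \<in> N n \<Longrightarrow> act n g (e j) = (\<lambda>i. if i \<in> N n then g i j else 0)"
  by (auto simp: act_def e_def fun_eq_iff finite_N if_distrib cong: if_cong)

lemma set_N_list: "set (N_list n) = N n" and length_N_list: "length (N_list n) = 2 * n"
  and distinct_N_list: "distinct (N_list n)"
  by (auto simp: N_list_def N_def)

text \<open>Column \<open>j\<close> is supported from \<open>j\<close> on with respect to
  \<open>ord_lt'\<close>, which means that \<open>g\<close> maps the spans of final segments into
  themselves.\<close>

definition triangular :: "nat \<Rightarrow> cmat \<Rightarrow> bool" where
  "triangular n g \<longleftrightarrow> (\<forall>i\<in>N n. \<forall>j\<in>N n. code i < code j \<longrightarrow> g i j = 0)"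

lemma permutes_eq_id_mono:
  fixes f :: "nat \<Rightarrow> nat"
  assumes p: "p permutes {0..<m}" and f: "inj_on f {0..<m}" and le: "\<And>i. i < m \<Longrightarrow> f (p i) \<le> f i"
  shows "p = id"
proof -
  have "(\<Sum>i\<in>{0..<m}. f (p i)) = (\<Sum>i\<in>{0..<m}. f i)"
    using sum.permute[OF p, of f] by (simp add: o_def)
  then have "f (p i) = f i" if "i < m" for i
    using sum_strict_mono_ex1[of "{0..<m}" "\<lambda>i. f (p i)" f] le that
    by (metis atLeastLessThan_iff finite_atLeastLessThan le_neq_implies_less less_irrefl zero_le)
  then have "p i = i" if "i < m" for i
    using f that permutes_in_image[OF p, of i] by (auto simp: inj_on_def)
  then show ?thesis using permutes_not_in[OF p] by (metis atLeastLessThan_iff eq_id_iff not_le zero_le)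
qed

text \<open>The determinant in \<open>SL\<close> lists the indices by \<open>ord_lt\<close>, for
  which the matrix need not look triangular. Hence the Leibniz formula: a permutation other than the
  identity raises some code and meets a zero.\<close>

lemma det_triangular:
  assumes "triangular n g"
  shows "det (mat (2 * n) (2 * n) (\<lambda>(r, c). g (N_list n ! r) (N_list n ! c))) = (\<Prod>i\<in>N n. g i i)"
proof -
  let ?m = "2 * n" and ?L = "N_list n"
  have L: "?L ! i \<in> N n" if "i < ?m" for i
    using that set_N_list nth_mem[of i ?L] by (simp add: length_N_list)
  have inj: "inj_on (\<lambda>i. code (?L ! i)) {0..<?m}"
    using distinct_N_list by (auto simp: inj_on_def code_inj nth_eq_iff_index_eq length_N_list)
  have "det (mat ?m ?m (\<lambda>(r, c). g (?L ! r) (?L ! c))) =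
      (\<Sum>p | p permutes {0..<?m}. of_int (sign p) * (\<Prod>i = 0..<?m. g (?L ! i) (?L ! p i)))"
    by (subst det_def'[of _ ?m]) (auto intro!: sum.cong prod.cong dest: permutes_in_image)
  also have "\<dots> = (\<Sum>p | p permutes {0..<?m}. if p = id then \<Prod>i = 0..<?m. g (?L ! i) (?L ! i) else 0)"
  proof (intro sum.cong refl)
    fix p assume "p \<in> {p. p permutes {0..<?m}}"
    then have p: "p permutes {0..<?m}" by simp
    show "of_int (sign p) * (\<Prod>i = 0..<?m. g (?L ! i) (?L ! p i)) =
        (if p = id then \<Prod>i = 0..<?m. g (?L ! i) (?L ! i) else 0)"
    proof (cases "p = id")
      case False
      then have "\<not> (\<forall>i<?m. code (?L ! p i) \<le> code (?L ! i))"
        using permutes_eq_id_mono[OF p inj] by blast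
      then obtain i where i: "i < ?m" "code (?L ! i) < code (?L ! p i)"
        by (auto simp: not_le)
      have "p i < ?m" using i permutes_in_image[OF p, of i] by simp
      then have "g (?L ! i) (?L ! p i) = 0" using assms i L by (auto simp: triangular_def)
      then have "(\<Prod>i = 0..<?m. g (?L ! i) (?L ! p i)) = 0" using i by (intro prod_zero) auto
      with False show ?thesis by simp
    qed simp
  qed
  also have "\<dots> = (\<Prod>i = 0..<?m. g (?L ! i) (?L ! i))"
    by (simp add: sum.delta finite_permutations permutes_id)
  also have "\<dots> = (\<Prod>i\<in>N n. g i i)"
    using distinct_N_list[of n] set_N_list[of n]
    by (intro prod.reindex_bij_betw[of "(!) ?L" "{0..<?m}" "N n" "\<lambda>i. g i i"] bij_betw_nth)
      (auto simp: length_N_list atLeast0LessThan)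
  finally show ?thesis .
qed

lemma triangular_SL_diag:
  assumes "triangular n g" "g \<in> SL n" "i \<in> N n"
  shows "g i i \<noteq> 0"
proof -
  have "(\<Prod>i\<in>N n. g i i) = 1" using assms by (simp add: SL_def det_triangular)
  then show ?thesis using assms(3) finite_N[of n] by (metis prod_zero_iff zero_neq_one)
qed

lemma ord_ge_code: "i \<in> N n \<Longrightarrow> {j \<in> N n. j = i \<or> ord_lt' i j} = {j \<in> N n. code i \<le> code j}"
  using code_less N_nonzero by (auto simp: order_le_less code_inj)

lemma borel_iff: "g \<in> borel n \<longleftrightarrow> g \<in> SL n \<and> triangular n g"
proof
  assume g: "g \<in> borel n"
  have "g i j = 0" if ij: "i \<in> N n" "j \<in> N n" "code i < code j" for i j
  proof -
    let ?A = "{k \<in> N n. code j \<le> code k}"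
    have "act n g ` cvec.span (e ` {k \<in> N n. k = j \<or> ord_lt' j k}) =
        cvec.span (e ` {k \<in> N n. k = j \<or> ord_lt' j k})"
      using g ij(2) by (auto simp only: borel_def Let_def)
    then have U: "act n g ` cvec.span (e ` ?A) = cvec.span (e ` ?A)"
      by (simp only: ord_ge_code[OF ij(2)])
    have "e j \<in> cvec.span (e ` ?A)" using ij by (intro cvec.span_base) auto
    then have "act n g (e j) \<in> cvec.span (e ` ?A)" using U by blast
    then have "act n g (e j) i = 0" using ij by (subst (asm) span_e) (auto simp: finite_N)
    then show ?thesis using ij by (simp add: act_e)
  qed
  then show "g \<in> SL n \<and> triangular n g" using g by (auto simp: borel_def triangular_def)
next
  assume g: "g \<in> SL n \<and> triangular n g"
  have "act n g ` cvec.span (e ` {j \<in> N n. code i \<le> code j}) = cvec.span (e ` {j \<in> N n. code i \<le> code j})"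
    if i: "i \<in> N n" for i
  proof
    let ?A = "{j \<in> N n. code i \<le> code j}"
    have finA: "finite ?A" by (simp add: finite_N)
    interpret act: module_hom "\<lambda>(c::complex) (v::cvec) i. c * v i" "\<lambda>c v i. c * v i" "act n g"
      by (rule act_hom)
    show "act n g ` cvec.span (e ` ?A) \<subseteq> cvec.span (e ` ?A)"
    proof
      fix w assume "w \<in> act n g ` cvec.span (e ` ?A)"
      then obtain v where v: "w = act n g v" "\<And>j. j \<notin> ?A \<Longrightarrow> v j = 0"
        using span_e[OF finA] by auto
      have "(\<Sum>a\<in>N n. g j a * v a) = 0" if "j \<in> N n" "code j < code i" for j
        using that v(2) g by (intro sum.neutral) (force simp: triangular_def not_le)
      then have "\<forall>j. j \<notin> ?A \<longrightarrow> w j = 0" by (auto simp: v(1) act_def not_le)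
      then show "w \<in> cvec.span (e ` ?A)" by (simp only: span_e[OF finA])
    qed
    have sub: "cvec.subspace (act n g ` cvec.span (e ` ?A))"
      by (intro act.subspace_image cvec.subspace_span)
    have "e j \<in> act n g ` cvec.span (e ` ?A)" if "j \<in> ?A" for j
      using that
    \<comment> \<open>From the last index downwards: modulo the \<open>e a\<close> of larger code,
      which are already in the image, \<open>e j\<close> is sent to \<open>g j j\<close> times
      itself.\<close>
    proof (induction "2 * n + 1 - code j" arbitrary: j rule: less_induct)
      case less
      then have j: "j \<in> N n" "code i \<le> code j" by auto
      let ?B = "{a \<in> N n. code j < code a}"
      have gj: "g j j \<noteq> 0" using g j triangular_SL_diag by blast
      have "e a \<in> act n g ` cvec.span (e ` ?A)" if "a \<in> ?B" for a
        using that j code_bounds[of a n] by (intro less.hyps) auto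
      then have "(\<Sum>a\<in>?B. (\<lambda>i. g a j * e a i)) \<in> act n g ` cvec.span (e ` ?A)"
        by (intro cvec.subspace_sum[OF sub] cvec.subspace_scale[OF sub]) auto
      moreover have "act n g (e j) \<in> act n g ` cvec.span (e ` ?A)"
        using less.prems by (intro imageI cvec.span_base) auto
      ultimately have "(\<lambda>i. inverse (g j j) * (act n g (e j) - (\<Sum>a\<in>?B. (\<lambda>i. g a j * e a i))) i)
          \<in> act n g ` cvec.span (e ` ?A)"
        by (intro cvec.subspace_scale[OF sub] cvec.subspace_diff[OF sub])
      also have "(\<lambda>i. inverse (g j j) * (act n g (e j) - (\<Sum>a\<in>?B. (\<lambda>i. g a j * e a i))) i) = e j"
      proof
        fix x
        have "(\<Sum>a\<in>?B. g a j * e a x) = (\<Sum>a\<in>?B. if a = x then g x j else 0)"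
          by (intro sum.cong) (auto simp: e_def)
        also have "\<dots> = (if x \<in> ?B then g x j else 0)" by (simp add: finite_N)
        finally have s: "(\<Sum>a\<in>?B. g a j * e a x) = (if x \<in> ?B then g x j else 0)" .
        have "act n g (e j) x - (if x \<in> ?B then g x j else 0) = (if x = j then g j j else 0)"
        proof (cases "x \<in> N n")
          case True
          then consider "x = j" | "code j < code x" | "code x < code j"
            using code_inj by (metis linorder_neqE_nat)
          then show ?thesis
            using True j g by cases (auto simp: act_e triangular_def)
        qed (use j in \<open>auto simp: act_e\<close>)
        then show "inverse (g j j) * (act n g (e j) - (\<Sum>a\<in>?B. (\<lambda>i. g a j * e a i))) x = e j x"
          using gj s by (simp add: sum_fun_apply e_def)
      qed
      finally show ?case .
    qed
    then show "cvec.span (e ` ?A) \<subseteq> act n g ` cvec.span (e ` ?A)"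
      using sub by (intro cvec.span_minimal) auto
  qed
  then show "g \<in> borel n" using g ord_ge_code by (simp add: borel_def Let_def)
qed

section \<open>The orbit of the fixed point\<close>

text \<open>Rows are counted from 0, so row \<open>i\<close> is the image of the basis vector with
  index \<open>-(i + 1)\<close>.\<close>

definition orbit_row :: "nat \<Rightarrow> cmat \<Rightarrow> nat \<Rightarrow> cvec" where
  "orbit_row n g i = act n g (e (- (int i + 1)))"

text \<open>Listed as \<open>-1, -2, ...\<close>, against \<open>ord_lt\<close>, so that columns
  match rows and the orbit matrix becomes upper triangular on them.\<close>

definition y_list :: "nat \<Rightarrow> int list" where
  "y_list k = map (\<lambda>i. - (int i + 1)) [0..<k]"

lemma y_index: "i < n \<Longrightarrow> - (int i + 1) \<in> N n"
  by (auto simp: N_def)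

lemma image_y_index: "(\<lambda>i. - (int i + 1)) ` {..<k} = {- int k..-1}"
proof (intro equalityI subsetI)
  fix x assume "x \<in> {- int k..-1}"
  then show "x \<in> (\<lambda>i. - (int i + 1)) ` {..<k}" by (intro image_eqI[of _ _ "nat (- x - 1)"]) auto
qed auto

lemma set_y_list: "set (y_list k) = {- int k..-1}"
  using image_y_index[of k] by (simp add: y_list_def atLeast0LessThan)

lemma length_y_list [simp]: "length (y_list k) = k" and distinct_y_list: "distinct (y_list k)"
  by (simp_all add: y_list_def distinct_map inj_on_def)

lemma orbit_row_entry: "i < n \<Longrightarrow> orbit_row n g i j = (if j \<in> N n then g j (- (int i + 1)) else 0)"
  unfolding orbit_row_def by (subst act_e[OF y_index]) auto

text \<open>The index \<open>-(i + 1)\<close> has code \<open>2 * i + 2\<close>, while absolute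
  value at most \<open>i\<close> gives code at most \<open>2 * i + 1\<close>.\<close>

lemma orbit_row_zero:
  assumes "triangular n g" "i < n" "nat \<bar>j\<bar> \<le> i"
  shows "orbit_row n g i j = 0"
proof -
  have "code (- (int i + 1)) = 2 * i + 2" by (simp add: code_def nat_add_distrib)
  moreover have "code j \<le> 2 * nat \<bar>j\<bar> + 1" by (simp add: code_def)
  ultimately have "code j < code (- (int i + 1))" using assms(3) by linarith
  then show ?thesis using assms y_index[of i n] by (auto simp: orbit_row_entry triangular_def)
qed

lemma flags_from_rows:
  assumes r: "\<And>i. i < n \<Longrightarrow> r i \<in> CN n"
    and w: "\<And>k. k \<in> {1..n} \<Longrightarrow> wedge_coord (map r [0..<k]) (y_list k) \<noteq> 0"
    and V: "\<And>k. k \<in> {1..n} \<Longrightarrow> V k = cvec.span (r ` {..<k})" "V \<in> extensional {1..n}"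
  shows "V \<in> flags n" "\<And>k. k \<in> {1..n} \<Longrightarrow> is_basis (map r [0..<k]) (V k)"
proof -
  have set: "set (map r [0..<k]) = r ` {..<k}" for k by (auto simp: atLeast0LessThan)
  show b: "is_basis (map r [0..<k]) (V k)" if "k \<in> {1..n}" for k
    using basis_of_wedge(1)[OF _ w[OF that]] V(1)[OF that] set by simp
  have dim: "cvec.dim (V k) = k" if "k \<in> {1..n}" for k
    using is_basis_length[OF b[OF that]] by simp
  have "V k \<subseteq> CN n" if "k \<in> {1..n}" for k
    using r that unfolding V(1)[OF that] by (intro cvec.span_minimal subspace_CN) auto
  moreover have "V k \<subseteq> V (Suc k)" if "k \<in> {1..<n}" for k
  proof -
    have "cvec.span (r ` {..<k}) \<subseteq> cvec.span (r ` {..<Suc k})" by (intro cvec.span_mono) auto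
    then show ?thesis using V(1)[of k] V(1)[of "Suc k"] that by simp
  qed
  ultimately show "V \<in> flags n"
    using dim V by (auto simp: flags_def PiE_def Pi_def)
qed

lemma orbit_flag:
  assumes g: "g \<in> SL n" "triangular n g"
  defines "V \<equiv> flag_act n g (y_flag n)"
  shows "V \<in> flags n" "\<And>k. k \<in> {1..n} \<Longrightarrow> is_basis (map (orbit_row n g) [0..<k]) (V k)"
proof -
  interpret act: module_hom "\<lambda>(c::complex) (v::cvec) i. c * v i" "\<lambda>c v i. c * v i" "act n g"
    by (rule act_hom)
  have V: "V k = cvec.span (orbit_row n g ` {..<k})" if "k \<in> {1..n}" for k
  proof -
    have "V k = act n g ` cvec.span (e ` {- int k..-1})"
      using that by (simp add: V_def flag_act_def y_flag_def)
    also have "\<dots> = cvec.span (act n g ` e ` (\<lambda>i. - (int i + 1)) ` {..<k})"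
      by (simp only: act.span_image image_y_index)
    also have "act n g ` e ` (\<lambda>i. - (int i + 1)) ` {..<k} = orbit_row n g ` {..<k}"
      by (simp add: image_image orbit_row_def)
    finally show ?thesis .
  qed
  \<comment> \<open>On the columns \<open>-1, ..., -k\<close> the matrix is upper triangular, with
    diagonal entries of \<open>g\<close> that are nonzero since its determinant is 1.\<close>
  have w: "wedge_coord (map (orbit_row n g) [0..<k]) (y_list k) \<noteq> 0" if k: "k \<in> {1..n}" for k
  proof -
    let ?A = "mat k k (\<lambda>(r, c). (map (orbit_row n g) [0..<k] ! r) (y_list k ! c))"
    have entry: "?A $$ (r, c) = orbit_row n g r (- (int c + 1))" if "r < k" "c < k" for r c
      using that by (simp add: y_list_def)
    have "upper_triangular ?A"
      using k entry g(2) by (auto simp: upper_triangular_def intro!: orbit_row_zero)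
    then have "det ?A = prod_list (diag_mat ?A)" by (rule det_upper_triangular[where n = k]) simp
    moreover have "0 \<notin> set (diag_mat ?A)"
    proof
      assume "0 \<in> set (diag_mat ?A)"
      then obtain i where "i < k" "?A $$ (i, i) = 0" by (auto simp: diag_mat_def)
      then show False
        using entry[of i i] triangular_SL_diag[OF g(2,1) y_index[of i n]] k y_index[of i n]
        by (auto simp: orbit_row_entry)
    qed
    ultimately show ?thesis by (simp add: wedge_coord_def prod_list_zero_iff)
  qed
  have ext: "V \<in> extensional {1..n}" by (simp add: V_def flag_act_def)
  have CN: "orbit_row n g i \<in> CN n" if "i < n" for i
    using that by (simp add: CN_def orbit_row_entry)
  show "V \<in> flags n" by (rule flags_from_rows(1)[OF CN w V ext])
  show "is_basis (map (orbit_row n g) [0..<k]) (V k)" if "k \<in> {1..n}" for k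
    by (rule flags_from_rows(2)[OF CN w V ext that])
qed

text \<open>More than \<open>l\<close> columns have all their nonzero entries in the first
  \<open>l\<close> rows, so every term of the determinant contains a zero.\<close>

lemma minor_not_admissible:
  fixes F :: "nat \<Rightarrow> int \<Rightarrow> complex"
  assumes "\<not> admissible n t" and F: "\<And>i j. i < length t \<Longrightarrow> nat \<bar>j\<bar> \<le> i \<Longrightarrow> F i j = 0"
  shows "minor F t = 0"
proof -
  let ?k = "length t"
  obtain l where l: "length (filter (\<lambda>i. \<bar>i\<bar> \<le> int l) t) > l"
    using assms(1) by (auto simp: admissible_def not_le)
  define S where "S = {c. c < ?k \<and> \<bar>t ! c\<bar> \<le> int l}"
  have S: "card S > l" "finite S" using l by (auto simp: S_def length_filter_conv_card)
  have "(\<Prod>j<?k. F (p j) (t ! j)) = 0" if p: "p permutes {0..<?k}" for p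
  proof (rule ccontr)
    assume "(\<Prod>j<?k. F (p j) (t ! j)) \<noteq> 0"
    then have nz: "F (p j) (t ! j) \<noteq> 0" if "j < ?k" for j using that by auto
    have "p ` S \<subseteq> {..<l}"
    proof
      fix i assume "i \<in> p ` S"
      then obtain c where c: "c < ?k" "\<bar>t ! c\<bar> \<le> int l" "i = p c" by (auto simp: S_def)
      have "p c < ?k" using c permutes_in_image[OF p, of c] by simp
      then have "\<not> nat \<bar>t ! c\<bar> \<le> p c" using F nz[OF c(1)] by blast
      with c show "i \<in> {..<l}" by auto
    qed
    then have "card (p ` S) \<le> l" using card_mono[of "{..<l}" "p ` S"] by simp
    moreover have "card (p ` S) = card S"
      using permutes_inj[OF p] by (intro card_image) (auto intro: inj_on_subset)
    ultimately show False using S by simp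
  qed
  then have "(\<Prod>j<?k. mat ?k ?k (\<lambda>(r, c). F r (t ! c)) $$ (p j, j)) = 0" if "p permutes {0..<?k}" for p
  proof -
    have "(\<Prod>j<?k. mat ?k ?k (\<lambda>(r, c). F r (t ! c)) $$ (p j, j)) = (\<Prod>j<?k. F (p j) (t ! j))"
      using permutes_in_image[OF that] by (intro prod.cong) auto
    with \<open>\<And>p. p permutes {0..<?k} \<Longrightarrow> (\<Prod>j<?k. F (p j) (t ! j)) = 0\<close> that show ?thesis by simp
  qed
  then show ?thesis unfolding minor_def by (subst det_col[of _ ?k]) (auto intro!: sum.neutral)
qed

lemma orbit_support:
  assumes g: "g \<in> SL n" "triangular n g" and x: "x \<in> plucker n (flag_act n g (y_flag n))"
    and t: "t \<notin> Theta n"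
  shows "x t = 0"
proof (cases "t \<in> tuples n")
  case True
  have "x \<in> scaling_class (pcoord n (\<lambda>k. map (orbit_row n g) [0..<k]))"
    using x plucker_scaling_class[OF orbit_flag[OF g]] by simp
  then obtain c where c: "x t = c * pcoord n (\<lambda>k. map (orbit_row n g) [0..<k]) t"
    by (auto simp: scaling_class_def)
  have "length t \<le> n" using True by (simp add: tuples_sorted)
  then have "minor (\<lambda>r. map (orbit_row n g) [0..<length t] ! r) t = 0"
    using True t g by (intro minor_not_admissible[of n]) (auto simp: Theta_def orbit_row_zero)
  then show ?thesis by (simp add: c pcoord_def wedge_coord_minor)
next
  case False
  then show ?thesis using x by (auto simp: plucker_eq pcoord_def)
qed

text \<open>Only the columns \<open>-1, \<dots>, -n\<close> of the group element matter for \<open>y\<close>; column \<open>n\<close> is free to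
  normalise the determinant.\<close>

lemma curve_in_orbit:
  assumes z: "z \<noteq> 0" and n: "1 \<le> n"
  obtains g where "g \<in> borel n"
    "(\<lambda>t. if t \<in> tuples n then minor (curve_point n D z) t else 0) \<in> plucker n (flag_act n g (y_flag n))"
proof -
  \<comment> \<open>Column \<open>-(i + 1)\<close> is row \<open>i\<close> of the curve matrix, and
    the remaining columns are those of the identity. As \<open>z \<noteq> 0\<close>, the diagonal
    has no zeros.\<close>
  define g0 where "g0 j m = (if m < 0 then curve_point n D z (nat (- m) - 1) j else if j = m then 1 else 0)"
    for j m :: int
  define c where "c = (\<Prod>i\<in>N n - {int n}. g0 i i)"
  define g where "g j m = (if m = int n then if j = m then inverse c else 0 else g0 j m)" for j m :: int
  have "g0 i i \<noteq> 0" if "i \<in> N n" for i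
    using that z by (auto simp: g0_def curve_point_def N_def)
  then have c: "c \<noteq> 0" using finite_N by (auto simp: c_def)
  have tri: "triangular n g"
    unfolding triangular_def
  proof (intro ballI impI)
    fix i j assume ij: "i \<in> N n" "j \<in> N n" "code i < code j"
    show "g i j = 0"
    proof (cases "j < 0")
      case True
      have "\<bar>i\<bar> < \<bar>j\<bar>" using ij(3) True by (auto simp: code_def split: if_splits)
      then have "\<not> nat (- j) - 1 < nat \<bar>i\<bar>" using True by auto
      then show ?thesis using True by (simp add: g_def g0_def curve_point_def)
    next
      case False
      then show ?thesis using ij by (auto simp: g_def g0_def)
    qed
  qed
  have "int n \<in> N n" using n by (simp add: N_def)
  then have "(\<Prod>i\<in>N n. g i i) = g (int n) (int n) * (\<Prod>i\<in>N n - {int n}. g i i)"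
    using finite_N by (intro prod.remove) auto
  also have "(\<Prod>i\<in>N n - {int n}. g i i) = c" by (simp add: c_def g_def)
  finally have "(\<Prod>i\<in>N n. g i i) = 1" using c by (simp add: g_def)
  then have SL: "g \<in> SL n" by (simp add: SL_def det_triangular[OF tri])
  have row: "orbit_row n g i j = curve_point n D z i j" if "i < n" for i j
  proof -
    have "- (int i + 1) \<noteq> int n" "- (int i + 1) < 0" "nat (- (- (int i + 1))) - 1 = i" by auto
    then have "g j (- (int i + 1)) = curve_point n D z i j" by (simp only: g_def g0_def if_True if_False)
    then show ?thesis using that by (simp only: orbit_row_entry) (simp add: curve_point_def)
  qed
  have "(\<lambda>t. if t \<in> tuples n then minor (curve_point n D z) t else 0) =
      pcoord n (\<lambda>k. map (orbit_row n g) [0..<k])"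
    using row by (auto simp: pcoord_def wedge_coord_minor fun_eq_iff tuples_sorted intro!: minor_cong)
  moreover have "pcoord n (\<lambda>k. map (orbit_row n g) [0..<k]) \<in> plucker n (flag_act n g (y_flag n))"
    unfolding plucker_eq using orbit_flag(2)[OF SL tri] by blast
  ultimately show ?thesis using that[of g] SL tri by (simp add: borel_iff)
qed

section \<open>The torus-fixed point\<close>

lemma torus_fixes_y:
  assumes g: "g \<in> torus n"
  shows "flag_act n g (y_flag n) = y_flag n"
proof -
  have SL: "g \<in> SL n" and off: "\<And>i j. i \<in> N n \<Longrightarrow> j \<in> N n \<Longrightarrow> i \<noteq> j \<Longrightarrow> g i j = 0"
    using g by (auto simp: torus_def)
  have tri: "triangular n g" using off by (auto simp: triangular_def)
  have act: "act n g v = (\<lambda>i. if i \<in> N n then g i i * v i else 0)" for v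
  proof
    fix i
    have "(\<Sum>j\<in>N n. g i j * v j) = (\<Sum>j\<in>N n. if j = i then g i i * v i else 0)" if "i \<in> N n"
      using off that by (intro sum.cong) auto
    then show "act n g v i = (if i \<in> N n then g i i * v i else 0)"
      by (simp add: act_def finite_N)
  qed
  have "act n g ` cvec.span (e ` {- int k..-1}) = cvec.span (e ` {- int k..-1})" if k: "k \<in> {1..n}" for k
  proof (intro equalityI subsetI)
    fix w assume "w \<in> act n g ` cvec.span (e ` {- int k..-1})"
    then show "w \<in> cvec.span (e ` {- int k..-1})" by (auto simp: span_e act)
  next
    fix w assume w: "w \<in> cvec.span (e ` {- int k..-1})"
    have "w = act n g (\<lambda>i. w i / g i i)"
    proof
      fix i
      show "w i = act n g (\<lambda>i. w i / g i i) i"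
        using w k triangular_SL_diag[OF tri SL, of i] by (auto simp: span_e act N_def)
    qed
    moreover have "(\<lambda>i. w i / g i i) \<in> cvec.span (e ` {- int k..-1})" using w by (simp add: span_e)
    ultimately show "w \<in> act n g ` cvec.span (e ` {- int k..-1})" by blast
  qed
  then show ?thesis by (auto simp: flag_act_def y_flag_def fun_eq_iff restrict_def)
qed

lemma y_bases:
  "y_flag n \<in> flags n" "\<And>k. k \<in> {1..n} \<Longrightarrow> is_basis (map (\<lambda>i. e (- (int i + 1))) [0..<k]) (y_flag n k)"
proof -
  let ?r = "\<lambda>i. e (- (int i + 1))"
  have CN: "?r i \<in> CN n" if "i < n" for i using that by (auto simp: CN_def e_def N_def)
  have w: "wedge_coord (map ?r [0..<k]) (y_list k) \<noteq> 0" for k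
  proof -
    have "wedge_coord (map ?r [0..<k]) (y_list k) = delta (y_list k) (y_list k)"
      unfolding wedge_coord_minor delta_def by (intro minor_cong) (auto simp: y_list_def e_def)
    then show ?thesis by (simp add: delta_self distinct_y_list)
  qed
  have V: "y_flag n k = cvec.span (?r ` {..<k})" if "k \<in> {1..n}" for k
  proof -
    have "?r ` {..<k} = e ` (\<lambda>i. - (int i + 1)) ` {..<k}" by (simp add: image_image)
    then show ?thesis using that by (simp only: image_y_index) (simp add: y_flag_def)
  qed
  have ext: "y_flag n \<in> extensional {1..n}" by (simp add: y_flag_def)
  show "y_flag n \<in> flags n" by (rule flags_from_rows(1)[OF CN w V ext])
  show "is_basis (map ?r [0..<k]) (y_flag n k)" if "k \<in> {1..n}" for k
    by (rule flags_from_rows(2)[OF CN w V ext that])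
qed

lemma interval_tuple: "k \<in> {1..n} \<Longrightarrow> [- int k..-1] \<in> tuples n"
proof -
  assume k: "k \<in> {1..n}"
  have "sorted_wrt ord_lt [- int k..-1]"
    by (rule sorted_wrt_mono_rel[OF _ sorted_wrt_upto]) (auto simp: ord_lt_def)
  then show ?thesis using k by (auto simp: tuples_def N_def)
qed

text \<open>The coordinates of \<open>y\<close> are multiples of \<open>delta (y_list k) t\<close>,
  nonzero exactly if \<open>t\<close> rearranges \<open>y_list k\<close>; the sorted arrangement is
  \<open>[- int k..-1]\<close>.\<close>

lemma y_coordinates:
  assumes x: "x \<in> plucker n (y_flag n)" and t: "t \<in> tuples n"
  shows "x t \<noteq> 0 \<longleftrightarrow> (\<exists>k\<in>{1..n}. t = [- int k..-1])"
proof -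
  let ?r = "\<lambda>i. e (- (int i + 1))"
  have t': "length t \<in> {1..n}" "distinct t" using t by (auto simp: tuples_sorted)
  have "x \<in> scaling_class (pcoord n (\<lambda>k. map ?r [0..<k]))"
    using x plucker_scaling_class[OF y_bases] by simp
  then obtain c where c: "x t = c * pcoord n (\<lambda>k. map ?r [0..<k]) t" "c \<noteq> 0"
    by (auto simp: scaling_class_def)
  have pc: "pcoord n (\<lambda>k. map ?r [0..<k]) t = delta (y_list (length t)) t"
    using t unfolding pcoord_def wedge_coord_minor delta_def
    by (auto intro!: minor_cong simp: y_list_def e_def)
  have "delta (y_list (length t)) t \<noteq> (0::complex) \<longleftrightarrow> set t = {- int (length t)..-1}"
  proof
    assume nz: "delta (y_list (length t)) t \<noteq> (0::complex)"
    have "set t \<subseteq> set (y_list (length t))"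
    proof
      fix j assume "j \<in> set t"
      then obtain i where i: "i < length t" "j = t ! i" by (auto simp: in_set_conv_nth)
      show "j \<in> set (y_list (length t))"
      proof (rule ccontr)
        assume "j \<notin> set (y_list (length t))"
        then have "delta (y_list (length t)) t = (0::complex)"
          unfolding delta_def using i by (intro minor_not_subset[of i]) (auto simp: in_set_conv_nth)
        with nz show False by simp
      qed
    qed
    then show "set t = {- int (length t)..-1}"
      using t'(2) distinct_y_list[of "length t"] unfolding set_y_list[symmetric]
      by (intro card_subset_eq) (auto simp: distinct_card)
  next
    assume "set t = {- int (length t)..-1}"
    then have "delta (y_list (length t)) t * delta t (y_list (length t)) = (1::complex)"
      using t'(2) by (intro delta_inverse distinct_y_list) (auto simp: set_y_list)
    then show "delta (y_list (length t)) t \<noteq> (0::complex)" by auto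
  qed
  also have "\<dots> \<longleftrightarrow> (\<exists>k\<in>{1..n}. t = [- int k..-1])"
  proof
    assume "set t = {- int (length t)..-1}"
    then have "t = [- int (length t)..-1]"
      using t'(1) by (intro tuples_eqI[OF t interval_tuple]) auto
    with t'(1) show "\<exists>k\<in>{1..n}. t = [- int k..-1]" by blast
  qed auto
  finally show ?thesis using c pc by simp
qed

section \<open>The Schubert variety\<close>

definition borel_orbit :: "nat \<Rightarrow> mpoint set" where
  "borel_orbit n = {plucker n (flag_act n g (y_flag n)) | g. g \<in> borel n}"

lemma schubert_variety_eq:
  "schubert_variety n = flag_variety n \<inter> zariski_closure n (tuples n) (borel_orbit n)"
  by (simp add: schubert_variety_def borel_orbit_def)

lemma borel_orbit_flags: "borel_orbit n \<subseteq> flag_variety n"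
  using orbit_flag(1) by (auto simp: borel_orbit_def flag_variety_def borel_iff)

lemma flag_variety_multiproj: "flag_variety n \<subseteq> multiproj n (tuples n)"
  using plucker_in_multiproj by (auto simp: flag_variety_def)

lemma borel_orbit_support: "P \<in> borel_orbit n \<Longrightarrow> x \<in> P \<Longrightarrow> t \<notin> Theta n \<Longrightarrow> x t = 0"
  using orbit_support by (auto simp: borel_orbit_def borel_iff)

lemma subset_zariski_closure: "Z \<subseteq> zariski_closure n D Z"
  by (auto simp: zariski_closure_def)

lemma borel_orbit_schubert: "borel_orbit n \<subseteq> schubert_variety n"
  using borel_orbit_flags subset_zariski_closure by (auto simp: schubert_variety_eq)

lemma multiproj_support:
  assumes "P \<in> multiproj n D" "x \<in> P" "t \<notin> D"
  shows "x t = 0"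
  using assms by (auto simp: multiproj_def scaling_class_def)

text \<open>The vanishing of a single coordinate is a closed condition and holds on the
  orbit.\<close>

lemma schubert_support:
  assumes P: "P \<in> schubert_variety n" and x: "x \<in> P" and t: "t \<notin> Theta n"
  shows "x t = 0"
proof (cases "t \<in> tuples n")
  case True
  let ?C = "zero_locus n (tuples n) {Var t}"
  have "zariski_closed n (tuples n) ?C"
    unfolding zariski_closed_def using True by (intro exI[of _ "{Var t}"]) (simp add: poly_ring_Var)
  moreover have "borel_orbit n \<subseteq> ?C"
    using borel_orbit_flags[of n] flag_variety_multiproj[of n] borel_orbit_support[OF _ _ t]
    by (auto simp: zero_locus_def vanishes_at_def)
  ultimately have "P \<in> ?C" using P by (auto simp: schubert_variety_eq zariski_closure_def)
  then show ?thesis using x by (simp add: zero_locus_def vanishes_at_def)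
next
  case False
  have "P \<in> multiproj n (tuples n)"
    using P flag_variety_multiproj by (auto simp: schubert_variety_eq)
  then show ?thesis using x False by (rule multiproj_support)
qed

text \<open>The core of the proof. On the orbit \<open>f\<close> agrees with the projection of its
  standard part \<open>s\<close>; by independence this projection is 0, so \<open>f\<close> and
  \<open>h\<close> in the Pluecker ideal have the same projection.\<close>

lemma vanishing_on_orbit_imp:
  assumes n: "1 \<le> n" and f: "f \<in> poly_ring (tuples n)" and van: "\<And>P. P \<in> borel_orbit n \<Longrightarrow> vanishes_at f P"
  shows "f \<in> I_tilde_preimage n"
proof -
  obtain h s where h: "h \<in> plucker_ideal n" and s: "s \<in> poly_ring (tuples n)" "f = h + s"
    "\<And>m. m \<in> Poly_Mapping.keys s \<Longrightarrow> standard m"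
    using straightening[OF f] by blast
  have "proj_Theta n s = 0"
  proof (rule ccontr)
    assume "proj_Theta n s \<noteq> 0"
    moreover have "standard m \<and> Poly_Mapping.keys m \<subseteq> Theta n" if "m \<in> Poly_Mapping.keys (proj_Theta n s)" for m
      using that s(3) by (auto simp: in_keys_iff lookup_proj_Theta split: if_splits)
    ultimately obtain D z where z: "z \<noteq> 0"
      "eval_at (\<lambda>t. if t \<in> tuples n then minor (curve_point n D z) t else 0) (proj_Theta n s) \<noteq> 0"
      by (rule standard_independent)
    define x where "x = (\<lambda>t. if t \<in> tuples n then minor (curve_point n D z) t else 0)"
    obtain g where g: "g \<in> borel n" "x \<in> plucker n (flag_act n g (y_flag n))"
      using curve_in_orbit[OF z(1) n] unfolding x_def by blast
    define P where "P = plucker n (flag_act n g (y_flag n))"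
    have P: "P \<in> borel_orbit n" using g(1) by (auto simp: P_def borel_orbit_def)
    have xP: "x \<in> P" using g(2) by (simp add: P_def)
    have "eval_at x f = 0" using van[OF P] xP by (simp add: vanishes_at_def)
    moreover have "eval_at x h = 0"
      using h P xP borel_orbit_flags by (auto simp: plucker_ideal_def vanishing_ideal_def vanishes_at_def)
    moreover have "eval_at x (proj_Theta n s) = eval_at x s"
      using borel_orbit_support[OF P xP] by (rule eval_at_proj_Theta)
    ultimately show False using z(2) s(2) by (simp add: x_def)
  qed
  then have "proj_Theta n f = proj_Theta n h" by (simp add: s(2) proj_Theta_add)
  then show ?thesis using f h by (auto simp: I_tilde_preimage_def I_tilde_def)
qed

lemma plucker_ideal_subset: "plucker_ideal n \<subseteq> I_tilde_preimage n"
  by (auto simp: I_tilde_preimage_def I_tilde_def plucker_ideal_def vanishing_ideal_def)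

lemma I_tilde_preimage_eq:
  assumes n: "1 \<le> n"
  shows "I_tilde_preimage n = vanishing_ideal (tuples n) (schubert_variety n)"
proof (intro equalityI subsetI)
  fix f assume f: "f \<in> I_tilde_preimage n"
  then obtain h where h: "h \<in> plucker_ideal n" "proj_Theta n f = proj_Theta n h"
    by (auto simp: I_tilde_preimage_def I_tilde_def)
  have "eval_at x f = 0" if P: "P \<in> schubert_variety n" and x: "x \<in> P" for P x
  proof -
    have "eval_at x f = eval_at x (proj_Theta n f)"
      using schubert_support[OF P x] by (rule eval_at_proj_Theta[symmetric])
    also have "\<dots> = eval_at x h"
      unfolding h(2) using schubert_support[OF P x] by (rule eval_at_proj_Theta)
    also have "\<dots> = 0"
      using h(1) P x by (auto simp: plucker_ideal_def vanishing_ideal_def vanishes_at_def schubert_variety_eq)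
    finally show ?thesis .
  qed
  then show "f \<in> vanishing_ideal (tuples n) (schubert_variety n)"
    using f by (auto simp: vanishing_ideal_def vanishes_at_def I_tilde_preimage_def)
next
  fix f assume "f \<in> vanishing_ideal (tuples n) (schubert_variety n)"
  then show "f \<in> I_tilde_preimage n"
    using borel_orbit_schubert[of n] by (intro vanishing_on_orbit_imp[OF n]) (auto simp: vanishing_ideal_def)
qed

text \<open>Inadmissible variables project to 0 and so belong to the preimage, which confines its
  zeros to the coordinate subspace; there a polynomial and its projection agree.\<close>

lemma zero_locus_I_tilde_preimage: "zero_locus n (tuples n) (I_tilde_preimage n) = F_tilde n"
proof (intro equalityI subsetI)
  fix P assume P: "P \<in> zero_locus n (tuples n) (I_tilde_preimage n)"
  then obtain x where x: "P = scaling_class x" "\<And>t. t \<notin> tuples n \<Longrightarrow> x t = 0"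
    "\<forall>k\<in>{1..n}. \<exists>t\<in>tuples n. length t = k \<and> x t \<noteq> 0"
    by (auto simp: zero_locus_def multiproj_def)
  have van: "eval_at y f = 0" if "f \<in> I_tilde_preimage n" "y \<in> P" for f y
    using P that by (auto simp: zero_locus_def vanishes_at_def)
  have supp: "y t = 0" if y: "y \<in> P" and t: "t \<notin> Theta n" for y t
  proof (cases "t \<in> tuples n")
    case True
    have "proj_Theta n (Var t) = proj_Theta n 0" using t by (simp add: proj_Theta_Var proj_Theta_eq[of n 0])
    then have "Var t \<in> I_tilde_preimage n"
      using True plucker_ideal_ops(1) by (auto simp: I_tilde_preimage_def I_tilde_def poly_ring_Var)
    then show ?thesis using van[OF _ y] by fastforce
  next
    case False
    have "P \<in> multiproj n (tuples n)" using P by (simp add: zero_locus_def)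
    then show ?thesis using y False by (rule multiproj_support)
  qed
  have xP: "x \<in> P" using x(1) scaling_class_self by simp
  have "P \<in> multiproj n (Theta n)"
    unfolding multiproj_def using x(1,3) supp[OF xP] by (intro CollectI exI[of _ x]) metis
  moreover have "vanishes_at f P" if f: "f \<in> I_tilde n" for f
  proof -
    obtain h where h: "h \<in> plucker_ideal n" "f = proj_Theta n h" using f by (auto simp: I_tilde_def)
    have "eval_at y f = 0" if y: "y \<in> P" for y
    proof -
      have "eval_at y f = eval_at y h" unfolding h(2) using supp[OF y] by (rule eval_at_proj_Theta)
      then show ?thesis using van[OF _ y] h(1) plucker_ideal_subset by auto
    qed
    then show ?thesis by (simp add: vanishes_at_def)
  qed
  ultimately show "P \<in> F_tilde n" by (auto simp: F_tilde_def zero_locus_def)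
next
  fix P assume P: "P \<in> F_tilde n"
  then have mp: "P \<in> multiproj n (Theta n)" by (simp add: F_tilde_def zero_locus_def)
  then have "P \<in> multiproj n (tuples n)"
    using Theta_subset[of n] unfolding multiproj_def by blast
  moreover have "vanishes_at f P" if f: "f \<in> I_tilde_preimage n" for f
    unfolding vanishes_at_def
  proof
    fix x assume x: "x \<in> P"
    have "eval_at x f = eval_at x (proj_Theta n f)"
      using multiproj_support[OF mp x] by (rule eval_at_proj_Theta[symmetric])
    also have "\<dots> = 0"
      using f P x by (auto simp: I_tilde_preimage_def F_tilde_def zero_locus_def vanishes_at_def)
    finally show "eval_at x f = 0" .
  qed
  ultimately show "P \<in> zero_locus n (tuples n) (I_tilde_preimage n)" by (simp add: zero_locus_def)
qed

text \<open>Equations of a closed set containing the orbit vanish on the orbit, hence lie in the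
  preimage ideal. Membership in the flag variety is supplied separately by
  \<open>zero_locus_plucker_ideal\<close>.\<close>

lemma F_tilde_eq_schubert:
  assumes n: "1 \<le> n"
  shows "F_tilde n = schubert_variety n"
proof (intro equalityI subsetI)
  fix P assume "P \<in> F_tilde n"
  then have P: "P \<in> zero_locus n (tuples n) (I_tilde_preimage n)"
    by (simp add: zero_locus_I_tilde_preimage)
  then have "P \<in> zero_locus n (tuples n) (plucker_ideal n)"
    using plucker_ideal_subset by (auto simp: zero_locus_def)
  then have "P \<in> flag_variety n" using zero_locus_plucker_ideal by blast
  moreover have "P \<in> C" if C: "zariski_closed n (tuples n) C" "borel_orbit n \<subseteq> C" for C
  proof -
    obtain T where T: "T \<subseteq> poly_ring (tuples n)" "C = zero_locus n (tuples n) T"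
      using C(1) by (auto simp: zariski_closed_def)
    have "T \<subseteq> I_tilde_preimage n"
      using T C(2) by (auto intro!: vanishing_on_orbit_imp[OF n] simp: zero_locus_def)
    then show ?thesis using P by (auto simp: T(2) zero_locus_def)
  qed
  ultimately show "P \<in> schubert_variety n" by (auto simp: schubert_variety_eq zariski_closure_def)
next
  fix P assume P: "P \<in> schubert_variety n"
  then have "P \<in> multiproj n (tuples n)"
    using flag_variety_multiproj by (auto simp: schubert_variety_eq)
  then have "P \<in> zero_locus n (tuples n) (I_tilde_preimage n)"
    using P by (auto simp: I_tilde_preimage_eq[OF n] zero_locus_def vanishing_ideal_def)
  then show "P \<in> F_tilde n" by (simp add: zero_locus_I_tilde_preimage)
qed

theorem mainTheorem4:
  fixes n :: nat
  assumes "n \<ge> 2"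
  shows "y_flag n \<in> flags n
    \<and> (\<forall>g\<in>torus n. flag_act n g (y_flag n) = y_flag n)
    \<and> (\<forall>x\<in>plucker n (y_flag n). \<forall>t\<in>tuples n. x t \<noteq> 0 \<longleftrightarrow> (\<exists>k\<in>{1..n}. t = [- int k..-1]))
    \<and> F_tilde n = schubert_variety n
    \<and> zero_locus n (tuples n) (I_tilde_preimage n) = F_tilde n
    \<and> I_tilde_preimage n = vanishing_ideal (tuples n) (schubert_variety n)"
proof (intro conjI ballI)
  have n: "1 \<le> n" using assms by simp
  show "F_tilde n = schubert_variety n" by (rule F_tilde_eq_schubert[OF n])
  show "I_tilde_preimage n = vanishing_ideal (tuples n) (schubert_variety n)"
    by (rule I_tilde_preimage_eq[OF n])
qed (fact y_bases(1) torus_fixes_y y_coordinates zero_locus_I_tilde_preimage)+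

end
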